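(* Let $(M,\mathcal{D})$ be an exact contact manifold with $\mathcal{D}=\ker\eta$ and local Darboux coordinates $(q^i,p_i,s)$, and let $\mathcal{H}(q^i,p_i,s)=\sum_{j=1}^N\phi_j(q^i,p_i,s)$ be a smooth contact Hamiltonian, with the $\phi_j$ smooth and each contact Hamiltonian vector field $X_{\phi_j}$ exactly integrable. Then contact integrators of any even order can be constructed for the flow of $X_{\mathcal{H}}$: for every integer $k\ge1$ there is a finite composition of flow maps of the form $e^{c\tau X_{\phi_j}}$, with fixed real coefficients $c$ independent of $\tau$ and $j\in\{1,\dots,N\}$, that is a contact integrator of order $2k$ for $X_{\mathcal{H}}$.
   Context: An exact contact manifold is a $(2n+1)$-dimensional manifold $M$ with a hyperplane distribution $\mathcal{D}=\ker\eta$, where $\eta$ is a global $1$-form with $\eta\wedge(\mathrm{d}\eta)^n\neq0$ everywhere. Darboux coordinates are local coordinates with $\eta=\mathrm{d}s-\sum_i p_i\,\mathrm{d}q^i$. For a function $\mathcal{H}$ on $M$, the contact Hamiltonian vector field $X_{\mathcal{H}}$ is determined by $\mathcal{L}_{X_{\mathcal{H}}}\eta=\rho\,\eta$ for some function $\rho$ and $\iota_{X_{\mathcal{H}}}\eta=-\mathcal{H}$; in Darboux coordinates $$X_{\mathcal{H}}=\sum_i\frac{\partial\mathcal{H}}{\partial p_i}\frac{\partial}{\partial q^i}-\sum_i\Big(\frac{\partial\mathcal{H}}{\partial q^i}+p_i\frac{\partial\mathcal{H}}{\partial s}\Big)\frac{\partial}{\partial p_i}+\Big(\sum_i p_i\frac{\partial\mathcal{H}}{\partial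 p_i}-\mathcal{H}\Big)\frac{\partial}{\partial s}.$$ For a vector field $Y$, $e^{tY}$ denotes its time-$t$ flow map (defined where the flow exists). A vector field $Y$ is exactly integrable if the solution $x(t)=e^{tY}x_0$ of $\dot x=Y(x)$, $x(0)=x_0$, can be written explicitly in closed form (this matters only for implementability). A one-parameter family of maps $S(\tau)$ is an integrator of order $k$ for $\dot x=X(x)$ if, in local coordinates and for each $x$, $S(\tau)(x)-e^{\tau X}(x)=\mathcal{O}(\tau^{k+1})$ as $\tau\to0$. It is a contact integrator if it preserves the contact structure, i.e. each map $S(\tau)$ satisfies $S(\tau)^*\eta=\rho_\tau\,\eta$ with $\rho_\tau$ a nowhere vanishing function. *)

theory Defs
  imports "HOL-Analysis.Analysis" "HOL-Library.Landau_Symbols"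
begin

section \<open>Smooth maps between Euclidean spaces\<close>

text \<open>Both predicates are meant for open \<open>S\<close>: derivatives are taken with respect to \<open>at x\<close>.\<close>

fun Ck_on :: "nat \<Rightarrow> 'e::euclidean_space set \<Rightarrow> ('e \<Rightarrow> 'f::real_normed_vector) \<Rightarrow> bool" where
  "Ck_on 0 S f \<longleftrightarrow> continuous_on S f"
| "Ck_on (Suc k) S f \<longleftrightarrow>
     (\<forall>x\<in>S. f differentiable (at x)) \<and> (\<forall>v. Ck_on k S (\<lambda>x. frechet_derivative f (at x) v))"

definition smooth_on :: "'e::euclidean_space set \<Rightarrow> ('e \<Rightarrow> 'f::real_normed_vector) \<Rightarrow> bool" where
  "smooth_on S f \<longleftrightarrow> (\<forall>k. Ck_on k S f)"

section \<open>Smooth manifolds\<close>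

text \<open>
  A chart is a domain together with a coordinate map, whose values outside the domain are
  irrelevant.  The underlying set of a manifold is the union of the chart domains of its atlas;
  its topology is that of the ambient type, which is Hausdorff and second countable.
\<close>

type_synonym ('m, 'e) chart = "'m set \<times> ('m \<Rightarrow> 'e)"

abbreviation chart_dom :: "('m, 'e) chart \<Rightarrow> 'm set" where
  "chart_dom c \<equiv> fst c"

abbreviation coord :: "('m, 'e) chart \<Rightarrow> 'm \<Rightarrow> 'e" where
  "coord c \<equiv> snd c"

abbreviation chart_inv :: "('m, 'e) chart \<Rightarrow> 'e \<Rightarrow> 'm" where
  "chart_inv c \<equiv> inv_into (chart_dom c) (coord c)"

definition carrier :: "('m, 'e) chart set \<Rightarrow> 'm set" where
  "carrier A = (\<Union>c\<in>A. chart_dom c)"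

definition is_chart ::
    "('m::{t2_space, second_countable_topology}, 'e::euclidean_space) chart \<Rightarrow> bool" where
  "is_chart c \<longleftrightarrow> open (chart_dom c) \<and> open (coord c ` chart_dom c) \<and>
     homeomorphism (chart_dom c) (coord c ` chart_dom c) (coord c) (chart_inv c)"

definition transition :: "('m, 'e) chart \<Rightarrow> ('m, 'e) chart \<Rightarrow> 'e \<Rightarrow> 'e" where
  "transition c d = coord d \<circ> chart_inv c"

definition smooth_atlas ::
    "('m::{t2_space, second_countable_topology}, 'e::euclidean_space) chart set \<Rightarrow> bool" where
  "smooth_atlas A \<longleftrightarrow> (\<forall>c\<in>A. is_chart c) \<and>
     (\<forall>c\<in>A. \<forall>d\<in>A. smooth_on (coord c ` (chart_dom c \<inter> chart_dom d)) (transition c d))"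

definition smooth_function :: "('m, 'e::euclidean_space) chart set \<Rightarrow> ('m \<Rightarrow> real) \<Rightarrow> bool" where
  "smooth_function A f \<longleftrightarrow> (\<forall>c\<in>A. smooth_on (coord c ` chart_dom c) (f \<circ> chart_inv c))"

section \<open>Vector fields, one-forms and their calculus in coordinates\<close>

text \<open>
  Tensor fields are families of local coordinate expressions, one for each chart, that are related
  by the tensor transformation law on the overlaps.  The arguments of a coordinate expression are a
  point of the coordinate domain and, for a one-form, a tangent vector in coordinates.
\<close>

type_synonym ('m, 'e) vfield = "('m, 'e) chart \<Rightarrow> 'e \<Rightarrow> 'e"

type_synonym ('m, 'e) oneform = "('m, 'e) chart \<Rightarrow> 'e \<Rightarrow> 'e \<Rightarrow> real"

definition vector_field ::
    "('m, 'e::euclidean_space) chart set \<Rightarrow> ('m, 'e) vfield \<Rightarrow> bool" where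
  "vector_field A Y \<longleftrightarrow>
     (\<forall>c\<in>A. smooth_on (coord c ` chart_dom c) (Y c)) \<and>
     (\<forall>c\<in>A. \<forall>d\<in>A. \<forall>x \<in> chart_dom c \<inter> chart_dom d.
        Y d (coord d x) =
          frechet_derivative (transition c d) (at (coord c x)) (Y c (coord c x)))"

definition one_form ::
    "('m, 'e::euclidean_space) chart set \<Rightarrow> ('m, 'e) oneform \<Rightarrow> bool" where
  "one_form A \<eta> \<longleftrightarrow>
     (\<forall>c\<in>A. (\<forall>x \<in> chart_dom c. linear (\<eta> c (coord c x))) \<and>
             (\<forall>v. smooth_on (coord c ` chart_dom c) (\<lambda>x. \<eta> c x v))) \<and>
     (\<forall>c\<in>A. \<forall>d\<in>A. \<forall>x \<in> chart_dom c \<inter> chart_dom d. \<forall>v.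
        \<eta> c (coord c x) v =
          \<eta> d (coord d x) (frechet_derivative (transition c d) (at (coord c x)) v))"

definition ext_deriv :: "('e::euclidean_space \<Rightarrow> 'e \<Rightarrow> real) \<Rightarrow> 'e \<Rightarrow> 'e \<Rightarrow> 'e \<Rightarrow> real" where
  "ext_deriv \<alpha> x u v =
     frechet_derivative (\<lambda>y. \<alpha> y v) (at x) u - frechet_derivative (\<lambda>y. \<alpha> y u) (at x) v"

text \<open>Cartan's formula: the Lie derivative of \<open>\<alpha>\<close> along \<open>Y\<close> is
  \<open>\<iota>\<^sub>Y d\<alpha> + d (\<iota>\<^sub>Y \<alpha>)\<close>.\<close>

definition lie_deriv ::
    "('e::euclidean_space \<Rightarrow> 'e) \<Rightarrow> ('e \<Rightarrow> 'e \<Rightarrow> real) \<Rightarrow> 'e \<Rightarrow> 'e \<Rightarrow> real" where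
  "lie_deriv Y \<alpha> x v =
     ext_deriv \<alpha> x (Y x) v + frechet_derivative (\<lambda>y. \<alpha> y (Y y)) (at x) v"

text \<open>
  \<open>contact_volume n \<alpha> x v\<close> is the value of \<open>\<alpha> \<and> (d\<alpha>)\<^sup>n\<close> at \<open>x\<close> on
  the \<open>2n+1\<close> vectors \<open>v 0, \<dots>, v (2n)\<close>; the factor \<open>1 / 2^n\<close> comes from the convention
  \<open>(\<beta> \<and> \<gamma>)(v\<^sub>1, \<dots>) = 1/(p! q!) \<Sum>\<^sub>\<sigma> sign \<sigma> \<beta>(v\<^sub>\<sigma>\<^sub>1, \<dots>) \<gamma>(\<dots>)\<close>.
\<close>

definition contact_volume ::
    "nat \<Rightarrow> ('e::euclidean_space \<Rightarrow> 'e \<Rightarrow> real) \<Rightarrow> 'e \<Rightarrow> (nat \<Rightarrow> 'e) \<Rightarrow> real" where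
  "contact_volume n \<alpha> x v =
     (\<Sum>\<sigma> | \<sigma> permutes {..2 * n}.
        of_int (sign \<sigma>) * \<alpha> x (v (\<sigma> 0)) *
        (\<Prod>i<n. ext_deriv \<alpha> x (v (\<sigma> (2 * i + 1))) (v (\<sigma> (2 * i + 2))))) / 2 ^ n"

section \<open>Exact contact manifolds and contact Hamiltonian vector fields\<close>

definition exact_contact_manifold ::
    "nat \<Rightarrow> ('m::{t2_space, second_countable_topology}, 'e::euclidean_space) chart set \<Rightarrow>
     ('m, 'e) oneform \<Rightarrow> bool" where
  "exact_contact_manifold n A \<eta> \<longleftrightarrow>
     DIM('e) = 2 * n + 1 \<and> smooth_atlas A \<and> one_form A \<eta> \<and>
     (\<forall>c\<in>A. \<forall>x \<in> chart_dom c. \<exists>v. contact_volume n (\<eta> c) (coord c x) v \<noteq> 0)"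

definition contact_hamiltonian_vf ::
    "('m, 'e::euclidean_space) chart set \<Rightarrow> ('m, 'e) oneform \<Rightarrow> ('m \<Rightarrow> real) \<Rightarrow>
     ('m, 'e) vfield \<Rightarrow> bool" where
  "contact_hamiltonian_vf A \<eta> H Y \<longleftrightarrow> vector_field A Y \<and>
     (\<exists>\<rho> :: 'm \<Rightarrow> real. \<forall>c\<in>A. \<forall>x \<in> chart_dom c.
        \<forall>v. lie_deriv (Y c) (\<eta> c) (coord c x) v = \<rho> x * \<eta> c (coord c x) v) \<and>
     (\<forall>c\<in>A. \<forall>x \<in> chart_dom c. \<eta> c (coord c x) (Y c (coord c x)) = - H x)"

section \<open>Flows\<close>

definition integral_curve ::
    "('m::topological_space, 'e::euclidean_space) chart set \<Rightarrow> ('m, 'e) vfield \<Rightarrow>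
     real set \<Rightarrow> (real \<Rightarrow> 'm) \<Rightarrow> bool" where
  "integral_curve A Y I \<gamma> \<longleftrightarrow> continuous_on I \<gamma> \<and> \<gamma> ` I \<subseteq> carrier A \<and>
     (\<forall>t\<in>I. \<forall>c\<in>A. \<gamma> t \<in> chart_dom c \<longrightarrow>
        ((coord c \<circ> \<gamma>) has_vector_derivative Y c (coord c (\<gamma> t))) (at t within I))"

definition flows_to ::
    "('m::topological_space, 'e::euclidean_space) chart set \<Rightarrow> ('m, 'e) vfield \<Rightarrow>
     real \<Rightarrow> 'm \<Rightarrow> 'm \<Rightarrow> bool" where
  "flows_to A Y t x y \<longleftrightarrow>
     (\<exists>\<gamma>. integral_curve A Y (closed_segment 0 t) \<gamma> \<and> \<gamma> 0 = x \<and> \<gamma> t = y)"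

text \<open>The time-\<open>t\<close> flow map is a partial map; \<open>t\<close> may be negative.\<close>

definition flow ::
    "('m::topological_space, 'e::euclidean_space) chart set \<Rightarrow> ('m, 'e) vfield \<Rightarrow>
     real \<Rightarrow> 'm \<rightharpoonup> 'm" where
  "flow A Y t x = (if \<exists>y. flows_to A Y t x y then Some (THE y. flows_to A Y t x y) else None)"

text \<open>\<open>flow_composition A X [(c\<^sub>1, j\<^sub>1), \<dots>, (c\<^sub>m, j\<^sub>m)] \<tau>\<close> applies the time-\<open>c\<^sub>m \<tau>\<close> flow of
  \<open>X j\<^sub>m\<close> first.\<close>

definition flow_composition ::
    "('m::topological_space, 'e::euclidean_space) chart set \<Rightarrow> (nat \<Rightarrow> ('m, 'e) vfield) \<Rightarrow>
     (real \<times> nat) list \<Rightarrow> real \<Rightarrow> 'm \<rightharpoonup> 'm" where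
  "flow_composition A X cs \<tau> = foldr (\<lambda>(c, j) f. flow A (X j) (c * \<tau>) \<circ>\<^sub>m f) cs Some"

section \<open>Contact integrators\<close>

text \<open>The coordinate expression of a partial map of the manifold, from chart \<open>c\<close> to chart \<open>d\<close>.\<close>

definition local_expr ::
    "('m, 'e) chart \<Rightarrow> ('m, 'e) chart \<Rightarrow> ('m \<rightharpoonup> 'm) \<Rightarrow> 'e \<Rightarrow> 'e" where
  "local_expr c d f = coord d \<circ> the \<circ> f \<circ> chart_inv c"

text \<open>
  \<open>f\<^sup>* \<eta> = \<rho> \<eta>\<close> on the domain of the partial map \<open>f\<close>, with \<open>\<rho>\<close> nowhere vanishing there.
  Openness of the domain and continuity of \<open>f\<close> ensure that every coordinate expression is
  meaningful in a neighbourhood of the point at which it is differentiated.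
\<close>

definition contact_map ::
    "('m::topological_space, 'e::euclidean_space) chart set \<Rightarrow> ('m, 'e) oneform \<Rightarrow>
     ('m \<rightharpoonup> 'm) \<Rightarrow> bool" where
  "contact_map A \<eta> f \<longleftrightarrow>
     open (dom f) \<and> dom f \<subseteq> carrier A \<and> ran f \<subseteq> carrier A \<and>
     continuous_on (dom f) (the \<circ> f) \<and>
     (\<exists>\<rho> :: 'm \<Rightarrow> real. \<forall>x y. f x = Some y \<longrightarrow> \<rho> x \<noteq> 0 \<and>
        (\<forall>c\<in>A. \<forall>d\<in>A. x \<in> chart_dom c \<longrightarrow> y \<in> chart_dom d \<longrightarrow>
           local_expr c d f differentiable (at (coord c x)) \<and>
           (\<forall>v. \<eta> d (coord d y) (frechet_derivative (local_expr c d f) (at (coord c x)) v) =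
                \<rho> x * \<eta> c (coord c x) v)))"

definition contact_integrator ::
    "('m::topological_space, 'e::euclidean_space) chart set \<Rightarrow> ('m, 'e) oneform \<Rightarrow>
     (real \<Rightarrow> 'm \<rightharpoonup> 'm) \<Rightarrow> bool" where
  "contact_integrator A \<eta> S \<longleftrightarrow> (\<forall>\<tau>. contact_map A \<eta> (S \<tau>))"

definition integrator_of_order ::
    "('m::topological_space, 'e::euclidean_space) chart set \<Rightarrow> ('m, 'e) vfield \<Rightarrow> nat \<Rightarrow>
     (real \<Rightarrow> 'm \<rightharpoonup> 'm) \<Rightarrow> bool" where
  "integrator_of_order A Y k S \<longleftrightarrow>
     (\<forall>c\<in>A. \<forall>x \<in> chart_dom c.
        (\<forall>\<^sub>F \<tau> in at 0. \<exists>y \<in> chart_dom c. S \<tau> x = Some y) \<and>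
        (\<forall>\<^sub>F \<tau> in at 0. \<exists>y \<in> chart_dom c. flow A Y \<tau> x = Some y) \<and>
        (\<lambda>\<tau>. norm (coord c (the (S \<tau> x)) - coord c (the (flow A Y \<tau> x)))) \<in> O[at 0](\<lambda>\<tau>. \<tau> ^ (k + 1)))"

end

theory Submission
  imports Defs
begin

text \<open>
  Flows of contact Hamiltonian vector fields are contact maps: if \<open>W\<close> solves the variational equation
  along an integral curve \<open>z\<close>, then \<open>\<eta> (z t) (W t v)\<close> satisfies a scalar linear equation with
  coefficient \<open>\<rho> (z t)\<close>, so it is a nonzero multiple of \<open>\<eta> (z 0) v\<close> that does not depend on \<open>v\<close>.  Long
  times are reached by composing short-time flows along a compact curve.

  For the order, nondegeneracy of \<open>\<eta>\<close> gives \<open>X_H = \<Sum>j. X j\<close>.  Taylor expansion along integral curves turns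
  a composition of flows into a Lie series whose coefficients are those of a product of exponentials in
  noncommuting letters, one letter per \<open>X j\<close>; no smooth dependence on initial values is needed here.  It
  therefore suffices to approximate the exponential of the sum of the letters up to degree \<open>2 k\<close>.  A
  palindromic product that is correct up to an odd degree is automatically correct one degree further,
  and the triple jump \<open>p, q, p\<close> of Yoshida and Suzuki with \<open>2 p + q = 1\<close> and \<open>2 p ^ (2 k + 1) + q ^ (2 k + 1) = 0\<close> gains one
  degree while keeping the palindrome, so the order can be raised by two at a time.
\<close>

text \<open>Two features of the definitions shape the proof. Flows are partial maps, and
  \<open>contact_map\<close> is required for every \<tau>, not only for small ones: the domain must
  be open and the map conformal at each of its points. The contact property is therefore handled
  pointwise, on germs, which can be composed and extended freely. Secondly, a remainder estimate for
  a single initial point cannot be iterated, because each flow of a composition starts where the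
  previous one ends. All expansions are therefore uniform for initial points near a given
  \<open>x0\<close>, and they are proved for every smooth \<open>f\<close>, since expanding one flow
  produces iterated derivatives of \<open>f\<close> as new functions to be expanded along the next.

  Why parity enters: a palindromic product T satisfies T(-t) T(t) = 1, which rules out a leading
  error of even degree. The equation for \<open>p\<close> and \<open>q\<close> has no real solution
  with \<open>2 * p + q = 1\<close> when the exponent is even, and has one when it is odd. So the
  two devices alternate: the triple jump reaches an odd degree, the palindrome the next even one.
  The solution has \<open>q < 0\<close>, hence some flows run backwards in time.\<close>

section \<open>Calculus of smooth maps\<close>

lemma frechet_derivative_eq:
  "(f has_derivative f') (at x) \<Longrightarrow> frechet_derivative f (at x) = f'"
  by (metis frechet_derivative_at)

lemma frechet_derivative_cong:
  assumes "open S" "x \<in> S" "\<And>y. y \<in> S \<Longrightarrow> f y = g y" "f differentiable (at x)"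
  shows "frechet_derivative g (at x) = frechet_derivative f (at x)"
proof (rule frechet_derivative_eq)
  have "(f has_derivative frechet_derivative f (at x)) (at x)"
    using assms(4) by (simp add: frechet_derivative_works)
  then show "(g has_derivative frechet_derivative f (at x)) (at x)"
    by (rule has_derivative_transform_within_open[OF _ assms(1-3)])
qed

lemma differentiable_cong_open:
  assumes "open S" "x \<in> S" "\<And>y. y \<in> S \<Longrightarrow> f y = g y" "f differentiable (at x)"
  shows "g differentiable (at x)"
proof -
  obtain f' where "(f has_derivative f') (at x)"
    using assms(4) by (auto simp: differentiable_def)
  then have "(g has_derivative f') (at x)"
    by (rule has_derivative_transform_within_open[OF _ assms(1-3)])
  then show ?thesis by (auto simp: differentiable_def)
qed

lemma Ck_on_cong:
  "open S \<Longrightarrow> (\<And>y. y \<in> S \<Longrightarrow> f y = g y) \<Longrightarrow> Ck_on k S f \<Longrightarrow> Ck_on k S g"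
proof (induction k arbitrary: f g)
  case 0
  then show ?case by (simp cong: continuous_on_cong)
next
  case (Suc k)
  have "g differentiable (at x)" if "x \<in> S" for x
    by (rule differentiable_cong_open[OF _ that, of f]) (use Suc.prems that in auto)
  moreover have "Ck_on k S (\<lambda>x. frechet_derivative g (at x) v)" for v
  proof (rule Suc.IH)
    show "Ck_on k S (\<lambda>x. frechet_derivative f (at x) v)" using Suc.prems by simp
    show "frechet_derivative f (at y) v = frechet_derivative g (at y) v" if "y \<in> S" for y
      using Suc.prems frechet_derivative_cong[of S y f g] that by auto
  qed (use Suc.prems in auto)
  ultimately show ?case by simp
qed

lemma Ck_on_continuous: "Ck_on k S f \<Longrightarrow> continuous_on S f"
  by (cases k) (auto simp: continuous_at_imp_continuous_on differentiable_imp_continuous_within)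

lemma Ck_on_SucD: "Ck_on (Suc k) S f \<Longrightarrow> Ck_on k S f"
  by (induction k arbitrary: f)
    (auto simp: continuous_at_imp_continuous_on differentiable_imp_continuous_within)

lemma Ck_on_const: "Ck_on k S (\<lambda>x. c)"
proof (induction k arbitrary: c)
  case (Suc k)
  have "frechet_derivative (\<lambda>x. c) (at x) = (\<lambda>v. 0)" for x
    by (rule frechet_derivative_eq) simp
  with Suc[of 0] show ?case by simp
qed simp

lemma Ck_on_bounded_linear:
  assumes "open S" "bounded_linear h"
  shows "Ck_on k S f \<Longrightarrow> Ck_on k S (\<lambda>x. h (f x))"
proof (induction k arbitrary: f)
  case 0
  then show ?case
    using assms(2) by (simp add: bounded_linear.continuous_on)
next
  case (Suc k)
  have d: "((\<lambda>x. h (f x)) has_derivative (\<lambda>v. h (frechet_derivative f (at x) v))) (at x)" if "x \<in> S" for x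
    by (rule bounded_linear.has_derivative[OF assms(2)])
      (use Suc.prems that in \<open>simp add: frechet_derivative_works\<close>)
  have "Ck_on k S (\<lambda>x. frechet_derivative (\<lambda>x. h (f x)) (at x) v)" for v
    by (rule Ck_on_cong[OF \<open>open S\<close> _ Suc.IH[of "\<lambda>x. frechet_derivative f (at x) v"]])
      (use Suc.prems frechet_derivative_eq[OF d] in auto)
  with d show ?case by (auto simp: differentiable_def)
qed

lemma Ck_on_add:
  assumes "open S"
  shows "Ck_on k S f \<Longrightarrow> Ck_on k S g \<Longrightarrow> Ck_on k S (\<lambda>x. f x + g x)"
proof (induction k arbitrary: f g)
  case 0
  then show ?case by (simp add: continuous_on_add)
next
  case (Suc k)
  have d: "((\<lambda>x. f x + g x) has_derivative
      (\<lambda>v. frechet_derivative f (at x) v + frechet_derivative g (at x) v)) (at x)" if "x \<in> S" for x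
    using Suc.prems that by (intro has_derivative_add) (auto simp: frechet_derivative_works)
  have "Ck_on k S (\<lambda>x. frechet_derivative (\<lambda>x. f x + g x) (at x) v)" for v
    by (rule Ck_on_cong[OF \<open>open S\<close> _ Suc.IH[of "\<lambda>x. frechet_derivative f (at x) v" "\<lambda>x. frechet_derivative g (at x) v"]])
      (use Suc.prems frechet_derivative_eq[OF d] in auto)
  with d show ?case by (auto simp: differentiable_def)
qed

lemma Ck_on_sum:
  assumes "open S"
  shows "(\<And>i. i \<in> I \<Longrightarrow> Ck_on k S (f i)) \<Longrightarrow> Ck_on k S (\<lambda>x. \<Sum>i\<in>I. f i x)"
  by (induction I rule: infinite_finite_induct) (auto intro: Ck_on_const Ck_on_add[OF assms])

lemma Ck_on_bounded_bilinear:
  assumes "open S" "bounded_bilinear h"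
  shows "Ck_on k S f \<Longrightarrow> Ck_on k S g \<Longrightarrow> Ck_on k S (\<lambda>x. h (f x) (g x))"
proof (induction k arbitrary: f g)
  case 0
  then show ?case
    using assms(2) by (simp add: bounded_bilinear.continuous_on)
next
  case (Suc k)
  have d: "((\<lambda>x. h (f x) (g x)) has_derivative
      (\<lambda>v. h (f x) (frechet_derivative g (at x) v) + h (frechet_derivative f (at x) v) (g x))) (at x)"
    if "x \<in> S" for x
    using Suc.prems that by (intro bounded_bilinear.FDERIV[OF assms(2)]) (auto simp: frechet_derivative_works)
  have "Ck_on k S (\<lambda>x. frechet_derivative (\<lambda>x. h (f x) (g x)) (at x) v)" for v
  proof (rule Ck_on_cong[OF \<open>open S\<close>])
    have "Ck_on k S f" "Ck_on k S g"
      using Suc.prems Ck_on_SucD by blast+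
    then show "Ck_on k S (\<lambda>x. h (f x) (frechet_derivative g (at x) v) + h (frechet_derivative f (at x) v) (g x))"
      using Suc.prems by (intro Ck_on_add[OF \<open>open S\<close> Suc.IH Suc.IH]) auto
  qed (simp add: frechet_derivative_eq[OF d])
  with d show ?case by (auto simp: differentiable_def)
qed

lemma smooth_on_cong:
  "open S \<Longrightarrow> (\<And>y. y \<in> S \<Longrightarrow> f y = g y) \<Longrightarrow> smooth_on S f \<Longrightarrow> smooth_on S g"
  unfolding smooth_on_def using Ck_on_cong[of S f g] by simp

lemma smooth_on_differentiable: "smooth_on S f \<Longrightarrow> x \<in> S \<Longrightarrow> f differentiable (at x)"
  unfolding smooth_on_def by (drule spec[of _ "Suc 0"]) simp

lemma smooth_on_has_derivative:
  "smooth_on S f \<Longrightarrow> x \<in> S \<Longrightarrow> (f has_derivative frechet_derivative f (at x)) (at x)"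
  using smooth_on_differentiable frechet_derivative_works by blast

lemma smooth_on_continuous: "smooth_on S f \<Longrightarrow> continuous_on S f"
  unfolding smooth_on_def using Ck_on_continuous by blast

lemma smooth_on_derivative: "smooth_on S f \<Longrightarrow> smooth_on S (\<lambda>x. frechet_derivative f (at x) v)"
  unfolding smooth_on_def
proof
  fix k assume "\<forall>k. Ck_on k S f"
  then have "Ck_on (Suc k) S f" by blast
  then show "Ck_on k S (\<lambda>x. frechet_derivative f (at x) v)" by simp
qed

lemma smooth_on_sum:
  "open S \<Longrightarrow> (\<And>i. i \<in> I \<Longrightarrow> smooth_on S (f i)) \<Longrightarrow> smooth_on S (\<lambda>x. \<Sum>i\<in>I. f i x)"
  unfolding smooth_on_def by (simp add: Ck_on_sum)

lemma smooth_on_scaleR: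
  "open S \<Longrightarrow> smooth_on S f \<Longrightarrow> smooth_on S g \<Longrightarrow> smooth_on S (\<lambda>x. f x *\<^sub>R g x)"
  unfolding smooth_on_def by (simp add: Ck_on_bounded_bilinear[OF _ bounded_bilinear_scaleR])

lemma smooth_on_inner: "open S \<Longrightarrow> smooth_on S f \<Longrightarrow> smooth_on S (\<lambda>x. f x \<bullet> b)"
  unfolding smooth_on_def by (simp add: Ck_on_bounded_linear[OF _ bounded_linear_inner_left])

lemma smooth_on_add:
  "open S \<Longrightarrow> smooth_on S f \<Longrightarrow> smooth_on S g \<Longrightarrow> smooth_on S (\<lambda>x. f x + g x)"
  unfolding smooth_on_def by (simp add: Ck_on_add)

lemma smooth_on_ident:
  assumes "open S" shows "smooth_on S (\<lambda>x. x)"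
proof -
  have "Ck_on k S (\<lambda>x. x)" for k
  proof (cases k)
    case (Suc l)
    have "Ck_on l S (\<lambda>x. frechet_derivative (\<lambda>x. x) (at x) v)" for v :: 'a
      by (rule Ck_on_cong[OF assms _ Ck_on_const[of l S v]]) (simp add: frechet_derivative_eq[OF has_derivative_ident])
    then show ?thesis using Suc by simp
  qed simp
  then show ?thesis by (simp add: smooth_on_def)
qed

section \<open>Directional and total derivatives, mean value estimates\<close>

lemma linear_eq_sum_Basis:
  fixes f :: "'a::euclidean_space \<Rightarrow> 'b::real_normed_vector"
  assumes "linear f" shows "f v = (\<Sum>b\<in>Basis. (v \<bullet> b) *\<^sub>R f b)"
proof -
  have "f v = f (\<Sum>b\<in>Basis. (v \<bullet> b) *\<^sub>R b)" by (simp add: euclidean_representation)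
  also have "\<dots> = (\<Sum>b\<in>Basis. (v \<bullet> b) *\<^sub>R f b)"
    by (simp only: linear_sum[OF assms] linear_scale[OF assms])
  finally show ?thesis .
qed

text \<open>The Lie derivative of \<open>f\<close> along \<open>Y\<close>. The values of
  \<open>f\<close> may be vectors, so that the identity can be inserted for \<open>f\<close>; its
  iterated derivatives are the Taylor coefficients of the flow itself.\<close>

definition dir_deriv :: "('e::euclidean_space \<Rightarrow> 'e) \<Rightarrow> ('e \<Rightarrow> 'f::real_normed_vector) \<Rightarrow> 'e \<Rightarrow> 'f" where
  "dir_deriv Y f x = frechet_derivative f (at x) (Y x)"

text \<open>\<open>smooth_on\<close> speaks of derivatives in a fixed direction only. Expanding
  \<open>Y x\<close> in the basis reduces the moving direction to finitely many fixed ones.\<close>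

lemma smooth_on_dir_deriv:
  assumes "open S" "smooth_on S Y" "smooth_on S f"
  shows "smooth_on S (dir_deriv Y f)"
proof (rule smooth_on_cong[OF \<open>open S\<close>])
  show "smooth_on S (\<lambda>x. \<Sum>b\<in>Basis. (Y x \<bullet> b) *\<^sub>R frechet_derivative f (at x) b)"
    by (intro smooth_on_sum smooth_on_scaleR smooth_on_inner smooth_on_derivative assms)
  show "(\<Sum>b\<in>Basis. (Y x \<bullet> b) *\<^sub>R frechet_derivative f (at x) b) = dir_deriv Y f x" if "x \<in> S" for x
    unfolding dir_deriv_def
    by (rule linear_eq_sum_Basis[symmetric])
      (rule has_derivative_linear[OF smooth_on_has_derivative[OF assms(3) that]])
qed

text \<open>The derivative as an element of a Banach space. Its continuity in operator norm can then
  be stated, and the variational equation becomes an ordinary differential equation to which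
  \<open>picard\<close> applies.\<close>

definition total_deriv :: "('e::euclidean_space \<Rightarrow> 'f::real_normed_vector) \<Rightarrow> 'e \<Rightarrow> 'e \<Rightarrow>\<^sub>L 'f" where
  "total_deriv f x = Blinfun (frechet_derivative f (at x))"

lemma total_deriv_apply:
  "f differentiable (at x) \<Longrightarrow> blinfun_apply (total_deriv f x) = frechet_derivative f (at x)"
  unfolding total_deriv_def
  by (intro bounded_linear_Blinfun_apply has_derivative_bounded_linear) (simp add: frechet_derivative_works)

lemma total_deriv_has_derivative:
  "smooth_on S f \<Longrightarrow> x \<in> S \<Longrightarrow> (f has_derivative blinfun_apply (total_deriv f x)) (at x)"
  by (simp add: smooth_on_differentiable smooth_on_has_derivative total_deriv_apply)

lemma continuous_on_total_deriv:
  assumes "smooth_on S f" shows "continuous_on S (total_deriv f)"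
proof (rule continuous_on_blinfun_componentwise)
  fix i :: 'a assume "i \<in> Basis"
  show "continuous_on S (\<lambda>x. blinfun_apply (total_deriv f x) i)"
    using smooth_on_continuous[OF smooth_on_derivative[OF assms]]
    by (rule continuous_on_eq) (simp add: total_deriv_apply smooth_on_differentiable[OF assms])
qed

lemma smooth_on_Lipschitz:
  assumes "smooth_on S f" "compact K" "convex K" "K \<subseteq> S"
  obtains L where "L \<ge> 0" "\<And>x. x \<in> K \<Longrightarrow> norm (total_deriv f x) \<le> L"
    "\<And>x y. x \<in> K \<Longrightarrow> y \<in> K \<Longrightarrow> norm (f x - f y) \<le> L * norm (x - y)"
proof -
  have "compact (total_deriv f ` K)"
    by (intro compact_continuous_image continuous_on_subset[OF continuous_on_total_deriv[OF assms(1)]] assms)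
  then obtain B where B: "\<And>x. x \<in> K \<Longrightarrow> norm (total_deriv f x) \<le> B"
    using compact_imp_bounded bounded_iff by (metis imageI)
  \<comment> \<open>\<open>K\<close> may be empty, and then nothing forces \<open>B\<close> to be
    nonnegative.\<close>
  have "norm (f x - f y) \<le> max B 0 * norm (x - y)" if "x \<in> K" "y \<in> K" for x y
  proof (rule differentiable_bound[OF \<open>convex K\<close> _ _ that])
    show "(f has_derivative blinfun_apply (total_deriv f x)) (at x within K)" if "x \<in> K" for x
      using total_deriv_has_derivative[OF assms(1)] assms(4) that has_derivative_at_withinI by blast
    show "onorm (blinfun_apply (total_deriv f x)) \<le> max B 0" if "x \<in> K" for x
      using B[OF that] by (simp add: norm_blinfun.rep_eq)
  qed
  then show thesis using that[of "max B 0"] B by (simp add: le_max_iff_disj)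
qed

text \<open>Each partial derivative is Lipschitz on \<open>K\<close>; summing the constants over the
  basis makes the total derivative Lipschitz, and the mean value inequality on the segment from
  \<open>x\<close> to \<open>y\<close> gives a quadratic remainder. This is the estimate behind the
  differentiability of flows in the initial value.\<close>

lemma smooth_on_quadratic_remainder:
  assumes "smooth_on S f" "compact K" "convex K" "K \<subseteq> S"
  obtains C where "C \<ge> 0" "\<And>x y. x \<in> K \<Longrightarrow> y \<in> K \<Longrightarrow>
     norm (f y - f x - blinfun_apply (total_deriv f x) (y - x)) \<le> C * norm (y - x) ^ 2"
proof -
  have "\<exists>L\<ge>0. \<forall>x\<in>K. \<forall>y\<in>K. norm (frechet_derivative f (at x) b - frechet_derivative f (at y) b) \<le> L * norm (x - y)" for b
    by (rule smooth_on_Lipschitz[OF smooth_on_derivative[OF assms(1)] assms(2-4), of b]) blast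
  then obtain L where L0: "\<And>b. L b \<ge> 0" and
    L: "\<And>b x y. x \<in> K \<Longrightarrow> y \<in> K \<Longrightarrow> norm (frechet_derivative f (at x) b - frechet_derivative f (at y) b) \<le> L b * norm (x - y)"
    by metis
  define C where "C = (\<Sum>b\<in>Basis. L b)"
  have C: "norm (total_deriv f x - total_deriv f y) \<le> C * norm (x - y)" if "x \<in> K" "y \<in> K" for x y
  proof (rule norm_blinfun_bound)
    fix v
    have "norm (blinfun_apply (total_deriv f x - total_deriv f y) v) =
        norm (\<Sum>b\<in>Basis. (v \<bullet> b) *\<^sub>R (frechet_derivative f (at x) b - frechet_derivative f (at y) b))"
      using that assms(4) blinfun.bounded_linear_right bounded_linear.linear
      by (subst linear_eq_sum_Basis[of "blinfun_apply (total_deriv f x - total_deriv f y)"])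
        (auto simp: blinfun.diff_left total_deriv_apply smooth_on_differentiable[OF assms(1)] subset_eq)
    also have "\<dots> \<le> (\<Sum>b\<in>Basis. norm v * (L b * norm (x - y)))"
      using L[OF that] Basis_le_norm[of _ v]
      by (intro order_trans[OF norm_sum] sum_mono) (auto intro!: mult_mono)
    also have "\<dots> = C * norm (x - y) * norm v"
      by (simp add: C_def sum_distrib_left sum_distrib_right mult_ac)
    finally show "norm (blinfun_apply (total_deriv f x - total_deriv f y) v) \<le> C * norm (x - y) * norm v" .
  qed (simp add: C_def L0 sum_nonneg)
  have "norm (f y - f x - blinfun_apply (total_deriv f x) (y - x)) \<le> C * norm (y - x) ^ 2" if xy: "x \<in> K" "y \<in> K" for x y
  proof -
    have seg: "closed_segment x y \<subseteq> K" using assms(3) xy by (simp add: closed_segment_subset)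
    have "norm (f y - f x - blinfun_apply (total_deriv f x) (y - x)) \<le> norm (y - x) * (C * norm (y - x))"
    proof (rule differentiable_bound_linearization[of x y "closed_segment x y" f "\<lambda>x. blinfun_apply (total_deriv f x)"])
      show "x + t *\<^sub>R (y - x) \<in> closed_segment x y" if "t \<in> {0..1}" for t
        using that by (auto simp: closed_segment_def algebra_simps intro!: exI[of _ t])
      show "(f has_derivative blinfun_apply (total_deriv f z)) (at z within closed_segment x y)" if "z \<in> closed_segment x y" for z
        using total_deriv_has_derivative[OF assms(1)] assms(4) that seg has_derivative_at_withinI by blast
      show "onorm (blinfun_apply (total_deriv f z) - blinfun_apply (total_deriv f x)) \<le> C * norm (y - x)" if "z \<in> closed_segment x y" for z
      proof -
        have "norm (total_deriv f z - total_deriv f x) \<le> C * norm (z - x)"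
          using C seg xy that by auto
        also have "\<dots> \<le> C * norm (y - x)"
          using segment_bound1[OF that] by (intro mult_left_mono) (auto simp: C_def L0 sum_nonneg)
        finally show ?thesis by (simp add: norm_blinfun.rep_eq minus_blinfun.rep_eq fun_diff_def)
      qed
    qed simp
    then show ?thesis by (simp add: power2_eq_square mult_ac)
  qed
  then show thesis using that[of C] by (simp add: C_def L0 sum_nonneg)
qed

section \<open>Ordinary differential equations\<close>

lemma vector_derivative_bound:
  fixes f :: "real \<Rightarrow> 'a::real_normed_vector"
  assumes "convex J" "\<And>t. t \<in> J \<Longrightarrow> (f has_vector_derivative f' t) (at t within J)"
    and "\<And>t. t \<in> J \<Longrightarrow> norm (f' t) \<le> B" "s \<in> J" "t \<in> J"
  shows "norm (f t - f s) \<le> B * \<bar>t - s\<bar>"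
proof -
  have "norm (f t - f s) \<le> B * norm (t - s)"
  proof (rule differentiable_bound[OF \<open>convex J\<close> _ _ \<open>t \<in> J\<close> \<open>s \<in> J\<close>])
    show "(f has_derivative (\<lambda>h. h *\<^sub>R f' t)) (at t within J)" if "t \<in> J" for t
      using assms(2)[OF that] by (simp add: has_vector_derivative_def)
    show "onorm (\<lambda>h. h *\<^sub>R f' t) \<le> B" if "t \<in> J" for t
      using assms(3)[OF that] by (intro onorm_le) (simp add: mult.commute[of B] mult_left_mono)
  qed
  then show ?thesis by simp
qed

text \<open>A short-time substitute for Gronwall's inequality: on an interval of length at most \<open>1 / (2 L)\<close>
  the linear term can be absorbed into the maximum of the left-hand side.\<close>

lemma short_time_gronwall:
  fixes r :: "real \<Rightarrow> 'a::real_normed_vector"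
  assumes J: "compact J" "convex J" "t0 \<in> J" "\<And>t. t \<in> J \<Longrightarrow> \<bar>t - t0\<bar> \<le> \<delta>"
    and r: "\<And>t. t \<in> J \<Longrightarrow> (r has_vector_derivative r' t) (at t within J)"
    and b: "\<And>t. t \<in> J \<Longrightarrow> norm (r' t) \<le> L * norm (r t) + M"
    and L: "L \<ge> 0" "M \<ge> 0" "\<delta> * L \<le> 1/2" and t: "t \<in> J"
  shows "norm (r t) \<le> 2 * norm (r t0) + 2 * \<delta> * M"
proof -
  have "continuous_on J r"
    by (rule continuous_on_vector_derivative[OF r])
  then have "continuous_on J (\<lambda>t. norm (r t))" by (rule continuous_on_norm)
  then obtain u where u: "u \<in> J" "\<And>t. t \<in> J \<Longrightarrow> norm (r t) \<le> norm (r u)"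
    using continuous_attains_sup[of J "\<lambda>t. norm (r t)"] J by blast
  have "norm (r u - r t0) \<le> (L * norm (r u) + M) * \<bar>u - t0\<bar>"
  proof (rule vector_derivative_bound[OF \<open>convex J\<close> r])
    show "norm (r' t) \<le> L * norm (r u) + M" if "t \<in> J" for t
      using b[OF that] u(2)[OF that] mult_left_mono[OF _ L(1)] by fastforce
  qed (use u J in auto)
  also have "\<dots> \<le> (L * norm (r u) + M) * \<delta>"
    using J(4)[OF u(1)] L by (intro mult_left_mono) auto
  also have "\<dots> = (\<delta> * L) * norm (r u) + \<delta> * M" by (simp add: algebra_simps)
  also have "\<dots> \<le> 1/2 * norm (r u) + \<delta> * M"
    using L by (intro add_right_mono mult_right_mono) auto
  finally have "norm (r u) \<le> 2 * norm (r t0) + 2 * \<delta> * M"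
    using norm_triangle_sub[of "r u" "r t0"] by linarith
  then show ?thesis using u(2)[OF t] by linarith
qed

text \<open>Picard-Lindelof on a two-sided interval, for a time-dependent field in a Banach space:
  it is applied to integral curves and to the operator-valued variational equation. The bound
  \<open>\<delta> * M \<le> R\<close> keeps the iterates in the ball, and
  \<open>\<delta> * L \<le> 1/2\<close> makes the iteration a contraction with constant 1/2. Curves
  are bounded continuous functions on the whole line, constant outside the interval, so that
  completeness comes from the supremum metric.\<close>

lemma picard:
  fixes f :: "real \<Rightarrow> 'a::banach \<Rightarrow> 'a"
  assumes \<delta>: "\<delta> \<ge> 0" "\<delta> * M \<le> R" "\<delta> * L \<le> 1/2" and "R \<ge> 0" "L \<ge> 0"
    and cont: "continuous_on ({-\<delta>..\<delta>} \<times> cball x R) (\<lambda>(t, y). f t y)"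
    and bound: "\<And>t y. t \<in> {-\<delta>..\<delta>} \<Longrightarrow> y \<in> cball x R \<Longrightarrow> norm (f t y) \<le> M"
    and lip: "\<And>t y z. t \<in> {-\<delta>..\<delta>} \<Longrightarrow> y \<in> cball x R \<Longrightarrow> z \<in> cball x R \<Longrightarrow>
      norm (f t y - f t z) \<le> L * norm (y - z)"
  shows "\<exists>z. z 0 = x \<and> (\<forall>t\<in>{-\<delta>..\<delta>}. z t \<in> cball x R \<and> (z has_vector_derivative f t (z t)) (at t within {-\<delta>..\<delta>}))"
proof -
  define J where "J = {-\<delta>..\<delta>}"
  have J: "convex J" "0 \<in> J" "\<And>t. t \<in> J \<Longrightarrow> \<bar>t\<bar> \<le> \<delta>" using \<delta>(1) by (auto simp: J_def)
  define S :: "(real \<Rightarrow>\<^sub>C 'a) set" where "S = PiC UNIV (\<lambda>_. cball x R)"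
  have S: "u \<in> S \<longleftrightarrow> (\<forall>t. u t \<in> cball x R)" for u by (simp add: S_def mem_PiC_iff Pi_iff)
  have "complete S"
    unfolding S_def by (simp add: complete_eq_closed closed_PiC)
  moreover have "S \<noteq> {}"
    using S[of "const_bcontfun x"] \<open>R \<ge> 0\<close> by auto
  \<comment> \<open>\<open>P u g\<close> says that \<open>g\<close> is the Picard iterate of
    \<open>u\<close>. The last conjunct fixes \<open>g\<close> outside the interval; the distance of
    two iterates is a supremum over all real times and would otherwise not be controlled by their
    values on \<open>J\<close>.\<close>
  define P where "P u g \<longleftrightarrow> g 0 = x \<and> (\<forall>t\<in>J. (apply_bcontfun g has_vector_derivative f t (apply_bcontfun u t)) (at t within J))
    \<and> (\<forall>t. apply_bcontfun g t = g (clamp (-\<delta>) \<delta> t))" for u g :: "real \<Rightarrow>\<^sub>C 'a"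
  have clamp: "clamp (-\<delta>) \<delta> t \<in> J" for t
    using clamp_in_interval[of "-\<delta>" \<delta> t] \<delta>(1) by (simp add: J_def)
  have "\<exists>g\<in>S. P u g" if u: "u \<in> S" for u
  proof -
    have c: "continuous_on J (\<lambda>t. (t, apply_bcontfun u t))"
      by (intro continuous_on_Pair continuous_on_id continuous_on_apply_bcontfun)
    have "continuous_on J (\<lambda>t. f t (u t))"
      using continuous_on_compose2[OF cont c] u S by (auto simp: J_def image_subset_iff)
    then obtain G where G: "\<And>t. t \<in> J \<Longrightarrow> (G has_vector_derivative f t (u t)) (at t within J)"
      unfolding J_def using antiderivative_continuous by blast
    have Gx: "((\<lambda>t. x + (G t - G 0)) has_vector_derivative f t (u t)) (at t within J)" if "t \<in> J" for t
      using G[OF that] by (auto intro!: derivative_eq_intros)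
    then have cG: "continuous_on (cbox (-\<delta>) \<delta>) (\<lambda>t. x + (G t - G 0))"
      unfolding box_real J_def[symmetric]
      by (rule continuous_on_vector_derivative)
    obtain g :: "real \<Rightarrow>\<^sub>C 'a" where g: "\<And>t. t \<in> J \<Longrightarrow> g t = x + (G t - G 0)" "\<And>t. g t = x + (G (clamp (-\<delta>) \<delta> t) - G 0)"
      by (rule continuous_on_cbox_bcontfunE[OF cG]) (unfold J_def box_real, blast)
    have gc: "g t = g (clamp (-\<delta>) \<delta> t)" for t
      by (rule trans[OF g(2)[of t] sym[OF g(1)[OF clamp[of t]]]])
    have gd: "(g has_vector_derivative f t (u t)) (at t within J)" if "t \<in> J" for t
      by (rule has_vector_derivative_transform[OF that _ Gx[OF that]]) (simp add: g(1))
    have g0: "g 0 = x" using g(1)[OF J(2)] by simp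
    have gR: "norm (g t - g 0) \<le> R" if "t \<in> J" for t
    proof -
      have "norm (g t - g 0) \<le> M * \<bar>t - 0\<bar>"
        by (rule vector_derivative_bound[OF \<open>convex J\<close> gd])
          (use that J bound u S in \<open>auto simp: J_def\<close>)
      also have "\<dots> \<le> M * \<delta>"
        using J(3)[OF that] norm_ge_zero[THEN order_trans, OF bound[of 0 x]] \<open>R \<ge> 0\<close> \<delta>(1) by (intro mult_left_mono) auto
      finally show ?thesis using \<delta> by (simp add: mult.commute)
    qed
    have "dist x (g t) \<le> R" for t
      by (subst gc) (use gR[OF clamp[of t]] g0 in \<open>simp add: dist_norm norm_minus_commute\<close>)
    then have "g \<in> S" by (simp add: S)
    moreover have "P u g" unfolding P_def using g0 gd gc by blast
    ultimately show ?thesis by blast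
  qed
  then obtain T where T: "\<And>u. u \<in> S \<Longrightarrow> T u \<in> S \<and> P u (T u)" by metis
  have T0: "T u 0 = x" if "u \<in> S" for u
    using T[OF that] unfolding P_def by blast
  have Td: "(T u has_vector_derivative f t (apply_bcontfun u t)) (at t within J)" if "u \<in> S" "t \<in> J" for u t
    using T[OF that(1)] that(2) unfolding P_def by blast
  have Tc: "T u t = T u (clamp (-\<delta>) \<delta> t)" if "u \<in> S" for u t
    using T[OF that] unfolding P_def by blast
  have "dist (T u) (T v) \<le> 1/2 * dist u v" if uv: "u \<in> S" "v \<in> S" for u v
  proof (rule dist_bound)
    have *: "dist (T u t) (T v t) \<le> 1/2 * dist u v" if "t \<in> J" for t
    proof -
      have "norm ((T u t - T v t) - (T u 0 - T v 0)) \<le> (L * dist u v) * \<bar>t - 0\<bar>"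
      proof (rule vector_derivative_bound[OF \<open>convex J\<close>])
        show "((\<lambda>t. T u t - T v t) has_vector_derivative (f t (u t) - f t (v t))) (at t within J)" if "t \<in> J" for t
          by (intro has_vector_derivative_diff Td uv that)
        show "norm (f t (u t) - f t (v t)) \<le> L * dist u v" if "t \<in> J" for t
          using lip[of t "u t" "v t"] uv S that dist_bounded[of u t v] \<open>L \<ge> 0\<close>
          by (auto simp: J_def dist_norm intro: order_trans[OF _ mult_left_mono])
      qed (use J that in auto)
      also have "\<dots> \<le> (L * dist u v) * \<delta>"
        using J(3)[OF that] \<open>L \<ge> 0\<close> by (intro mult_left_mono) auto
      also have "\<dots> = (\<delta> * L) * dist u v" by simp
      also have "\<dots> \<le> 1/2 * dist u v" using \<delta> by (intro mult_right_mono) auto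
      finally show ?thesis using T0 uv by (simp add: dist_norm)
    qed
    show "dist (T u t) (T v t) \<le> 1/2 * dist u v" for t
      by (subst Tc[OF uv(1)], subst Tc[OF uv(2)]) (rule *[OF clamp])
  qed
  then obtain z where z: "z \<in> S" "T z = z"
    using Banach_fix[of S "1/2" T] \<open>complete S\<close> \<open>S \<noteq> {}\<close> T by auto
  then show ?thesis
    using T0[OF z(1)] Td[OF z(1)] z S unfolding J_def by (intro exI[of _ "apply_bcontfun z"]) auto
qed

lemma has_derivative_of_quadratic_remainder:
  fixes f :: "'a::real_normed_vector \<Rightarrow> 'b::real_normed_vector"
  assumes "open S" "x \<in> S" "bounded_linear f'"
    and "\<And>y. y \<in> S \<Longrightarrow> norm (f y - f x - f' (y - x)) \<le> C * norm (y - x) ^ 2"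
  shows "(f has_derivative f') (at x)"
proof -
  obtain e where e: "e > 0" "ball x e \<subseteq> S" using assms openE by blast
  show ?thesis
  proof (rule has_derivativeI_sandwich[OF e(1) assms(3)])
    show "norm (f y - f x - f' (y - x)) / norm (y - x) \<le> C * norm (y - x)" if "y \<noteq> x" "dist y x < e" for y
      using assms(4)[of y] e that
      by (auto simp: divide_simps power2_eq_square mult_ac dist_commute subset_eq)
    show "((\<lambda>y. C * norm (y - x)) \<longlongrightarrow> 0) (at x)"
      by (auto intro!: tendsto_eq_intros)
  qed
qed

text \<open>One \<open>\<delta>\<close> serves all initial points in \<open>ball x0 r\<close>,
  because a solution moves by at most \<open>\<delta> * M \<le> r\<close> and so stays in the ball
  of radius \<open>2 * r\<close>. That \<open>W\<close> is the derivative of the flow in the initial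
  value follows from Gronwall: the remainder R = \<phi> y - \<phi> x - W x (y - x) starts at 0 and
  satisfies R' = DY R + O(|y - x|^2), so it is itself quadratic in y - x.\<close>

lemma local_flow:
  fixes Y :: "'e::euclidean_space \<Rightarrow> 'e"
  assumes "open U" "smooth_on U Y" "x0 \<in> U"
  obtains \<delta> r \<phi> W where "\<delta> > 0" "r > 0" "cball x0 (2 * r) \<subseteq> U"
    "\<And>x. x \<in> ball x0 r \<Longrightarrow> \<phi> x 0 = x"
    "\<And>x t. x \<in> ball x0 r \<Longrightarrow> t \<in> {-\<delta>..\<delta>} \<Longrightarrow> \<phi> x t \<in> cball x0 (2 * r)"
    "\<And>x t. x \<in> ball x0 r \<Longrightarrow> t \<in> {-\<delta>..\<delta>} \<Longrightarrow>
       (\<phi> x has_vector_derivative Y (\<phi> x t)) (at t within {-\<delta>..\<delta>})"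
    "\<And>x. x \<in> ball x0 r \<Longrightarrow> W x 0 = id_blinfun"
    "\<And>x t. x \<in> ball x0 r \<Longrightarrow> t \<in> {-\<delta>..\<delta>} \<Longrightarrow>
       (W x has_vector_derivative (total_deriv Y (\<phi> x t) o\<^sub>L W x t)) (at t within {-\<delta>..\<delta>})"
    "\<And>x t. x \<in> ball x0 r \<Longrightarrow> t \<in> {-\<delta>..\<delta>} \<Longrightarrow>
       ((\<lambda>x. \<phi> x t) has_derivative blinfun_apply (W x t)) (at x)"
proof -
  obtain e where e: "e > 0" "cball x0 e \<subseteq> U" using assms open_contains_cball by metis
  define r where "r = e / 2"
  define K where "K = cball x0 (2 * r)"
  have r: "r > 0" and K: "compact K" "convex K" "K \<subseteq> U" using e by (auto simp: K_def r_def)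
  obtain L where L: "L \<ge> 0" "\<And>x. x \<in> K \<Longrightarrow> norm (total_deriv Y x) \<le> L"
    "\<And>x y. x \<in> K \<Longrightarrow> y \<in> K \<Longrightarrow> norm (Y x - Y y) \<le> L * norm (x - y)"
    using smooth_on_Lipschitz[OF assms(2) K] by blast
  obtain C where C: "C \<ge> 0" "\<And>x y. x \<in> K \<Longrightarrow> y \<in> K \<Longrightarrow>
     norm (Y y - Y x - blinfun_apply (total_deriv Y x) (y - x)) \<le> C * norm (y - x) ^ 2"
    using smooth_on_quadratic_remainder[OF assms(2) K] by blast
  have contY: "continuous_on K Y"
    using smooth_on_continuous[OF assms(2)] K continuous_on_subset by blast
  then have "bounded (Y ` K)"
    using K compact_continuous_image compact_imp_bounded by blast
  then obtain M where M: "M > 0" "\<And>x. x \<in> K \<Longrightarrow> norm (Y x) \<le> M"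
    by (auto simp: bounded_pos)
  \<comment> \<open>The first bound keeps solutions inside \<open>K\<close>; the second yields
    \<open>\<delta> * L \<le> 1/2\<close>, with \<open>L + 1\<close> in place of \<open>L\<close>
    because \<open>L\<close> may be 0.\<close>
  define \<delta> where "\<delta> = min (r / M) (1 / (2 * (L + 1)))"
  have "\<delta> > 0" using r M L by (simp add: \<delta>_def)
  have \<delta>M: "\<delta> * M \<le> r"
    using M mult_right_mono[of \<delta> "r / M" M] by (simp add: \<delta>_def)
  have "\<delta> * L \<le> 1 / (2 * (L + 1)) * L"
    using L by (intro mult_right_mono) (auto simp: \<delta>_def)
  also have "\<dots> \<le> 1/2" using L by (simp add: field_simps)
  finally have \<delta>L: "\<delta> * L \<le> 1/2" .
  define J where "J = {-\<delta>..\<delta>}"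
  have J: "compact J" "convex J" "0 \<in> J" "\<And>t. t \<in> J \<Longrightarrow> \<bar>t - 0\<bar> \<le> \<delta>"
    using \<open>\<delta> > 0\<close> by (auto simp: J_def)
  have sub: "cball x r \<subseteq> K" if "x \<in> ball x0 r" for x
  proof
    fix y assume "y \<in> cball x r"
    then show "y \<in> K" using that dist_triangle[of x0 y x] by (simp add: K_def)
  qed
  have "\<exists>z. z 0 = x \<and> (\<forall>t\<in>J. z t \<in> cball x r \<and> (z has_vector_derivative Y (z t)) (at t within J))"
    if x: "x \<in> ball x0 r" for x
    unfolding J_def
  proof (rule picard[OF _ \<delta>M \<delta>L])
    have "continuous_on (J \<times> cball x r) (\<lambda>p. Y (snd p))"
      by (rule continuous_on_compose2[OF contY]) (use sub[OF x] in \<open>auto intro!: continuous_intros\<close>)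
    then show "continuous_on ({-\<delta>..\<delta>} \<times> cball x r) (\<lambda>(t, y). Y y)"
      by (simp add: case_prod_beta' J_def)
    show "norm (Y y) \<le> M" if "y \<in> cball x r" for y
      using M sub[OF x] that by blast
    show "norm (Y y - Y z) \<le> L * norm (y - z)" if "y \<in> cball x r" "z \<in> cball x r" for y z
      using L(3) sub[OF x] that by blast
  qed (use \<open>\<delta> > 0\<close> r L in auto)
  then obtain \<phi> where \<phi>0: "\<And>x. x \<in> ball x0 r \<Longrightarrow> \<phi> x 0 = x"
    and \<phi>K: "\<And>x t. x \<in> ball x0 r \<Longrightarrow> t \<in> J \<Longrightarrow> \<phi> x t \<in> K"
    and \<phi>: "\<And>x t. x \<in> ball x0 r \<Longrightarrow> t \<in> J \<Longrightarrow> (\<phi> x has_vector_derivative Y (\<phi> x t)) (at t within J)"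
    using sub by (metis subsetD)
  have "\<exists>V. V 0 = id_blinfun \<and> (\<forall>t\<in>J. V t \<in> cball id_blinfun 1 \<and>
      (V has_vector_derivative (total_deriv Y (\<phi> x t) o\<^sub>L V t)) (at t within J))"
    if x: "x \<in> ball x0 r" for x
    unfolding J_def
  \<comment> \<open>In the unit ball around the identity operators have norm at most 2, so the field
    is bounded by \<open>2 * L\<close>, and \<open>\<delta> * (2 * L) \<le> 1\<close> matches the
    radius 1.\<close>
  proof (rule picard[of \<delta> "2 * L" 1 L])
    have "continuous_on J (\<phi> x)" by (rule continuous_on_vector_derivative[OF \<phi>[OF x]])
    then have "continuous_on J (\<lambda>t. total_deriv Y (\<phi> x t))"
      by (rule continuous_on_compose2[OF continuous_on_total_deriv[OF assms(2)]]) (use \<phi>K[OF x] K in auto)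
    then have "continuous_on (J \<times> cball id_blinfun 1) (\<lambda>p. total_deriv Y (\<phi> x (fst p)))"
      by (rule continuous_on_compose2) (auto intro!: continuous_intros)
    then have "continuous_on (J \<times> cball id_blinfun 1) (\<lambda>p. total_deriv Y (\<phi> x (fst p)) o\<^sub>L snd p)"
      by (intro bounded_bilinear.continuous_on[OF bounded_bilinear_blinfun_compose] continuous_intros)
    then show "continuous_on ({-\<delta>..\<delta>} \<times> cball id_blinfun 1) (\<lambda>(t, V). total_deriv Y (\<phi> x t) o\<^sub>L V)"
      by (simp add: case_prod_beta' J_def)
    show "norm (total_deriv Y (\<phi> x t) o\<^sub>L V) \<le> 2 * L" if "t \<in> {-\<delta>..\<delta>}" "V \<in> cball id_blinfun 1" for t V
    proof -
      have "norm V \<le> norm (id_blinfun :: 'e \<Rightarrow>\<^sub>L 'e) + norm (V - id_blinfun)"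
        by (rule norm_triangle_sub)
      also have "\<dots> \<le> 2"
        using that(2) norm_blinfun_id_le[where 'a = 'e] by (simp add: dist_norm norm_minus_commute)
      finally have "norm V \<le> 2" .
      then have "norm (total_deriv Y (\<phi> x t)) * norm V \<le> L * 2"
        using L(2)[OF \<phi>K[OF x]] that L(1) by (intro mult_mono) (auto simp: J_def)
      then show ?thesis
        using norm_blinfun_compose[of "total_deriv Y (\<phi> x t)" V] by linarith
    qed
    show "norm ((total_deriv Y (\<phi> x t) o\<^sub>L V) - (total_deriv Y (\<phi> x t) o\<^sub>L V')) \<le> L * norm (V - V')"
      if "t \<in> {-\<delta>..\<delta>}" for t and V V' :: "'e \<Rightarrow>\<^sub>L 'e"
    proof -
      have "norm (total_deriv Y (\<phi> x t) o\<^sub>L (V - V')) \<le> norm (total_deriv Y (\<phi> x t)) * norm (V - V')"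
        by (rule norm_blinfun_compose)
      also have "\<dots> \<le> L * norm (V - V')"
        using L(2)[OF \<phi>K[OF x]] that by (intro mult_right_mono) (auto simp: J_def)
      finally show ?thesis
        by (simp add: bounded_bilinear.diff_right[OF bounded_bilinear_blinfun_compose])
    qed
  qed (use \<open>\<delta> > 0\<close> L \<delta>L in auto)
  then obtain W where W0: "\<And>x. x \<in> ball x0 r \<Longrightarrow> W x 0 = id_blinfun"
    and W: "\<And>x t. x \<in> ball x0 r \<Longrightarrow> t \<in> J \<Longrightarrow>
       (W x has_vector_derivative (total_deriv Y (\<phi> x t) o\<^sub>L W x t)) (at t within J)"
    by metis
  \<comment> \<open>Lipschitz dependence on the initial value turns an error quadratic in the
    distance of the curves into one quadratic in y - x, with the factor 4 = 2^2.\<close>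
  have lip: "norm (\<phi> y t - \<phi> x t) \<le> 2 * norm (y - x)"
    if "x \<in> ball x0 r" "y \<in> ball x0 r" "t \<in> J" for x y t
  proof -
    have "norm (\<phi> y t - \<phi> x t) \<le> 2 * norm (\<phi> y 0 - \<phi> x 0) + 2 * \<delta> * 0"
    proof (rule short_time_gronwall[OF J])
      show "((\<lambda>t. \<phi> y t - \<phi> x t) has_vector_derivative (Y (\<phi> y t) - Y (\<phi> x t))) (at t within J)" if "t \<in> J" for t
        by (intro has_vector_derivative_diff \<phi> that \<open>x \<in> _\<close> \<open>y \<in> _\<close>)
      show "norm (Y (\<phi> y t) - Y (\<phi> x t)) \<le> L * norm (\<phi> y t - \<phi> x t) + 0" if "t \<in> J" for t
        using L(3) \<phi>K that \<open>x \<in> _\<close> \<open>y \<in> _\<close> by auto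
    qed (use L \<delta>L that in auto)
    then show ?thesis using \<phi>0 that by simp
  qed
  have "((\<lambda>x. \<phi> x t) has_derivative blinfun_apply (W x t)) (at x)" if x: "x \<in> ball x0 r" and t: "t \<in> J" for x t
  proof (rule has_derivative_of_quadratic_remainder[OF open_ball x blinfun.bounded_linear_right])
    fix y assume y: "y \<in> ball x0 r"
    define R where "R t = \<phi> y t - \<phi> x t - blinfun_apply (W x t) (y - x)" for t
    have "norm (R t) \<le> 2 * norm (R 0) + 2 * \<delta> * (4 * C * norm (y - x) ^ 2)"
    proof (rule short_time_gronwall[OF J])
      fix t assume t: "t \<in> J"
      let ?D = "blinfun_apply (total_deriv Y (\<phi> x t))"
      show "(R has_vector_derivative (Y (\<phi> y t) - Y (\<phi> x t)
          - ?D (blinfun_apply (W x t) (y - x)))) (at t within J)"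
        unfolding R_def
        using bounded_linear.has_vector_derivative[OF blinfun.bounded_linear_left W[OF x t], of "y - x"]
        by (intro has_vector_derivative_diff \<phi> t x y) simp
      have "Y (\<phi> y t) - Y (\<phi> x t) - ?D (blinfun_apply (W x t) (y - x))
         = (Y (\<phi> y t) - Y (\<phi> x t) - ?D (\<phi> y t - \<phi> x t))
           + ?D (R t)"
        by (simp add: R_def blinfun.diff_right)
      moreover have "norm (Y (\<phi> y t) - Y (\<phi> x t) - ?D (\<phi> y t - \<phi> x t))
          \<le> 4 * C * norm (y - x) ^ 2"
      proof -
        have "norm (Y (\<phi> y t) - Y (\<phi> x t) - ?D (\<phi> y t - \<phi> x t))
          \<le> C * norm (\<phi> y t - \<phi> x t) ^ 2"
          using C(2) \<phi>K x y t by blast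
        also have "\<dots> \<le> C * (2 * norm (y - x)) ^ 2"
          using lip[OF x y t] C(1) by (intro mult_left_mono power_mono) auto
        finally show ?thesis by (simp add: power_mult_distrib)
      qed
      moreover have "norm (?D (R t)) \<le> L * norm (R t)"
        using L(2)[OF \<phi>K[OF x t]] norm_blinfun order_trans mult_right_mono norm_ge_zero by metis
      ultimately show "norm (Y (\<phi> y t) - Y (\<phi> x t) - ?D (blinfun_apply (W x t) (y - x)))
         \<le> L * norm (R t) + 4 * C * norm (y - x) ^ 2"
        using norm_triangle_mono by (metis add.commute)
    qed (use L C \<delta>L t in auto)
    moreover have "R 0 = 0" using \<phi>0 W0 x y by (simp add: R_def)
    ultimately show "norm (\<phi> y t - \<phi> x t - blinfun_apply (W x t) (y - x)) \<le> (8 * \<delta> * C) * norm (y - x) ^ 2"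
      by (simp add: R_def mult_ac)
  qed
  then show thesis
    using that[of \<delta> r \<phi> W] \<open>\<delta> > 0\<close> r \<phi>0 \<phi>K \<phi> W0 W K unfolding J_def K_def by blast
qed

section \<open>Integral curves and flows on manifolds\<close>

lemma chart_facts:
  assumes "smooth_atlas A" "c \<in> A"
  shows open_chart_dom: "open (chart_dom c)"
    and open_chart_image: "open (coord c ` chart_dom c)"
    and continuous_on_coord: "continuous_on (chart_dom c) (coord c)"
    and continuous_on_chart_inv: "continuous_on (coord c ` chart_dom c) (chart_inv c)"
    and chart_inv_coord: "p \<in> chart_dom c \<Longrightarrow> chart_inv c (coord c p) = p"
    and coord_chart_inv: "x \<in> coord c ` chart_dom c \<Longrightarrow> coord c (chart_inv c x) = x"
    and chart_inv_in_dom: "x \<in> coord c ` chart_dom c \<Longrightarrow> chart_inv c x \<in> chart_dom c"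
  using assms by (auto simp: smooth_atlas_def is_chart_def homeomorphism_def f_inv_into_f inv_into_into)

lemma open_chart_preimage:
  assumes "smooth_atlas A" "c \<in> A" "open V"
  shows "open {p \<in> chart_dom c. coord c p \<in> V}"
proof -
  have "open (chart_dom c \<inter> coord c -` V)"
    by (rule continuous_open_preimage[OF continuous_on_coord open_chart_dom]) (use assms in auto)
  then show ?thesis by (simp add: vimage_def Int_def)
qed

lemma tendsto_coord:
  assumes "smooth_atlas A" "c \<in> A" "p \<in> chart_dom c"
  shows "(coord c \<longlongrightarrow> coord c p) (nhds p)"
proof -
  have "isCont (coord c) p"
    using continuous_on_coord[OF assms(1,2)] assms(3)
    unfolding continuous_on_eq_continuous_at[OF open_chart_dom[OF assms(1,2)]] by blast
  then show ?thesis by (simp only: isCont_def tendsto_at_iff_tendsto_nhds)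
qed

lemma tendsto_chart_inv:
  assumes "smooth_atlas A" "c \<in> A" "p \<in> chart_dom c"
  shows "(chart_inv c \<longlongrightarrow> p) (nhds (coord c p))"
proof -
  have "isCont (chart_inv c) (coord c p)"
    using continuous_on_chart_inv[OF assms(1,2)] assms(3)
    unfolding continuous_on_eq_continuous_at[OF open_chart_image[OF assms(1,2)]] by blast
  then have "(chart_inv c \<longlongrightarrow> chart_inv c (coord c p)) (nhds (coord c p))"
    by (simp only: isCont_def tendsto_at_iff_tendsto_nhds)
  then show ?thesis by (simp only: chart_inv_coord[OF assms])
qed

lemma transition_coord:
  "smooth_atlas A \<Longrightarrow> c \<in> A \<Longrightarrow> p \<in> chart_dom c \<Longrightarrow> transition c d (coord c p) = coord d p"
  by (simp add: transition_def chart_inv_coord)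

lemma transition_has_derivative:
  assumes "smooth_atlas A" "c \<in> A" "d \<in> A" "p \<in> chart_dom c" "p \<in> chart_dom d"
  shows "(transition c d has_derivative frechet_derivative (transition c d) (at (coord c p))) (at (coord c p))"
  using assms by (intro smooth_on_has_derivative[of "coord c ` (chart_dom c \<inter> chart_dom d)"])
    (auto simp: smooth_atlas_def)

text \<open>\<open>integral_curve\<close> asks for the equation in every chart. The transformation
  law of \<open>Y\<close> carries it from the one chart \<open>c\<close> to all others.\<close>

lemma integral_curve_from_chart:
  assumes A: "smooth_atlas A" and c: "c \<in> A" and Y: "vector_field A Y"
    and z: "\<And>t. t \<in> I \<Longrightarrow> z t \<in> coord c ` chart_dom c"
      "\<And>t. t \<in> I \<Longrightarrow> (z has_vector_derivative Y c (z t)) (at t within I)"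
  shows "integral_curve A Y I (chart_inv c \<circ> z)"
  unfolding integral_curve_def
proof (intro conjI ballI impI)
  show "continuous_on I (chart_inv c \<circ> z)"
    using continuous_on_vector_derivative[OF z(2)] z(1)
    by (intro continuous_on_compose continuous_on_subset[OF continuous_on_chart_inv[OF A c]]) auto
  show "(chart_inv c \<circ> z) ` I \<subseteq> carrier A"
    using chart_inv_in_dom[OF A c] z(1) c by (auto simp: carrier_def)
  fix t d assume t: "t \<in> I" and d: "d \<in> A" "(chart_inv c \<circ> z) t \<in> chart_dom d"
  define p where "p = chart_inv c (z t)"
  have p: "p \<in> chart_dom c" "p \<in> chart_dom d" "coord c p = z t"
    using chart_inv_in_dom[OF A c z(1)[OF t]] coord_chart_inv[OF A c z(1)[OF t]] d by (auto simp: p_def)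
  let ?T = "frechet_derivative (transition c d) (at (coord c p))"
  note T = transition_has_derivative[OF A c d(1) p(1,2)]
  have "((\<lambda>s. transition c d (z s)) has_derivative (\<lambda>h. ?T (h *\<^sub>R Y c (z t)))) (at t within I)"
    by (rule has_derivative_compose[OF z(2)[OF t, unfolded has_vector_derivative_def]])
      (use T p(3) in simp)
  moreover have "?T (h *\<^sub>R Y c (z t)) = h *\<^sub>R Y d (coord d p)" for h
  proof -
    have "?T (h *\<^sub>R Y c (z t)) = h *\<^sub>R ?T (Y c (z t))"
      by (rule linear_scale[OF has_derivative_linear[OF T]])
    then show ?thesis using Y c d p by (simp add: vector_field_def)
  qed
  ultimately show "((coord d \<circ> (chart_inv c \<circ> z)) has_vector_derivative Y d (coord d ((chart_inv c \<circ> z) t))) (at t within I)"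
    by (simp add: has_vector_derivative_def transition_def comp_def p_def)
qed

section \<open>Uniqueness of integral curves and concatenation of flows\<close>

lemma integral_curve_subset:
  "integral_curve A Y I \<gamma> \<Longrightarrow> J \<subseteq> I \<Longrightarrow> integral_curve A Y J \<gamma>"
  unfolding integral_curve_def
  by (blast intro: continuous_on_subset has_vector_derivative_within_subset)

lemma continuous_on_nbhd:
  assumes "continuous_on I f" "s \<in> I" "open B" "f s \<in> B"
  shows "\<exists>V. open V \<and> s \<in> V \<and> (\<forall>u\<in>V \<inter> I. f u \<in> B)"
proof -
  have "\<exists>V. open V \<and> s \<in> V \<and> (\<forall>u\<in>I. u \<in> V \<longrightarrow> f u \<in> B)"
    using assms(1)[unfolded continuous_on_topological, rule_format, OF assms(2-4)] .
  then show ?thesis by auto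
qed

text \<open>For times near \<open>s\<close> both curves stay in the preimage of a ball in one chart;
  there the difference of their coordinates vanishes at \<open>s\<close> and obeys a Lipschitz
  bound, so Gronwall forces it to vanish.\<close>

lemma integral_curve_unique_local:
  assumes A: "smooth_atlas A" and Y: "vector_field A Y" and I: "compact I" "convex I"
    and \<gamma>: "integral_curve A Y I \<gamma>1" "integral_curve A Y I \<gamma>2"
    and s: "s \<in> I" "\<gamma>1 s = \<gamma>2 s"
  shows "\<exists>V. open V \<and> s \<in> V \<and> (\<forall>u\<in>V \<inter> I. \<gamma>1 u = \<gamma>2 u)"
proof -
  obtain c where c: "c \<in> A" "\<gamma>1 s \<in> chart_dom c"
    using \<gamma>(1) s(1) unfolding integral_curve_def carrier_def by blast
  define x0 where "x0 = coord c (\<gamma>1 s)"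
  have "x0 \<in> coord c ` chart_dom c" using c by (simp add: x0_def)
  then obtain e where e: "e > 0" "cball x0 e \<subseteq> coord c ` chart_dom c"
    using open_chart_image[OF A c(1)] unfolding open_contains_cball by blast
  have "smooth_on (coord c ` chart_dom c) (Y c)" using Y c by (simp add: vector_field_def)
  then obtain L where L: "L \<ge> 0" "\<And>x. x \<in> cball x0 e \<Longrightarrow> norm (total_deriv (Y c) x) \<le> L"
    "\<And>x y. x \<in> cball x0 e \<Longrightarrow> y \<in> cball x0 e \<Longrightarrow> norm (Y c x - Y c y) \<le> L * norm (x - y)"
    using smooth_on_Lipschitz[OF _ compact_cball convex_cball e(2)] by blast
  define B where "B = {p \<in> chart_dom c. coord c p \<in> ball x0 e}"
  have B: "open B" "\<gamma>1 s \<in> B"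
    using open_chart_preimage[OF A c(1) open_ball] c e by (auto simp: B_def x0_def)
  have cont: "continuous_on I \<gamma>1" "continuous_on I \<gamma>2"
    using \<gamma> unfolding integral_curve_def by blast+
  obtain V1 where V1: "open V1" "s \<in> V1" "\<And>u. u \<in> V1 \<inter> I \<Longrightarrow> \<gamma>1 u \<in> B"
    using continuous_on_nbhd[OF cont(1) s(1) B] by blast
  obtain V2 where V2: "open V2" "s \<in> V2" "\<And>u. u \<in> V2 \<inter> I \<Longrightarrow> \<gamma>2 u \<in> B"
    using continuous_on_nbhd[OF cont(2) s(1) B(1)] B(2) s(2) by auto
  have "open (V1 \<inter> V2)" "s \<in> V1 \<inter> V2" using V1 V2 by auto
  then obtain \<epsilon> where \<epsilon>: "\<epsilon> > 0" "cball s \<epsilon> \<subseteq> V1 \<inter> V2"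
    unfolding open_contains_cball by blast
  define \<delta> where "\<delta> = min \<epsilon> (1 / (2 * (L + 1)))"
  have "\<delta> > 0" using \<epsilon> L by (simp add: \<delta>_def)
  have "\<delta> * L \<le> 1 / (2 * (L + 1)) * L"
    using L by (intro mult_right_mono) (auto simp: \<delta>_def)
  also have "\<dots> \<le> 1/2" using L by (simp add: field_simps)
  finally have \<delta>L: "\<delta> * L \<le> 1/2" .
  define J where "J = I \<inter> cball s \<delta>"
  have J: "compact J" "convex J" "s \<in> J" "\<And>t. t \<in> J \<Longrightarrow> \<bar>t - s\<bar> \<le> \<delta>" "J \<subseteq> I"
    using I s(1) \<open>\<delta> > 0\<close> unfolding J_def
    by (auto intro: convex_Int compact_Int_closed simp: dist_real_def)
  have JB: "\<gamma>1 u \<in> B" "\<gamma>2 u \<in> B" if "u \<in> J" for u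
  proof -
    have "u \<in> cball s \<epsilon>" "u \<in> I" using that by (auto simp: J_def \<delta>_def)
    then have "u \<in> V1 \<inter> I" "u \<in> V2 \<inter> I" using \<epsilon>(2) by blast+
    then show "\<gamma>1 u \<in> B" "\<gamma>2 u \<in> B" using V1(3) V2(3) by blast+
  qed
  have d: "((coord c \<circ> \<gamma>) has_vector_derivative Y c (coord c (\<gamma> u))) (at u within J)"
    if "integral_curve A Y I \<gamma>" "u \<in> J" "\<gamma> u \<in> B" for \<gamma> u
    using integral_curve_subset[OF that(1) J(5)] that c(1) by (simp add: integral_curve_def B_def)
  have inj: "inj_on (coord c) (chart_dom c)"
    by (rule inj_on_inverseI[of _ "chart_inv c"]) (rule chart_inv_coord[OF A c(1)])
  have "\<gamma>1 u = \<gamma>2 u" if u: "u \<in> J" for u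
  proof -
    have "norm (coord c (\<gamma>1 u) - coord c (\<gamma>2 u)) \<le> 2 * norm (coord c (\<gamma>1 s) - coord c (\<gamma>2 s)) + 2 * \<delta> * 0"
    proof (rule short_time_gronwall[OF J(1-4) _ _ L(1) _ \<delta>L u])
      fix t assume t: "t \<in> J"
      show "((\<lambda>t. coord c (\<gamma>1 t) - coord c (\<gamma>2 t)) has_vector_derivative
         (Y c (coord c (\<gamma>1 t)) - Y c (coord c (\<gamma>2 t)))) (at t within J)"
        using d[OF \<gamma>(1) t JB(1)[OF t]] d[OF \<gamma>(2) t JB(2)[OF t]]
        by (intro has_vector_derivative_diff) (simp_all add: comp_def)
      show "norm (Y c (coord c (\<gamma>1 t)) - Y c (coord c (\<gamma>2 t))) \<le> L * norm (coord c (\<gamma>1 t) - coord c (\<gamma>2 t)) + 0"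
        using L(3)[of "coord c (\<gamma>1 t)" "coord c (\<gamma>2 t)"] JB[OF t] by (simp add: B_def)
    qed auto
    then have "coord c (\<gamma>1 u) = coord c (\<gamma>2 u)" using s(2) by simp
    then show ?thesis using inj JB[OF u] by (auto simp: B_def dest: inj_onD)
  qed
  then show ?thesis
    using \<open>\<delta> > 0\<close> by (intro exI[of _ "ball s \<delta>"]) (auto simp: J_def)
qed

text \<open>The times at which the curves agree form an open set by local uniqueness and a closed
  one by the Hausdorff property; an interval is connected.\<close>

lemma integral_curve_unique:
  assumes A: "smooth_atlas A" and Y: "vector_field A Y" and I: "compact I" "convex I"
    and \<gamma>: "integral_curve A Y I \<gamma>1" "integral_curve A Y I \<gamma>2"
    and s: "s \<in> I" "\<gamma>1 s = \<gamma>2 s" and t: "t \<in> I"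
  shows "\<gamma>1 t = \<gamma>2 t"
proof -
  have cont: "continuous_on I \<gamma>1" "continuous_on I \<gamma>2"
    using \<gamma> unfolding integral_curve_def by blast+
  define E where "E = {u \<in> I. \<gamma>1 u = \<gamma>2 u}"
  have "openin (top_of_set I) E"
  proof (subst openin_subopen, intro ballI)
    fix u assume "u \<in> E"
    then obtain V where "open V" "u \<in> V" "\<forall>w\<in>V \<inter> I. \<gamma>1 w = \<gamma>2 w"
      using integral_curve_unique_local[OF A Y I \<gamma>, of u] by (auto simp: E_def)
    then show "\<exists>T. openin (top_of_set I) T \<and> u \<in> T \<and> T \<subseteq> E"
      using \<open>u \<in> E\<close> by (intro exI[of _ "I \<inter> V"]) (auto simp: E_def openin_open_Int)
  qed
  moreover have "openin (top_of_set I) (I - E)"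
  proof (subst openin_subopen, intro ballI)
    fix u assume u: "u \<in> I - E"
    then have "\<gamma>1 u \<noteq> \<gamma>2 u" by (auto simp: E_def)
    then obtain B1 B2 where B: "open B1" "open B2" "\<gamma>1 u \<in> B1" "\<gamma>2 u \<in> B2" "B1 \<inter> B2 = {}"
      using hausdorff[of "\<gamma>1 u" "\<gamma>2 u"] by blast
    obtain V1 where V1: "open V1" "u \<in> V1" "\<And>w. w \<in> V1 \<inter> I \<Longrightarrow> \<gamma>1 w \<in> B1"
      using continuous_on_nbhd[OF cont(1) _ B(1) B(3)] u by auto
    obtain V2 where V2: "open V2" "u \<in> V2" "\<And>w. w \<in> V2 \<inter> I \<Longrightarrow> \<gamma>2 w \<in> B2"
      using continuous_on_nbhd[OF cont(2) _ B(2) B(4)] u by auto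
    have "I \<inter> (V1 \<inter> V2) \<subseteq> I - E"
    proof
      fix w assume w: "w \<in> I \<inter> (V1 \<inter> V2)"
      then have "\<gamma>1 w \<in> B1" "\<gamma>2 w \<in> B2" using V1(3) V2(3) by auto
      with w B show "w \<in> I - E" by (auto simp: E_def)
    qed
    then show "\<exists>T. openin (top_of_set I) T \<and> u \<in> T \<and> T \<subseteq> I - E"
      using u V1 V2 by (intro exI[of _ "I \<inter> (V1 \<inter> V2)"]) (auto simp: openin_open_Int)
  qed
  then have "closedin (top_of_set I) E"
    by (simp add: closedin_def E_def)
  moreover have "connected I" using I convex_connected by blast
  ultimately have "E = {} \<or> E = I" unfolding connected_clopen by blast
  moreover have "s \<in> E" using s by (simp add: E_def)
  ultimately have "t \<in> E" using t by blast
  then show ?thesis by (simp add: E_def)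
qed

text \<open>Uniqueness of integral curves eliminates the definite description in
  \<open>flow\<close>.\<close>

lemma flow_eq_Some_iff:
  assumes "smooth_atlas A" "vector_field A Y"
  shows "flow A Y t x = Some y \<longleftrightarrow> flows_to A Y t x y"
proof -
  have u: "y = z" if yz: "flows_to A Y t x y" "flows_to A Y t x z" for y z
  proof -
    obtain \<gamma>1 where \<gamma>1: "integral_curve A Y (closed_segment 0 t) \<gamma>1" "\<gamma>1 0 = x" "\<gamma>1 t = y"
      using yz(1) unfolding flows_to_def by blast
    obtain \<gamma>2 where \<gamma>2: "integral_curve A Y (closed_segment 0 t) \<gamma>2" "\<gamma>2 0 = x" "\<gamma>2 t = z"
      using yz(2) unfolding flows_to_def by blast
    have "\<gamma>1 t = \<gamma>2 t"
      by (rule integral_curve_unique[OF assms compact_segment convex_closed_segment \<gamma>1(1) \<gamma>2(1), of 0])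
        (use \<gamma>1 \<gamma>2 in auto)
    then show ?thesis using \<gamma>1 \<gamma>2 by simp
  qed
  show ?thesis
  proof (cases "\<exists>y. flows_to A Y t x y")
    case True
    then obtain z where z: "flows_to A Y t x z" by blast
    then have "(THE y. flows_to A Y t x y) = z" using u by (intro the_equality) auto
    then have "flow A Y t x = Some z" using True by (simp add: flow_def)
    then show ?thesis using u z by auto
  qed (simp add: flow_def)
qed

lemma flows_to_along_curve:
  assumes "integral_curve A Y (closed_segment 0 t) \<gamma>" "s \<in> closed_segment 0 t"
  shows "flows_to A Y s (\<gamma> 0) (\<gamma> s)"
proof -
  have "closed_segment 0 s \<subseteq> closed_segment 0 t"
    using assms(2) by (simp add: subset_closed_segment)
  from integral_curve_subset[OF assms(1) this] show ?thesis
    unfolding flows_to_def by blast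
qed

text \<open>\<open>between\<close> excludes a reversal of the time direction. The two time segments
  then meet only in \<open>s\<close>, and the second curve, shifted by \<open>s\<close>, can be
  glued to the first.\<close>

lemma flows_to_concat:
  assumes "flows_to A Y s x y" "flows_to A Y h y z" and between: "s \<in> closed_segment 0 (s + h)"
  shows "flows_to A Y (s + h) x z"
proof -
  obtain \<gamma>1 where \<gamma>1: "integral_curve A Y (closed_segment 0 s) \<gamma>1" "\<gamma>1 0 = x" "\<gamma>1 s = y"
    using assms by (auto simp: flows_to_def)
  obtain \<gamma>2 where \<gamma>2: "integral_curve A Y (closed_segment 0 h) \<gamma>2" "\<gamma>2 0 = y" "\<gamma>2 h = z"
    using assms by (auto simp: flows_to_def)
  define S where "S = closed_segment 0 s"
  define T where "T = closed_segment s (s + h)"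
  have ST: "closed_segment 0 (s + h) = S \<union> T" "S \<inter> T = {s}"
    using between by (auto simp: S_def T_def closed_segment_eq_real_ivl split: if_splits)
  have cl: "closed S" "closed T" "closure S = S" "closure T = T" by (simp_all add: S_def T_def)
  have shift: "u - s \<in> closed_segment 0 h \<longleftrightarrow> u \<in> T" for u
    by (auto simp: T_def closed_segment_eq_real_ivl)
  define \<gamma> where "\<gamma> u = (if u \<in> S then \<gamma>1 u else \<gamma>2 (u - s))" for u
  have T\<gamma>: "\<gamma> u = \<gamma>2 (u - s)" if "u \<in> T" for u
    using that ST(2) \<gamma>1 \<gamma>2 by (cases "u = s") (auto simp: \<gamma>_def S_def)
  have "integral_curve A Y (S \<union> T) \<gamma>"
    unfolding integral_curve_def
  proof (intro conjI ballI impI)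
    have c2: "continuous_on T (\<lambda>u. \<gamma>2 (u - s))"
      using \<gamma>2(1) shift unfolding integral_curve_def
      by (intro continuous_on_compose2[of "closed_segment 0 h" \<gamma>2 T]) (auto intro!: continuous_intros)
    show "continuous_on (S \<union> T) \<gamma>"
      unfolding \<gamma>_def
    proof (rule continuous_on_cases[OF cl(1,2) _ c2])
      show "continuous_on S \<gamma>1" using \<gamma>1(1) by (simp add: integral_curve_def S_def)
      show "\<forall>u. u \<in> S \<and> u \<notin> S \<or> u \<in> T \<and> u \<in> S \<longrightarrow> \<gamma>1 u = \<gamma>2 (u - s)"
      proof (intro allI impI)
        fix u assume "u \<in> S \<and> u \<notin> S \<or> u \<in> T \<and> u \<in> S"
        then have "u = s" using ST(2) by blast
        then show "\<gamma>1 u = \<gamma>2 (u - s)" using \<gamma>1 \<gamma>2 by simp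
      qed
    qed
    show "\<gamma> ` (S \<union> T) \<subseteq> carrier A"
      using \<gamma>1(1) \<gamma>2(1) T\<gamma> shift by (force simp: integral_curve_def S_def \<gamma>_def)
    fix t c assume t: "t \<in> S \<union> T" and c: "c \<in> A" "\<gamma> t \<in> chart_dom c"
    have d2: "((\<lambda>u. coord c (\<gamma>2 (u - s))) has_vector_derivative Y c (coord c (\<gamma>2 (t - s)))) (at t within T)" if "t \<in> T"
    proof -
      have "((coord c \<circ> \<gamma>2) has_vector_derivative Y c (coord c (\<gamma>2 (t - s)))) (at (t - s) within closed_segment 0 h)"
        using \<gamma>2(1) shift that c T\<gamma> by (simp add: integral_curve_def)
      then have "((coord c \<circ> \<gamma>2) has_vector_derivative Y c (coord c (\<gamma>2 (t - s)))) (at (t - s) within (\<lambda>u. u - s) ` T)"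
        by (rule has_vector_derivative_within_subset) (use shift in auto)
      moreover have "((\<lambda>u. u - s) has_vector_derivative 1) (at t within T)"
        by (auto intro!: derivative_eq_intros)
      ultimately show ?thesis
        using vector_diff_chain_within[of "\<lambda>u. u - s" 1 t T "coord c \<circ> \<gamma>2"] by (simp add: comp_def)
    qed
    \<comment> \<open>At the common point \<open>s\<close> both one-sided derivatives equal the
      value of the field there, so the two pieces fit together.\<close>
    have "((\<lambda>u. if u \<in> S then coord c (\<gamma>1 u) else coord c (\<gamma>2 (u - s))) has_vector_derivative
      (if t \<in> S then Y c (coord c (\<gamma>1 t)) else Y c (coord c (\<gamma>2 (t - s))))) (at t within (S \<union> T))"
    proof (rule has_vector_derivative_If_within_closures[OF t refl])
      assume "t \<in> S \<union> closure S \<inter> closure T"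
      then have "t \<in> S" using cl by auto
      moreover have "S \<union> closure S \<inter> closure T = S" using cl by auto
      ultimately show "((\<lambda>u. coord c (\<gamma>1 u)) has_vector_derivative Y c (coord c (\<gamma>1 t))) (at t within S \<union> closure S \<inter> closure T)"
        using \<gamma>1(1) c by (simp add: integral_curve_def S_def[symmetric] \<gamma>_def comp_def)
    next
      assume "t \<in> T \<union> closure S \<inter> closure T"
      then have "t \<in> T" using cl by auto
      moreover have "T \<union> closure S \<inter> closure T = T" using cl by auto
      ultimately show "((\<lambda>u. coord c (\<gamma>2 (u - s))) has_vector_derivative Y c (coord c (\<gamma>2 (t - s)))) (at t within T \<union> closure S \<inter> closure T)"
        using d2 by simp
    next
      assume "t \<in> closure S" "t \<in> closure T"
      then have "t = s" using cl ST by auto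
      then show "coord c (\<gamma>1 t) = coord c (\<gamma>2 (t - s))" "Y c (coord c (\<gamma>1 t)) = Y c (coord c (\<gamma>2 (t - s)))"
        using \<gamma>1 \<gamma>2 by simp_all
    qed
    moreover have "(\<lambda>u. if u \<in> S then coord c (\<gamma>1 u) else coord c (\<gamma>2 (u - s))) = coord c \<circ> \<gamma>"
      by (auto simp: \<gamma>_def)
    moreover have "(if t \<in> S then Y c (coord c (\<gamma>1 t)) else Y c (coord c (\<gamma>2 (t - s)))) = Y c (coord c (\<gamma> t))"
      by (simp add: \<gamma>_def)
    ultimately show "((coord c \<circ> \<gamma>) has_vector_derivative Y c (coord c (\<gamma> t))) (at t within (S \<union> T))"
      by (simp only:)
  qed
  moreover have "\<gamma> 0 = x" using \<gamma>1 by (simp add: \<gamma>_def S_def)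
  moreover have "\<gamma> (s + h) = z" using T\<gamma>[of "s + h"] \<gamma>2 by (simp add: T_def)
  ultimately show ?thesis unfolding flows_to_def using ST(1) by auto
qed

lemma flow_from_chart:
  assumes A: "smooth_atlas A" and c: "c \<in> A" and Y: "vector_field A Y"
    and z: "\<And>t. t \<in> {-\<delta>..\<delta>} \<Longrightarrow> z t \<in> coord c ` chart_dom c"
      "\<And>t. t \<in> {-\<delta>..\<delta>} \<Longrightarrow> (z has_vector_derivative Y c (z t)) (at t within {-\<delta>..\<delta>})"
    and t: "t \<in> {-\<delta>..\<delta>}"
  shows "flow A Y t (chart_inv c (z 0)) = Some (chart_inv c (z t))"
proof -
  have "closed_segment 0 t \<subseteq> {-\<delta>..\<delta>}"
    using t by (auto simp: closed_segment_eq_real_ivl)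
  then have "integral_curve A Y (closed_segment 0 t) (chart_inv c \<circ> z)"
    using integral_curve_subset[OF integral_curve_from_chart[OF A c Y z]] by blast
  from flows_to_along_curve[OF this ends_in_segment(2)] show ?thesis
    by (simp add: flow_eq_Some_iff[OF A Y])
qed

section \<open>Order conditions in the algebra of noncommutative power series\<close>

text \<open>A function on words is the coefficient family of a noncommutative power series; \<open>conv\<close> is
  multiplication of series and \<open>exp_letter c j\<close> is the exponential of \<open>c\<close> times the letter \<open>j\<close>.\<close>

definition conv :: "('a list \<Rightarrow> real) \<Rightarrow> ('a list \<Rightarrow> real) \<Rightarrow> 'a list \<Rightarrow> real" where
  "conv f g w = (\<Sum>i\<le>length w. f (take i w) * g (drop i w))"

definition word_one :: "'a list \<Rightarrow> real" where
  "word_one w = (if w = [] then 1 else 0)"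

definition exp_letter :: "real \<Rightarrow> 'a \<Rightarrow> 'a list \<Rightarrow> real" where
  "exp_letter c j w = (if w = replicate (length w) j then c ^ length w / fact (length w) else 0)"

fun word_coeff :: "(real \<times> 'a) list \<Rightarrow> 'a list \<Rightarrow> real" where
  "word_coeff [] = word_one"
| "word_coeff ((c, j) # cs) = conv (exp_letter c j) (word_coeff cs)"

text \<open>Both sides sum over all ways to cut \<open>w\<close> into three blocks;
  \<open>a k m\<close> is the term whose first two blocks have lengths \<open>k\<close> and
  \<open>m\<close>.\<close>

lemma conv_assoc: "conv (conv f g) h = conv f (conv g h)"
proof
  fix w :: "'a list"
  let ?n = "length w"
  define a where "a k m = f (take k w) * g (take m (drop k w)) * h (drop (k + m) w)" for k m
  have "conv (conv f g) h w = (\<Sum>i\<le>?n. \<Sum>k\<le>i. a k (i - k))"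
    unfolding conv_def sum_distrib_right
  proof (rule sum.cong[OF refl])
    fix i assume "i \<in> {..?n}"
    then show "(\<Sum>k\<le>length (take i w). f (take k (take i w)) * g (drop k (take i w)) * h (drop i w)) = (\<Sum>k\<le>i. a k (i - k))"
      by (intro sum.cong) (auto simp: a_def drop_take min_def)
  qed
  also have "\<dots> = (\<Sum>(k, m)\<in>{(k, m). k + m \<le> ?n}. a k m)"
    by (rule sum.triangle_reindex_eq[symmetric])
  also have "{(k, m). k + m \<le> ?n} = Sigma {..?n} (\<lambda>k. {..?n - k})" by auto
  also have "(\<Sum>(k, m)\<in>Sigma {..?n} (\<lambda>k. {..?n - k}). a k m) = (\<Sum>k\<le>?n. \<Sum>m\<le>?n - k. a k m)"
    by (rule sum.Sigma[symmetric]) auto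
  also have "\<dots> = conv f (conv g h) w"
    by (simp add: conv_def a_def sum_distrib_left mult.assoc add.commute)
  finally show "conv (conv f g) h w = conv f (conv g h) w" .
qed

lemma conv_one_left: "conv word_one f = f"
proof
  fix w :: "'a list"
  have "conv word_one f w = (\<Sum>i\<in>{0}. word_one (take i w) * f (drop i w))"
    unfolding conv_def by (rule sum.mono_neutral_right) (auto simp: word_one_def)
  then show "conv word_one f w = f w" by (simp add: word_one_def)
qed

lemma conv_one_right: "conv f word_one = f"
proof
  fix w :: "'a list"
  have "conv f word_one w = (\<Sum>i\<in>{length w}. f (take i w) * word_one (drop i w))"
    unfolding conv_def by (rule sum.mono_neutral_right) (auto simp: word_one_def)
  then show "conv f word_one w = f w" by (simp add: word_one_def)
qed

lemma word_coeff_append: "word_coeff (xs @ ys) = conv (word_coeff xs) (word_coeff ys)"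
  by (induction xs) (auto simp: conv_one_left conv_assoc)

lemma sum_power_div_fact:
  fixes a b :: real
  shows "(\<Sum>i\<le>n. a ^ i / fact i * (b ^ (n - i) / fact (n - i))) = (a + b) ^ n / fact n"
proof -
  have "a ^ i / fact i * (b ^ (n - i) / fact (n - i)) = of_nat (n choose i) * a ^ i * b ^ (n - i) / fact n"
    if "i \<le> n" for i
    using that by (simp add: binomial_fact field_simps)
  then show ?thesis
    by (simp add: binomial_ring sum_divide_distrib)
qed

text \<open>On powers of \<open>j\<close> this is the binomial theorem; any other word cannot be cut
  into two powers of \<open>j\<close>, so all terms vanish.\<close>

lemma conv_exp_letter: "conv (exp_letter a j) (exp_letter b j) = exp_letter (a + b) j"
proof
  fix w
  show "conv (exp_letter a j) (exp_letter b j) w = exp_letter (a + b) j w"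
  proof (cases "w = replicate (length w) j")
    case True
    then obtain n where w: "w = replicate n j" by blast
    have "conv (exp_letter a j) (exp_letter b j) w = (\<Sum>i\<le>n. a ^ i / fact i * (b ^ (n - i) / fact (n - i)))"
      unfolding conv_def w by (intro sum.cong) (auto simp: exp_letter_def min_def)
    then show ?thesis unfolding sum_power_div_fact by (simp add: exp_letter_def w)
  next
    case False
    have "exp_letter a j (take i w) * exp_letter b j (drop i w) = 0" if "i \<le> length w" for i
    proof (rule ccontr)
      assume "exp_letter a j (take i w) * exp_letter b j (drop i w) \<noteq> 0"
      then have "take i w = replicate i j" "drop i w = replicate (length w - i) j"
        using that by (auto simp: exp_letter_def min_def split: if_splits)
      then have "w = replicate i j @ replicate (length w - i) j"
        using append_take_drop_id[of i w] by simp
      then show False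
        using False that by (simp flip: replicate_add)
    qed
    then have "conv (exp_letter a j) (exp_letter b j) w = 0"
      unfolding conv_def by (intro sum.neutral) blast
    then show ?thesis using False by (simp add: exp_letter_def)
  qed
qed

lemma exp_letter_0: "exp_letter 0 j = word_one"
  by (auto simp: exp_letter_def word_one_def fun_eq_iff power_0_left)

text \<open>The same composition with the step \<tau> replaced by a \<tau>. On the level of series a
  word of length n gains the factor a^n.\<close>

definition scale_coeffs :: "real \<Rightarrow> (real \<times> 'a) list \<Rightarrow> (real \<times> 'a) list" where
  "scale_coeffs a = map (\<lambda>(c, j). (a * c, j))"

lemma word_coeff_scale: "word_coeff (scale_coeffs a cs) w = a ^ length w * word_coeff cs w"
proof (induction cs arbitrary: w)
  case Nil
  then show ?case by (simp add: scale_coeffs_def word_one_def)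
next
  case (Cons x cs)
  obtain c j where x: "x = (c, j)" by (cases x)
  have "exp_letter (a * c) j (take i w) * word_coeff (scale_coeffs a cs) (drop i w) =
      a ^ length w * (exp_letter c j (take i w) * word_coeff cs (drop i w))" if "i \<le> length w" for i
  proof -
    have "a ^ length w = a ^ i * a ^ (length w - i)" using that by (simp flip: power_add)
    then show ?thesis using that by (simp add: Cons.IH exp_letter_def power_mult_distrib min_def)
  qed
  then show ?case by (simp add: x scale_coeffs_def conv_def sum_distrib_left)
qed

text \<open>A product of exponentials is inverted by reversing the order and negating the
  coefficients. For a palindrome the reversal has no effect, which leaves the time symmetry T(t)
  T(-t) = 1.\<close>

lemma word_coeff_inverse: "conv (word_coeff cs) (word_coeff (rev (scale_coeffs (-1) cs))) = word_one"
proof (induction cs)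
  case (Cons x cs)
  obtain c j where x: "x = (c, j)" by (cases x)
  have 1: "word_coeff (x # cs) = conv (exp_letter c j) (word_coeff cs)"
    by (simp add: x)
  have 2: "word_coeff (rev (scale_coeffs (-1) (x # cs))) = conv (word_coeff (rev (scale_coeffs (-1) cs))) (exp_letter (- c) j)"
    by (simp add: scale_coeffs_def x word_coeff_append conv_one_right)
  have "conv (word_coeff (x # cs)) (word_coeff (rev (scale_coeffs (-1) (x # cs)))) =
      conv (exp_letter c j) (conv (conv (word_coeff cs) (word_coeff (rev (scale_coeffs (-1) cs)))) (exp_letter (- c) j))"
    unfolding 1 2 by (simp only: conv_assoc)
  also have "\<dots> = word_one"
    by (simp only: Cons.IH conv_one_left conv_exp_letter) (simp add: exp_letter_0)
  finally show ?case .
qed (simp add: scale_coeffs_def conv_one_left)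

text \<open>If two series agree with the exponentials of a X and b X up to degree r, where X is the
  sum of the letters, then their errors in degree r + 1 simply add in the product: an error can only
  be multiplied by the constant term of the other factor, which is 1. With \<open>0 < n\<close> the
  cuts 0 and \<open>n\<close> are distinct, and all cuts in between contribute exact terms.\<close>

lemma conv_leading_term:
  assumes f: "\<And>w. set w \<subseteq> S \<Longrightarrow> length w \<le> r \<Longrightarrow> f w = a ^ length w / fact (length w)"
    and g: "\<And>w. set w \<subseteq> S \<Longrightarrow> length w \<le> r \<Longrightarrow> g w = b ^ length w / fact (length w)"
    and w: "set w \<subseteq> S" "length w = n" "0 < n" "n \<le> Suc r"
  shows "conv f g w = (a + b) ^ n / fact n + (f w - a ^ n / fact n) + (g w - b ^ n / fact n)"
proof -
  define t where "t i = f (take i w) * g (drop i w) - a ^ i / fact i * (b ^ (n - i) / fact (n - i))" for i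
  have "conv f g w - (a + b) ^ n / fact n = (\<Sum>i\<le>n. t i)"
    unfolding conv_def t_def sum_power_div_fact[symmetric] sum_subtractf using w by simp
  also have "\<dots> = (\<Sum>i\<in>{0, n}. t i)"
  proof (rule sum.mono_neutral_right)
    show "\<forall>i\<in>{..n} - {0, n}. t i = 0"
    proof
      fix i assume i: "i \<in> {..n} - {0, n}"
      have "set (take i w) \<subseteq> S" "set (drop i w) \<subseteq> S"
        using w set_take_subset[of i w] set_drop_subset[of i w] by blast+
      then have "f (take i w) = a ^ i / fact i" "g (drop i w) = b ^ (n - i) / fact (n - i)"
        using i w by (subst f g; auto simp: min_def)+
      then show "t i = 0" by (simp add: t_def)
    qed
  qed auto
  also have "\<dots> = (f w - a ^ n / fact n) + (g w - b ^ n / fact n)"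
    using w f[of "[]"] g[of "[]"] by (simp add: t_def)
  finally show ?thesis by simp
qed

text \<open>The coefficient of a word \<open>w\<close> over \<open>S\<close> in the exponential of the sum of the letters in \<open>S\<close> is
  \<open>1 / fact (length w)\<close>.\<close>

definition exp_order :: "'a set \<Rightarrow> nat \<Rightarrow> (real \<times> 'a) list \<Rightarrow> bool" where
  "exp_order S r cs \<longleftrightarrow> (\<forall>w. set w \<subseteq> S \<longrightarrow> length w \<le> r \<longrightarrow> word_coeff cs w = 1 / fact (length w))"

text \<open>Let e be the error in the even degree r + 1. The inverse series, obtained by negating
  the coefficients, has error (-1)^(r+1) e = e in that degree, and the errors of a product add.
  Since the product is 1, 2 e = 0.\<close>

lemma exp_order_palindrome:
  assumes r: "exp_order S r cs" "odd r" and pal: "rev cs = cs"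
  shows "exp_order S (Suc r) cs"
  unfolding exp_order_def
proof (intro allI impI)
  fix w assume w: "set w \<subseteq> S" "length w \<le> Suc r"
  show "word_coeff cs w = 1 / fact (length w)"
  proof (cases "length w \<le> r")
    case False
    then have n: "length w = Suc r" using w by simp
    let ?g = "word_coeff (scale_coeffs (-1) cs)"
    have "conv (word_coeff cs) ?g = word_one"
      using word_coeff_inverse[of cs] pal by (simp add: scale_coeffs_def rev_map)
    then have "0 = conv (word_coeff cs) ?g w" using n by (auto simp: word_one_def)
    also have "\<dots> = (1 + (-1)) ^ Suc r / fact (Suc r) + (word_coeff cs w - 1 ^ Suc r / fact (Suc r)) + (?g w - (-1) ^ Suc r / fact (Suc r))"
      using r w n by (intro conv_leading_term[where S = S and r = r]) (auto simp: exp_order_def word_coeff_scale)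
    also have "\<dots> = 2 * (word_coeff cs w - 1 / fact (Suc r))"
      using n \<open>odd r\<close> by (simp add: word_coeff_scale)
    finally show ?thesis using n by simp
  qed (use r w in \<open>auto simp: exp_order_def\<close>)
qed

text \<open>The condition \<open>2 * p + q = 1\<close> preserves correctness up to degree r. In
  degree r + 1 the error e of \<open>cs\<close> is scaled by the power of \<open>p\<close> or
  \<open>q\<close> in each factor, and the three errors add up to (2 p^(r+1) + q^(r+1)) e =
  0.\<close>

lemma exp_order_triple_jump:
  assumes cs: "exp_order S r cs" and pq: "2 * p + q = 1" "2 * p ^ Suc r + q ^ Suc r = 0"
  shows "exp_order S (Suc r) (scale_coeffs p cs @ scale_coeffs q cs @ scale_coeffs p cs)"
  unfolding exp_order_def
proof (intro allI impI)
  fix w assume w: "set w \<subseteq> S" "length w \<le> Suc r"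
  let ?f = "word_coeff cs" let ?n = "length w"
  let ?P = "word_coeff (scale_coeffs p cs)" let ?Q = "word_coeff (scale_coeffs q cs)"
  have f: "?f w = 1 / fact (length w)" if "set w \<subseteq> S" "length w \<le> r" for w
    using cs that by (simp add: exp_order_def)
  have P: "?P w = p ^ length w / fact (length w)" if "set w \<subseteq> S" "length w \<le> r" for w
    using f that by (simp add: word_coeff_scale)
  have Q: "?Q w = q ^ length w / fact (length w)" if "set w \<subseteq> S" "length w \<le> r" for w
    using f that by (simp add: word_coeff_scale)
  \<comment> \<open>\<open>conv_leading_term\<close> multiplies two factors, so it is used twice:
    the inner product must be exact up to degree r, and its error in degree r + 1 must be known
    explicitly.\<close>
  have QP': "conv ?Q ?P w = (q + p) ^ length w / fact (length w) + (?Q w - q ^ length w / fact (length w)) + (?P w - p ^ length w / fact (length w))"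
    if "set w \<subseteq> S" "length w \<le> Suc r" "0 < length w" for w
    by (rule conv_leading_term[OF Q P]) (use that in auto)
  have QP: "conv ?Q ?P w = (q + p) ^ length w / fact (length w)" if "set w \<subseteq> S" "length w \<le> r" for w
  proof (cases "w = []")
    case True
    then show ?thesis using P[of "[]"] Q[of "[]"] by (simp add: conv_def)
  next
    case False
    then show ?thesis using QP'[OF that(1)] P[OF that] Q[OF that] that by simp
  qed
  have e: "word_coeff (scale_coeffs p cs @ scale_coeffs q cs @ scale_coeffs p cs) = conv ?P (conv ?Q ?P)"
    by (simp add: word_coeff_append)
  have "conv ?P (conv ?Q ?P) w = 1 / fact ?n"
  proof (cases "w = []")
    case True
    then show ?thesis using P[of "[]"] QP[of "[]"] by (simp add: conv_def)
  next
    case False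
    have "conv ?P (conv ?Q ?P) w = (p + (q + p)) ^ ?n / fact ?n + (?P w - p ^ ?n / fact ?n) + (conv ?Q ?P w - (q + p) ^ ?n / fact ?n)"
      by (rule conv_leading_term[OF P QP]) (use w False in auto)
    also have "\<dots> = 1 / fact ?n + (2 * (?P w - p ^ ?n / fact ?n) + (?Q w - q ^ ?n / fact ?n))"
    proof -
      have "p + (q + p) = 1" using pq by simp
      then show ?thesis using QP'[of w] w False by simp
    qed
    also have "2 * (?P w - p ^ ?n / fact ?n) + (?Q w - q ^ ?n / fact ?n) = 0"
    proof (cases "?n \<le> r")
      case True
      then show ?thesis using P Q w by simp
    next
      case False
      then have "?n = Suc r" using w by simp
      then have "2 * (?P w - p ^ ?n / fact ?n) + (?Q w - q ^ ?n / fact ?n) =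
          (2 * p ^ Suc r + q ^ Suc r) * (?f w - 1 / fact (Suc r))"
        by (simp add: word_coeff_scale field_simps)
      then show ?thesis using pq by simp
    qed
    finally show ?thesis by simp
  qed
  then show "word_coeff (scale_coeffs p cs @ scale_coeffs q cs @ scale_coeffs p cs) w = 1 / fact ?n"
    using e by simp
qed

text \<open>Put q = - s p. Since r + 1 is odd, the second equation becomes s^(r+1) = 2, and the
  first one reads (2 - s) p = 1. It is solvable because s = 2 would give 2^r = 1, contrary to r >
  0.\<close>

lemma triple_jump_coefficients:
  assumes "even r" "0 < r"
  obtains p q :: real where "2 * p + q = 1" "2 * p ^ Suc r + q ^ Suc r = 0"
proof -
  define s where "s = root (Suc r) 2"
  have s: "s ^ Suc r = 2" unfolding s_def by (rule real_root_pow_pos2) auto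
  have "s \<noteq> 2"
  proof
    assume "s = 2"
    then have "(2::real) ^ r = 1" using s by simp
    then show False using assms(2) one_less_power[of "2::real" r] by simp
  qed
  define p q where "p = 1 / (2 - s)" and "q = - s / (2 - s)"
  have "2 * p + q = 1"
  proof -
    have "2 * p + q = (2 + - s) / (2 - s)"
      unfolding p_def q_def add_divide_distrib by (simp only: times_divide_eq_right mult_1_right)
    also have "\<dots> = 1" using \<open>s \<noteq> 2\<close> by simp
    finally show ?thesis .
  qed
  moreover have "2 * p ^ Suc r + q ^ Suc r = 0"
  proof -
    have "q ^ Suc r = - (s ^ Suc r) / (2 - s) ^ Suc r"
      using assms(1) unfolding q_def power_divide by simp
    then show ?thesis unfolding s p_def power_divide by simp
  qed
  ultimately show thesis by (rule that)
qed

section \<open>Symmetric compositions of every even order\<close>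

lemma word_coeff_Nil_arg: "word_coeff cs [] = 1"
proof (induction cs)
  case (Cons x cs)
  then show ?case by (cases x) (simp add: conv_def exp_letter_def)
qed (simp add: word_one_def)

lemma word_coeff_single_letter: "word_coeff cs [i] = (\<Sum>(c, j)\<leftarrow>cs. if j = i then c else 0)"
proof (induction cs)
  case (Cons x cs)
  then show ?case
    by (cases x) (auto simp: conv_def exp_letter_def word_coeff_Nil_arg)
qed (simp add: word_one_def)

lemma exp_order_exists:
  assumes "finite S" "1 \<le> k"
  shows "\<exists>cs. snd ` set cs \<subseteq> S \<and> rev cs = cs \<and> exp_order S (2 * k) cs"
  using assms(2)
proof (induction k rule: dec_induct)
  case base
  obtain xs where xs: "set xs = S" "distinct xs" using finite_distinct_list[OF assms(1)] by blast
  \<comment> \<open>The symmetric (Strang) splitting: a half step in every letter, then the same in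
    reverse order. Every letter receives the total coefficient 1, which is correctness in degree
    one; the palindrome gives degree two.\<close>
  define hs where "hs = map (\<lambda>j. (1/2 :: real, j)) xs"
  have hs: "(\<Sum>(c, j)\<leftarrow>hs. if j = i then c else 0) = 1/2" if "i \<in> S" for i
  proof -
    have "(\<Sum>(c, j)\<leftarrow>hs. if j = i then c else 0) = (\<Sum>j\<leftarrow>xs. if j = i then 1/2 else 0)"
      by (simp add: hs_def comp_def)
    also have "\<dots> = (\<Sum>j\<in>S. if j = i then 1/2 else 0)"
      using sum_list_distinct_conv_sum_set[OF xs(2)] xs(1) by simp
    finally show ?thesis using that assms(1) by simp
  qed
  define cs where "cs = hs @ rev hs"
  have "exp_order S 1 cs"
    unfolding exp_order_def
  proof (intro allI impI)
    fix w assume w: "set w \<subseteq> S" "length w \<le> 1"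
    show "word_coeff cs w = 1 / fact (length w)"
    proof (cases w)
      case (Cons i v)
      then have "w = [i]" "i \<in> S" using w by auto
      then show ?thesis
        using hs[of i] by (simp add: word_coeff_single_letter cs_def flip: rev_map)
    qed (simp add: word_coeff_Nil_arg)
  qed
  then have "exp_order S 2 cs"
    using exp_order_palindrome[of S 1 cs] by (simp add: cs_def numeral_2_eq_2)
  then show ?case
    by (intro exI[of _ cs]) (auto simp: cs_def hs_def xs)
next
  case (step k)
  then obtain cs where cs: "snd ` set cs \<subseteq> S" "rev cs = cs" "exp_order S (2 * k) cs" by blast
  obtain p q :: real where pq: "2 * p + q = 1" "2 * p ^ Suc (2 * k) + q ^ Suc (2 * k) = 0"
    using triple_jump_coefficients[of "2 * k"] step by auto
  let ?cs = "scale_coeffs p cs @ scale_coeffs q cs @ scale_coeffs p cs"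
  have "rev ?cs = ?cs" using cs(2) by (simp add: scale_coeffs_def rev_map)
  moreover from this have "exp_order S (Suc (Suc (2 * k))) ?cs"
    by (intro exp_order_palindrome exp_order_triple_jump cs pq) auto
  moreover have "snd ` set ?cs \<subseteq> S" using cs(1) by (force simp: scale_coeffs_def)
  ultimately show ?case by (intro exI[of _ ?cs]) simp
qed

section \<open>Germs of contact maps\<close>

text \<open>Stated with some derivative \<open>F'\<close> instead of
  \<open>frechet_derivative\<close>, so that derivatives produced by the chain rule can be inserted
  directly. Uniqueness of derivatives translates back in
  \<open>contact_map_if_contact_at\<close>.\<close>

definition conformal_at ::
    "('m, 'e::euclidean_space) chart set \<Rightarrow> ('m, 'e) oneform \<Rightarrow> ('m \<rightharpoonup> 'm) \<Rightarrow> 'm \<Rightarrow> 'm \<Rightarrow> real \<Rightarrow> bool" where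
  "conformal_at A \<eta> f x y r \<longleftrightarrow> (\<forall>c\<in>A. \<forall>d\<in>A. x \<in> chart_dom c \<longrightarrow> y \<in> chart_dom d \<longrightarrow>
     (\<exists>F'. (local_expr c d f has_derivative F') (at (coord c x)) \<and>
       (\<forall>v. \<eta> d (coord d y) (F' v) = r * \<eta> c (coord c x) v)))"

text \<open>\<open>contact_map\<close> is local in the domain; the pointwise version depends only on the germ of \<open>f\<close> at \<open>x\<close>.\<close>

definition contact_at ::
    "('m::topological_space, 'e::euclidean_space) chart set \<Rightarrow> ('m, 'e) oneform \<Rightarrow> ('m \<rightharpoonup> 'm) \<Rightarrow> 'm \<Rightarrow> bool" where
  "contact_at A \<eta> f x \<longleftrightarrow> (\<exists>y r. f x = Some y \<and> x \<in> carrier A \<and> y \<in> carrier A \<and>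
     (\<forall>\<^sub>F u in nhds x. f u \<noteq> None) \<and> ((\<lambda>u. the (f u)) \<longlongrightarrow> y) (nhds x) \<and> r \<noteq> 0 \<and>
     conformal_at A \<eta> f x y r)"

lemma contact_atD:
  assumes "contact_at A \<eta> f x" "f x = Some y"
  shows "\<exists>r. x \<in> carrier A \<and> y \<in> carrier A \<and>
     (\<forall>\<^sub>F u in nhds x. f u \<noteq> None) \<and> ((\<lambda>u. the (f u)) \<longlongrightarrow> y) (nhds x) \<and> r \<noteq> 0 \<and> conformal_at A \<eta> f x y r"
proof -
  from assms(1)[unfolded contact_at_def] obtain y' r where *: "f x = Some y'" "x \<in> carrier A" "y' \<in> carrier A"
     "\<forall>\<^sub>F u in nhds x. f u \<noteq> None" "((\<lambda>u. the (f u)) \<longlongrightarrow> y') (nhds x)" "r \<noteq> 0"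
     "conformal_at A \<eta> f x y' r"
    by (elim exE conjE)
  have "y' = y" using *(1) assms(2) by simp
  from *[unfolded this] show ?thesis by (intro exI[of _ r] conjI)
qed

lemma contact_at_Some: "contact_at A \<eta> f x \<Longrightarrow> \<exists>y. f x = Some y"
  unfolding contact_at_def by (elim exE conjE) (rule exI)

lemma contact_map_if_contact_at:
  assumes "\<And>x. x \<in> dom f \<Longrightarrow> contact_at A \<eta> f x"
  shows "contact_map A \<eta> f"
proof -
  have D: "x \<in> carrier A \<and> y \<in> carrier A \<and> (\<forall>\<^sub>F u in nhds x. f u \<noteq> None) \<and>
      ((\<lambda>u. the (f u)) \<longlongrightarrow> y) (nhds x)" if "f x = Some y" for x y
  proof -
    have "contact_at A \<eta> f x" using assms that by blast
    from contact_atD[OF this that] show ?thesis by (elim exE conjE) (intro conjI)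
  qed
  have op: "open (dom f)"
  proof (subst open_subopen, intro ballI)
    fix x assume "x \<in> dom f"
    then obtain y where "f x = Some y" by blast
    then have "\<forall>\<^sub>F u in nhds x. f u \<noteq> None" using D by blast
    then show "\<exists>T. open T \<and> x \<in> T \<and> T \<subseteq> dom f" unfolding eventually_nhds dom_def by blast
  qed
  have dr: "dom f \<subseteq> carrier A" "ran f \<subseteq> carrier A"
    using D by (blast, auto simp: ran_def)
  have co: "continuous_on (dom f) (the \<circ> f)"
    unfolding continuous_on_def
  proof
    fix x assume "x \<in> dom f"
    then obtain y where y: "f x = Some y" by blast
    then have "((\<lambda>u. the (f u)) \<longlongrightarrow> y) (at x within dom f)"
      using D tendsto_mono[OF at_within_le_nhds] by blast
    then show "((the \<circ> f) \<longlongrightarrow> (the \<circ> f) x) (at x within dom f)"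
      using y by (simp add: comp_def)
  qed
  have "\<forall>x. \<exists>r. \<forall>y. f x = Some y \<longrightarrow> r \<noteq> 0 \<and>
        (\<forall>c\<in>A. \<forall>d\<in>A. x \<in> chart_dom c \<longrightarrow> y \<in> chart_dom d \<longrightarrow>
           local_expr c d f differentiable (at (coord c x)) \<and>
           (\<forall>v. \<eta> d (coord d y) (frechet_derivative (local_expr c d f) (at (coord c x)) v) =
                r * \<eta> c (coord c x) v))"
    (is "\<forall>x. ?P x")
  proof
    fix x
    show "?P x"
    proof (cases "f x")
      case (Some y)
      then have "contact_at A \<eta> f x" using assms by blast
      from contact_atD[OF this Some] obtain r where r: "r \<noteq> 0" "conformal_at A \<eta> f x y r"
        by blast
      show ?thesis
      proof (intro exI[of _ r] allI impI conjI ballI)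
        fix y' c d assume *: "f x = Some y'" "c \<in> A" "d \<in> A" "x \<in> chart_dom c" "y' \<in> chart_dom d"
        then have "y' = y" using Some by simp
        with * obtain F' where F': "(local_expr c d f has_derivative F') (at (coord c x))"
          "\<And>v. \<eta> d (coord d y) (F' v) = r * \<eta> c (coord c x) v"
          using r(2) unfolding conformal_at_def by blast
        show "local_expr c d f differentiable (at (coord c x))"
          using F'(1) by (auto simp: differentiable_def)
        show "\<eta> d (coord d y') (frechet_derivative (local_expr c d f) (at (coord c x)) v) = r * \<eta> c (coord c x) v" for v
          using F'(2) frechet_derivative_eq[OF F'(1)] * Some by simp
      qed (rule r(1))
    qed simp
  qed
  note ch = choice[OF this]
  show ?thesis unfolding contact_map_def by (intro conjI op dr co ch)
qed

lemma one_form_transition: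
  assumes "one_form A \<eta>" "c \<in> A" "d \<in> A" "p \<in> chart_dom c" "p \<in> chart_dom d"
  shows "\<eta> d (coord d p) (frechet_derivative (transition c d) (at (coord c p)) v) = \<eta> c (coord c p) v"
  using assms unfolding one_form_def by (metis IntI)

text \<open>One pair of charts suffices. In other charts the local expression is composed with
  transition maps on both sides, and \<eta> transforms by the same maps, so the factor
  \<open>r\<close> is unchanged.\<close>

lemma contact_atI:
  assumes A: "smooth_atlas A" and \<eta>: "one_form A \<eta>"
    and f: "f x = Some y" and ev: "\<forall>\<^sub>F u in nhds x. f u \<noteq> None"
    and lim: "((\<lambda>u. the (f u)) \<longlongrightarrow> y) (nhds x)" and r: "r \<noteq> 0"
    and c: "c \<in> A" "x \<in> chart_dom c" and d: "d \<in> A" "y \<in> chart_dom d"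
    and F: "(local_expr c d f has_derivative F') (at (coord c x))"
      "\<And>v. \<eta> d (coord d y) (F' v) = r * \<eta> c (coord c x) v"
  shows "contact_at A \<eta> f x"
  unfolding contact_at_def conformal_at_def
proof (rule exI[of _ y], rule exI[of _ r], intro conjI ballI impI)
  show "f x = Some y" "\<forall>\<^sub>F u in nhds x. f u \<noteq> None" "((\<lambda>u. the (f u)) \<longlongrightarrow> y) (nhds x)" "r \<noteq> 0"
    by (fact f, fact ev, fact lim, fact r)
  show "x \<in> carrier A" "y \<in> carrier A" using c d by (auto simp: carrier_def)
  fix c' d' assume c': "c' \<in> A" "x \<in> chart_dom c'" and d': "d' \<in> A" "y \<in> chart_dom d'"
  let ?T1 = "frechet_derivative (transition c' c) (at (coord c' x))"
  let ?T2 = "frechet_derivative (transition d d') (at (coord d y))"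
  have "((\<lambda>u. transition d d' (local_expr c d f (transition c' c u))) has_derivative (\<lambda>v. ?T2 (F' (?T1 v)))) (at (coord c' x))"
  proof (rule has_derivative_compose[OF transition_has_derivative[OF A c'(1) c(1) c'(2) c(2)]])
    have "local_expr c d f (coord c x) = coord d y"
      using f by (simp add: local_expr_def chart_inv_coord[OF A c])
    then show "((\<lambda>u. transition d d' (local_expr c d f u)) has_derivative (\<lambda>v. ?T2 (F' v))) (at (transition c' c (coord c' x)))"
      using has_derivative_compose[OF F(1), of "transition d d'" ?T2] transition_has_derivative[OF A d(1) d'(1) d(2) d'(2)]
      by (simp add: transition_coord[OF A c'])
  qed
  \<comment> \<open>The two expressions agree only near \<open>coord c' x\<close>: the point has to
    lie in the domain of \<open>c\<close> and its image in the domain of \<open>d\<close>, both of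
    which are open conditions.\<close>
  moreover have ev1: "\<forall>\<^sub>F u in nhds (coord c' x).
      transition d d' (local_expr c d f (transition c' c u)) = local_expr c' d' f u"
  proof -
    have "\<forall>\<^sub>F p in nhds x. p \<in> chart_dom c \<and> the (f p) \<in> chart_dom d"
      using eventually_nhds_in_open[OF open_chart_dom[OF A c(1)] c(2)]
        topological_tendstoD[OF lim open_chart_dom[OF A d(1)] d(2)]
      by eventually_elim simp
    then have "\<forall>\<^sub>F u in nhds (coord c' x). chart_inv c' u \<in> chart_dom c \<and> the (f (chart_inv c' u)) \<in> chart_dom d"
      by (rule eventually_compose_filterlim[OF _ tendsto_chart_inv[OF A c']])
    then show ?thesis
      by eventually_elim (auto simp: local_expr_def transition_def chart_inv_coord[OF A c(1)] chart_inv_coord[OF A d(1)])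
  qed
  ultimately have "(local_expr c' d' f has_derivative (\<lambda>v. ?T2 (F' (?T1 v)))) (at (coord c' x))"
    by (rule has_derivative_transform_eventually[OF _ filter_leD[OF at_within_le_nhds]])
      (use eventually_nhds_x_imp_x[OF ev1] in auto)
  moreover have "\<eta> d' (coord d' y) (?T2 (F' (?T1 v))) = r * \<eta> c' (coord c' x) v" for v
  proof -
    have "\<eta> d' (coord d' y) (?T2 (F' (?T1 v))) = \<eta> d (coord d y) (F' (?T1 v))"
      by (rule one_form_transition[OF \<eta> d(1) d'(1) d(2) d'(2)])
    also have "\<dots> = r * \<eta> c (coord c x) (?T1 v)" by (rule F(2))
    also have "\<eta> c (coord c x) (?T1 v) = \<eta> c' (coord c' x) v"
      by (rule one_form_transition[OF \<eta> c'(1) c(1) c'(2) c(2)])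
    finally show ?thesis .
  qed
  ultimately show "\<exists>F'. (local_expr c' d' f has_derivative F') (at (coord c' x)) \<and>
          (\<forall>v. \<eta> d' (coord d' y) (F' v) = r * \<eta> c' (coord c' x) v)"
    by blast
qed

text \<open>Since \<open>f\<close> is defined on a neighbourhood of \<open>x\<close>, the maps
  \<open>f\<close> and \<open>g\<close> have the same germ there. This passes from a composition of
  short-time flows to the flow that extends it.\<close>

lemma contact_at_mono:
  assumes A: "smooth_atlas A" and \<eta>: "one_form A \<eta>" and f: "contact_at A \<eta> f x" and "f \<subseteq>\<^sub>m g"
  shows "contact_at A \<eta> g x"
proof -
  obtain y where fx: "f x = Some y" using contact_at_Some[OF f] ..
  from contact_atD[OF f fx] obtain r where y: "x \<in> carrier A" "y \<in> carrier A"
      "\<forall>\<^sub>F u in nhds x. f u \<noteq> None" "((\<lambda>u. the (f u)) \<longlongrightarrow> y) (nhds x)" "r \<noteq> 0"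
    and F: "conformal_at A \<eta> f x y r"
    by (elim exE conjE)
  obtain c d where c: "c \<in> A" "x \<in> chart_dom c" and d: "d \<in> A" "y \<in> chart_dom d"
    using y unfolding carrier_def by blast
  obtain F' where F': "(local_expr c d f has_derivative F') (at (coord c x))"
          "\<And>v. \<eta> d (coord d y) (F' v) = r * \<eta> c (coord c x) v"
    using F c d unfolding conformal_at_def by blast
  have eq: "\<forall>\<^sub>F u in nhds x. g u = f u"
    using y(3) by eventually_elim (use assms(4) in \<open>auto simp: map_le_def dom_def\<close>)
  have ev1: "\<forall>\<^sub>F u in nhds (coord c x). local_expr c d f u = local_expr c d g u"
    using eventually_compose_filterlim[OF eq tendsto_chart_inv[OF A c]]
    by eventually_elim (simp add: local_expr_def)
  show ?thesis
  proof (rule contact_atI[OF A \<eta> _ _ _ y(5) c d _ F'(2)])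
    show "g x = Some y" using eventually_nhds_x_imp_x[OF eq] fx by simp
    show "\<forall>\<^sub>F u in nhds x. g u \<noteq> None" using eq y(3) by eventually_elim simp
    show "((\<lambda>u. the (g u)) \<longlongrightarrow> y) (nhds x)"
      by (rule Lim_transform_eventually[OF y(4)]) (use eq in eventually_elim, simp)
    show "(local_expr c d g has_derivative F') (at (coord c x))"
      by (rule has_derivative_transform_eventually[OF F'(1) filter_leD[OF at_within_le_nhds]])
        (use ev1 eventually_nhds_x_imp_x[OF ev1] in auto)
  qed
qed

lemma contact_at_map_comp:
  assumes A: "smooth_atlas A" and \<eta>: "one_form A \<eta>" and f: "contact_at A \<eta> f x" "f x = Some y"
    and g: "contact_at A \<eta> g y"
  shows "contact_at A \<eta> (g \<circ>\<^sub>m f) x"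
proof -
  from contact_atD[OF f] obtain r where r: "x \<in> carrier A" "y \<in> carrier A"
      "\<forall>\<^sub>F u in nhds x. f u \<noteq> None" "((\<lambda>u. the (f u)) \<longlongrightarrow> y) (nhds x)" "r \<noteq> 0"
    and F: "conformal_at A \<eta> f x y r"
    by (elim exE conjE)
  obtain z where gy: "g y = Some z" using contact_at_Some[OF g] ..
  from contact_atD[OF g gy] obtain r' where r': "y \<in> carrier A" "z \<in> carrier A"
      "\<forall>\<^sub>F u in nhds y. g u \<noteq> None" "((\<lambda>u. the (g u)) \<longlongrightarrow> z) (nhds y)" "r' \<noteq> 0"
    and G: "conformal_at A \<eta> g y z r'"
    by (elim exE conjE)
  obtain c d e where c: "c \<in> A" "x \<in> chart_dom c" and d: "d \<in> A" "y \<in> chart_dom d" and e: "e \<in> A" "z \<in> chart_dom e"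
    using r r' unfolding carrier_def by blast
  obtain F' where F': "(local_expr c d f has_derivative F') (at (coord c x))"
          "\<And>v. \<eta> d (coord d y) (F' v) = r * \<eta> c (coord c x) v"
    using F c d unfolding conformal_at_def by blast
  obtain G' where G': "(local_expr d e g has_derivative G') (at (coord d y))"
          "\<And>v. \<eta> e (coord e z) (G' v) = r' * \<eta> d (coord d y) v"
    using G d e unfolding conformal_at_def by blast
  have comp: "(g \<circ>\<^sub>m f) u = g (the (f u))" if "f u \<noteq> None" for u
    using that by (auto simp: map_comp_def)
  have ev: "\<forall>\<^sub>F u in nhds x. g (the (f u)) \<noteq> None"
    by (rule eventually_compose_filterlim[OF r'(3) r(4)])
  have ev1: "\<forall>\<^sub>F u in nhds (coord c x). local_expr d e g (local_expr c d f u) = local_expr c e (g \<circ>\<^sub>m f) u"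
  proof -
    have "\<forall>\<^sub>F p in nhds x. f p \<noteq> None \<and> the (f p) \<in> chart_dom d"
      using r(3) topological_tendstoD[OF r(4) open_chart_dom[OF A d(1)] d(2)]
      by eventually_elim simp
    from eventually_compose_filterlim[OF this tendsto_chart_inv[OF A c]] show ?thesis
      by eventually_elim (auto simp: local_expr_def chart_inv_coord[OF A d(1)] comp)
  qed
  show ?thesis
  proof (rule contact_atI[OF A \<eta> _ _ _ _ c e])
    show "(g \<circ>\<^sub>m f) x = Some z" using f(2) gy by (simp add: map_comp_def)
    show "\<forall>\<^sub>F u in nhds x. (g \<circ>\<^sub>m f) u \<noteq> None"
      using ev r(3) by eventually_elim (simp add: comp)
    have "((\<lambda>u. the (g (the (f u)))) \<longlongrightarrow> z) (nhds x)"
      by (rule filterlim_compose[OF r'(4) r(4)])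
    then show "((\<lambda>u. the ((g \<circ>\<^sub>m f) u)) \<longlongrightarrow> z) (nhds x)"
      by (rule Lim_transform_eventually) (use r(3) in eventually_elim, simp add: comp)
    show "r' * r \<noteq> 0" using r r' by simp
    have "local_expr c d f (coord c x) = coord d y"
      using f by (simp add: local_expr_def chart_inv_coord[OF A c])
    then have "((\<lambda>u. local_expr d e g (local_expr c d f u)) has_derivative (\<lambda>v. G' (F' v))) (at (coord c x))"
      using has_derivative_compose[OF F'(1), of "local_expr d e g" G'] G'(1) by simp
    then show "(local_expr c e (g \<circ>\<^sub>m f) has_derivative (\<lambda>v. G' (F' v))) (at (coord c x))"
      by (rule has_derivative_transform_eventually[OF _ filter_leD[OF at_within_le_nhds]])
        (use ev1 eventually_nhds_x_imp_x[OF ev1] in auto)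
    show "\<eta> e (coord e z) (G' (F' v)) = r' * r * \<eta> c (coord c x) v" for v
      by (simp add: F'(2) G'(2))
  qed
qed

section \<open>Flows of contact vector fields are contact maps\<close>

lemma form_eq_sum_Basis:
  fixes g :: "'e::euclidean_space \<Rightarrow> real"
  shows "linear g \<Longrightarrow> g v = (\<Sum>b\<in>Basis. (v \<bullet> b) * g b)"
  using linear_eq_sum_Basis[of g v] by simp

lemma form_derivative_eq_sum_Basis:
  fixes \<alpha> :: "'e::euclidean_space \<Rightarrow> 'e \<Rightarrow> real"
  assumes U: "open U" and sm: "\<And>v. smooth_on U (\<lambda>y. \<alpha> y v)" and lin: "\<And>y. y \<in> U \<Longrightarrow> linear (\<alpha> y)"
    and x: "x \<in> U"
  shows "frechet_derivative (\<lambda>y. \<alpha> y v) (at x) h = (\<Sum>b\<in>Basis. (v \<bullet> b) * frechet_derivative (\<lambda>y. \<alpha> y b) (at x) h)"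
proof -
  have "((\<lambda>y. \<Sum>b\<in>Basis. (v \<bullet> b) * \<alpha> y b) has_derivative
      (\<lambda>h. \<Sum>b\<in>Basis. (v \<bullet> b) * frechet_derivative (\<lambda>y. \<alpha> y b) (at x) h)) (at x)"
    by (intro has_derivative_sum has_derivative_mult_right smooth_on_has_derivative[OF sm x])
  then have "((\<lambda>y. \<alpha> y v) has_derivative
      (\<lambda>h. \<Sum>b\<in>Basis. (v \<bullet> b) * frechet_derivative (\<lambda>y. \<alpha> y b) (at x) h)) (at x)"
    by (rule has_derivative_transform_within_open[OF _ U x]) (rule form_eq_sum_Basis[OF lin, symmetric])
  from frechet_derivative_eq[OF this] show ?thesis by simp
qed

text \<open>The product rule for a form paired with a moving vector. Smoothness of \<alpha> is given
  for fixed vectors only, hence the expansion in the basis.\<close>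

lemma form_pairing_has_derivative:
  fixes \<alpha> :: "'e::euclidean_space \<Rightarrow> 'e \<Rightarrow> real"
  assumes U: "open U" and sm: "\<And>v. smooth_on U (\<lambda>y. \<alpha> y v)" and lin: "\<And>y. y \<in> U \<Longrightarrow> linear (\<alpha> y)"
    and z: "(z has_derivative z') (at s within J)" "z ` J \<subseteq> U" "s \<in> J"
    and u: "(u has_derivative u') (at s within J)"
  shows "((\<lambda>s. \<alpha> (z s) (u s)) has_derivative
    (\<lambda>h. frechet_derivative (\<lambda>y. \<alpha> y (u s)) (at (z s)) (z' h) + \<alpha> (z s) (u' h))) (at s within J)"
proof -
  have zs: "z s \<in> U" using z by blast
  have "((\<lambda>s. \<alpha> (z s) b) has_derivative (\<lambda>h. frechet_derivative (\<lambda>y. \<alpha> y b) (at (z s)) (z' h))) (at s within J)" for b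
    by (rule has_derivative_compose[OF z(1) smooth_on_has_derivative[OF sm zs]])
  moreover have "((\<lambda>s. u s \<bullet> b) has_derivative (\<lambda>h. u' h \<bullet> b)) (at s within J)" for b
    by (rule has_derivative_inner_left[OF u])
  ultimately have "((\<lambda>s. \<Sum>b\<in>Basis. (u s \<bullet> b) * \<alpha> (z s) b) has_derivative
    (\<lambda>h. \<Sum>b\<in>Basis. (u s \<bullet> b) * frechet_derivative (\<lambda>y. \<alpha> y b) (at (z s)) (z' h) + (u' h \<bullet> b) * \<alpha> (z s) b)) (at s within J)"
    by (intro has_derivative_sum has_derivative_mult)
  then have 1: "((\<lambda>s. \<alpha> (z s) (u s)) has_derivative
    (\<lambda>h. \<Sum>b\<in>Basis. (u s \<bullet> b) * frechet_derivative (\<lambda>y. \<alpha> y b) (at (z s)) (z' h) + (u' h \<bullet> b) * \<alpha> (z s) b)) (at s within J)"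
    by (rule has_derivative_transform[OF z(3), rotated]) (use z(2) in \<open>auto intro!: form_eq_sum_Basis lin\<close>)
  have 2: "frechet_derivative (\<lambda>y. \<alpha> y (u s)) (at (z s)) h =
      (\<Sum>b\<in>Basis. (u s \<bullet> b) * frechet_derivative (\<lambda>y. \<alpha> y b) (at (z s)) h)" for h
    by (rule form_derivative_eq_sum_Basis[OF U sm lin zs])
  have 3: "\<alpha> (z s) (u' h) = (\<Sum>b\<in>Basis. (u' h \<bullet> b) * \<alpha> (z s) b)" for h
    by (rule form_eq_sum_Basis[OF lin[OF zs]])
  show ?thesis using 1 unfolding 2 3 sum.distrib .
qed

text \<open>The term of d\<alpha> that differentiates \<alpha> with \<open>Y x\<close> frozen
  cancels against the same term in the product rule for \<alpha>(Y).\<close>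

lemma lie_deriv_eq:
  fixes \<alpha> :: "'e::euclidean_space \<Rightarrow> 'e \<Rightarrow> real"
  assumes U: "open U" and sm: "\<And>v. smooth_on U (\<lambda>y. \<alpha> y v)" and lin: "\<And>y. y \<in> U \<Longrightarrow> linear (\<alpha> y)"
    and Y: "smooth_on U Y" and x: "x \<in> U"
  shows "lie_deriv Y \<alpha> x v = frechet_derivative (\<lambda>y. \<alpha> y v) (at x) (Y x) + \<alpha> x (frechet_derivative Y (at x) v)"
proof -
  have "((\<lambda>y. \<alpha> y (Y y)) has_derivative
      (\<lambda>h. frechet_derivative (\<lambda>y. \<alpha> y (Y x)) (at x) h + \<alpha> x (frechet_derivative Y (at x) h))) (at x within U)"
    by (rule form_pairing_has_derivative[OF U sm lin has_derivative_ident _ x])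
      (use smooth_on_has_derivative[OF Y x] has_derivative_at_withinI in auto)
  then have "frechet_derivative (\<lambda>y. \<alpha> y (Y y)) (at x) =
      (\<lambda>h. frechet_derivative (\<lambda>y. \<alpha> y (Y x)) (at x) h + \<alpha> x (frechet_derivative Y (at x) h))"
    unfolding at_within_open[OF x U] by (rule frechet_derivative_eq)
  then show ?thesis by (simp add: lie_deriv_def ext_deriv_def)
qed

text \<open>\<open>contact_hamiltonian_vf\<close> provides \<rho> as a bare function. Near a point
  where \<alpha> is nonzero on \<open>v\<close>, it is the quotient of the Lie derivative on
  \<open>v\<close> by \<alpha> on \<open>v\<close>, hence continuous and integrable along
  curves.\<close>

lemma continuous_on_conformal_factor:
  fixes \<alpha> :: "'e::euclidean_space \<Rightarrow> 'e \<Rightarrow> real"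
  assumes U: "open U" and sm: "\<And>v. smooth_on U (\<lambda>y. \<alpha> y v)" and lin: "\<And>y. y \<in> U \<Longrightarrow> linear (\<alpha> y)"
    and Y: "smooth_on U Y" and nz: "\<And>y. y \<in> U \<Longrightarrow> \<exists>v. \<alpha> y v \<noteq> 0"
    and \<rho>: "\<And>y v. y \<in> U \<Longrightarrow> lie_deriv Y \<alpha> y v = \<rho> y * \<alpha> y v"
  shows "continuous_on U \<rho>"
  unfolding continuous_on_eq_continuous_at[OF U]
proof
  fix y0 assume y0: "y0 \<in> U"
  then obtain v where v: "\<alpha> y0 v \<noteq> 0" using nz by blast
  have "smooth_on U (\<lambda>y. dir_deriv Y (\<lambda>y. \<alpha> y v) y + (\<Sum>b\<in>Basis. (frechet_derivative Y (at y) v \<bullet> b) *\<^sub>R \<alpha> y b))"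
    by (intro smooth_on_add smooth_on_dir_deriv smooth_on_sum smooth_on_scaleR smooth_on_inner smooth_on_derivative sm Y U)
  then have "smooth_on U (\<lambda>y. lie_deriv Y \<alpha> y v)"
  proof (rule smooth_on_cong[OF U, rotated])
    fix y assume y: "y \<in> U"
    show "dir_deriv Y (\<lambda>y. \<alpha> y v) y + (\<Sum>b\<in>Basis. (frechet_derivative Y (at y) v \<bullet> b) *\<^sub>R \<alpha> y b) = lie_deriv Y \<alpha> y v"
    proof -
      have "lie_deriv Y \<alpha> y v = frechet_derivative (\<lambda>y. \<alpha> y v) (at y) (Y y) + \<alpha> y (frechet_derivative Y (at y) v)"
        by (rule lie_deriv_eq[OF U sm lin Y y])
      also have "\<alpha> y (frechet_derivative Y (at y) v) = (\<Sum>b\<in>Basis. (frechet_derivative Y (at y) v \<bullet> b) * \<alpha> y b)"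
        by (rule form_eq_sum_Basis[OF lin[OF y]])
      finally show ?thesis by (simp add: dir_deriv_def)
    qed
  qed
  then have c: "isCont (\<lambda>y. lie_deriv Y \<alpha> y v) y0" "isCont (\<lambda>y. \<alpha> y v) y0"
    using smooth_on_differentiable[OF _ y0] sm differentiable_imp_continuous_within by blast+
  have "\<forall>\<^sub>F y in nhds y0. \<alpha> y v \<noteq> 0"
  proof -
    have "((\<lambda>y. \<alpha> y v) \<longlongrightarrow> \<alpha> y0 v) (nhds y0)"
      using c(2) tendsto_at_iff_tendsto_nhds[of "\<lambda>y. \<alpha> y v" y0] by (simp add: isCont_def)
    then show ?thesis by (rule tendsto_imp_eventually_ne[OF _ v])
  qed
  then have "\<forall>\<^sub>F y in nhds y0. \<rho> y = lie_deriv Y \<alpha> y v / \<alpha> y v"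
    using eventually_nhds_in_open[OF U y0] by eventually_elim (simp add: \<rho>)
  moreover have "isCont (\<lambda>y. lie_deriv Y \<alpha> y v / \<alpha> y v) y0"
    using c v by (intro continuous_intros) auto
  ultimately show "isCont \<rho> y0" by (subst isCont_cong)
qed

text \<open>By the variational equation and \<open>lie_deriv_eq\<close>, the time derivative of
  \<alpha>(W v) along the curve is exactly the Lie derivative of \<alpha> evaluated on W v, that is,
  \<rho> times \<alpha>(W v).\<close>

lemma conformal_along_curve:
  fixes \<alpha> :: "'e::euclidean_space \<Rightarrow> 'e \<Rightarrow> real"
  assumes U: "open U" and sm: "\<And>v. smooth_on U (\<lambda>y. \<alpha> y v)" and lin: "\<And>y. y \<in> U \<Longrightarrow> linear (\<alpha> y)"
    and Y: "smooth_on U Y" and nz: "\<And>y. y \<in> U \<Longrightarrow> \<exists>v. \<alpha> y v \<noteq> 0"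
    and \<rho>: "\<And>y v. y \<in> U \<Longrightarrow> lie_deriv Y \<alpha> y v = \<rho> y * \<alpha> y v"
    and \<delta>: "\<delta> > 0"
    and z: "\<And>s. s \<in> {-\<delta>..\<delta>} \<Longrightarrow> z s \<in> U" "\<And>s. s \<in> {-\<delta>..\<delta>} \<Longrightarrow> (z has_vector_derivative Y (z s)) (at s within {-\<delta>..\<delta>})"
    and W: "W 0 = id_blinfun" "\<And>s. s \<in> {-\<delta>..\<delta>} \<Longrightarrow> (W has_vector_derivative (total_deriv Y (z s) o\<^sub>L W s)) (at s within {-\<delta>..\<delta>})"
    and t: "t \<in> {-\<delta>..\<delta>}"
  shows "\<exists>r. r \<noteq> 0 \<and> (\<forall>v. \<alpha> (z t) (blinfun_apply (W t) v) = r * \<alpha> (z 0) v)"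
proof -
  define J where "J = {-\<delta>..\<delta>}"
  have J: "convex J" "0 \<in> J" "t \<in> J" using \<delta> t by (auto simp: J_def)
  have "continuous_on J (\<lambda>s. \<rho> (z s))"
    by (rule continuous_on_compose2[OF continuous_on_conformal_factor[of U \<alpha>, OF U sm lin Y nz \<rho>]])
      (use z(1) continuous_on_vector_derivative[OF z(2)] in \<open>auto simp: J_def\<close>)
  \<comment> \<open>\<open>G\<close> is an antiderivative of \<rho> along the curve;
    \<open>exp (- G s)\<close> is the integrating factor, and \<open>exp (G t - G 0)\<close> becomes
    the conformal factor, the same for all \<open>v\<close>.\<close>
  then obtain G where G: "\<And>s. s \<in> J \<Longrightarrow> (G has_vector_derivative \<rho> (z s)) (at s within J)"
    unfolding J_def using antiderivative_continuous by blast
  have "\<alpha> (z t) (blinfun_apply (W t) v) = exp (G t - G 0) * \<alpha> (z 0) v" for v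
  proof -
    define a where "a s = \<alpha> (z s) (blinfun_apply (W s) v)" for s
    have a: "(a has_real_derivative \<rho> (z s) * a s) (at s within J)" if s: "s \<in> J" for s
    proof -
      have sU: "z s \<in> U" using z s by (simp add: J_def)
      have dW: "((\<lambda>s. blinfun_apply (W s) v) has_vector_derivative
          frechet_derivative Y (at (z s)) (blinfun_apply (W s) v)) (at s within J)"
        using bounded_linear.has_vector_derivative[OF blinfun.bounded_linear_left W(2), of s v] s
        by (simp add: J_def total_deriv_apply[OF smooth_on_differentiable[OF Y sU]])
      let ?u = "blinfun_apply (W s) v"
      let ?A = "frechet_derivative (\<lambda>y. \<alpha> y ?u) (at (z s))" and ?B = "frechet_derivative Y (at (z s)) ?u"
      have "(a has_derivative (\<lambda>h. ?A (h *\<^sub>R Y (z s))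
          + \<alpha> (z s) (h *\<^sub>R ?B))) (at s within J)"
        unfolding a_def
        by (rule form_pairing_has_derivative[OF U sm lin _ _ s])
          (use z s dW in \<open>auto simp: J_def has_vector_derivative_def\<close>)
      moreover have "?A (h *\<^sub>R Y (z s))
          + \<alpha> (z s) (h *\<^sub>R ?B) = \<rho> (z s) * a s * h" for h
      proof -
        have "?A (h *\<^sub>R Y (z s))
            = h * ?A (Y (z s))"
          using linear_scale[OF has_derivative_linear[OF smooth_on_has_derivative[OF sm sU]]] by simp
        moreover have "\<alpha> (z s) (h *\<^sub>R ?B)
            = h * \<alpha> (z s) (?B)"
          using linear_scale[OF lin[OF sU]] by simp
        ultimately show ?thesis
          using lie_deriv_eq[of U \<alpha>, OF U sm lin Y sU, of "?u"] \<rho>[OF sU, of "?u"]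
          by (simp add: a_def algebra_simps)
      qed
      ultimately show ?thesis by (simp add: has_field_derivative_def)
    qed
    have "norm (a t * exp (- G t) - a 0 * exp (- G 0)) \<le> 0 * \<bar>t - 0\<bar>"
    proof (rule vector_derivative_bound[OF J(1) _ _ J(2,3)])
      fix s assume s: "s \<in> J"
      have "(G has_real_derivative \<rho> (z s)) (at s within J)"
        using G[OF s] by (simp add: has_real_derivative_iff_has_vector_derivative)
      from DERIV_mult[OF a[OF s] DERIV_chain2[OF DERIV_exp DERIV_minus[OF this]]]
      have "((\<lambda>s. a s * exp (- G s)) has_real_derivative 0) (at s within J)"
        by (simp add: algebra_simps)
      then show "((\<lambda>s. a s * exp (- G s)) has_vector_derivative 0) (at s within J)"
        by (simp add: has_real_derivative_iff_has_vector_derivative)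
    qed simp
    then have "a t * exp (- G t) = a 0 * exp (- G 0)" by simp
    then have "a t * (exp (- G t) * exp (G t)) = a 0 * exp (- G 0) * exp (G t)" by simp
    then have "a t = exp (G t - G 0) * a 0"
      by (simp add: mult_exp_exp exp_diff exp_minus field_simps)
    then show ?thesis by (simp add: a_def W(1))
  qed
  then show ?thesis by (intro exI[of _ "exp (G t - G 0)"]) simp
qed

lemma contact_at_flow_local:
  assumes A: "smooth_atlas A" and \<eta>: "one_form A \<eta>" and Y: "vector_field A Y"
    and nz: "\<And>c x. c \<in> A \<Longrightarrow> x \<in> chart_dom c \<Longrightarrow> \<exists>v. \<eta> c (coord c x) v \<noteq> 0"
    and \<rho>: "\<And>c x v. c \<in> A \<Longrightarrow> x \<in> chart_dom c \<Longrightarrow> lie_deriv (Y c) (\<eta> c) (coord c x) v = \<rho> x * \<eta> c (coord c x) v"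
    and p: "p \<in> carrier A"
  shows "\<exists>\<delta>>0. \<exists>V. open V \<and> p \<in> V \<and> (\<forall>q\<in>V. \<forall>t\<in>{-\<delta>..\<delta>}. contact_at A \<eta> (flow A Y t) q)"
proof -
  obtain c where c: "c \<in> A" "p \<in> chart_dom c" using p by (auto simp: carrier_def)
  define U where "U = coord c ` chart_dom c"
  have U: "open U" "coord c p \<in> U" using open_chart_image[OF A c(1)] c by (auto simp: U_def)
  have sY: "smooth_on U (Y c)" using Y c by (simp add: vector_field_def U_def)
  have sm: "\<And>v. smooth_on U (\<lambda>y. \<eta> c y v)" and lin: "\<And>y. y \<in> U \<Longrightarrow> linear (\<eta> c y)"
    using \<eta> c unfolding one_form_def U_def by blast+
  have nzU: "\<exists>v. \<eta> c y v \<noteq> 0" if "y \<in> U" for y using nz[OF c(1)] that by (auto simp: U_def)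
  have \<rho>U: "lie_deriv (Y c) (\<eta> c) y v = \<rho> (chart_inv c y) * \<eta> c y v" if "y \<in> U" for y v
    using \<rho>[OF c(1), of "chart_inv c y" v] chart_inv_in_dom[OF A c(1)] coord_chart_inv[OF A c(1)] that by (simp add: U_def)
  obtain \<delta> r \<phi> W where L: "\<delta> > 0" "r > 0" "cball (coord c p) (2 * r) \<subseteq> U"
    "\<And>x. x \<in> ball (coord c p) r \<Longrightarrow> \<phi> x 0 = x"
    "\<And>x t. x \<in> ball (coord c p) r \<Longrightarrow> t \<in> {-\<delta>..\<delta>} \<Longrightarrow> \<phi> x t \<in> cball (coord c p) (2 * r)"
    "\<And>x t. x \<in> ball (coord c p) r \<Longrightarrow> t \<in> {-\<delta>..\<delta>} \<Longrightarrow>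
       (\<phi> x has_vector_derivative Y c (\<phi> x t)) (at t within {-\<delta>..\<delta>})"
    "\<And>x. x \<in> ball (coord c p) r \<Longrightarrow> W x 0 = id_blinfun"
    "\<And>x t. x \<in> ball (coord c p) r \<Longrightarrow> t \<in> {-\<delta>..\<delta>} \<Longrightarrow>
       (W x has_vector_derivative (total_deriv (Y c) (\<phi> x t) o\<^sub>L W x t)) (at t within {-\<delta>..\<delta>})"
    "\<And>x t. x \<in> ball (coord c p) r \<Longrightarrow> t \<in> {-\<delta>..\<delta>} \<Longrightarrow>
       ((\<lambda>x. \<phi> x t) has_derivative blinfun_apply (W x t)) (at x)"
    using local_flow[OF U(1) sY U(2)] by blast
  have \<phi>U: "\<phi> x t \<in> U" if "x \<in> ball (coord c p) r" "t \<in> {-\<delta>..\<delta>}" for x t using L(3) L(5)[OF that] by blast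
  define V where "V = {q \<in> chart_dom c. coord c q \<in> ball (coord c p) r}"
  have V: "open V" "p \<in> V"
    using open_chart_preimage[OF A c(1) open_ball] c L(2) by (auto simp: V_def)
  have fl: "flow A Y t q = Some (chart_inv c (\<phi> (coord c q) t))" if "q \<in> V" "t \<in> {-\<delta>..\<delta>}" for q t
  proof -
    have q: "q \<in> chart_dom c" "coord c q \<in> ball (coord c p) r" using that by (auto simp: V_def)
    have "flow A Y t (chart_inv c (\<phi> (coord c q) 0)) = Some (chart_inv c (\<phi> (coord c q) t))"
      by (rule flow_from_chart[OF A c(1) Y _ L(6)[OF q(2)] that(2)])
        (use \<phi>U[OF q(2)] in \<open>auto simp: U_def\<close>)
    then show ?thesis by (simp add: L(4)[OF q(2)] chart_inv_coord[OF A c(1) q(1)])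
  qed
  have "contact_at A \<eta> (flow A Y t) q" if q: "q \<in> V" and t: "t \<in> {-\<delta>..\<delta>}" for q t
  proof -
    define x where "x = coord c q"
    have x: "x \<in> ball (coord c p) r" "q \<in> chart_dom c" using q by (auto simp: V_def x_def)
    define y where "y = chart_inv c (\<phi> x t)"
    have y: "y \<in> chart_dom c" "coord c y = \<phi> x t"
      using \<phi>U[OF x(1) t] chart_inv_in_dom[OF A c(1)] coord_chart_inv[OF A c(1)] by (auto simp: y_def U_def)
    obtain k where k: "k \<noteq> 0" "\<And>v. \<eta> c (\<phi> x t) (blinfun_apply (W x t) v) = k * \<eta> c (\<phi> x 0) v"
      using conformal_along_curve[OF U(1) sm lin sY nzU \<rho>U L(1) \<phi>U[OF x(1)] L(6)[OF x(1)] L(7)[OF x(1)] L(8)[OF x(1)] t]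
      by blast
    have evV: "\<forall>\<^sub>F u in nhds q. u \<in> V" by (rule eventually_nhds_in_open[OF V(1) q])
    show ?thesis
    proof (rule contact_atI[OF A \<eta> _ _ _ k(1) c(1) x(2) c(1) y(1)])
      show "flow A Y t q = Some y" using fl[OF q t] by (simp add: y_def x_def)
      show "\<forall>\<^sub>F u in nhds q. flow A Y t u \<noteq> None"
        using evV by eventually_elim (simp add: fl[OF _ t])
      have "isCont (\<lambda>x. \<phi> x t) x" using has_derivative_continuous[OF L(9)[OF x(1) t]] .
      then have "((\<lambda>x. \<phi> x t) \<longlongrightarrow> coord c y) (nhds (coord c q))"
        unfolding y(2) x_def[symmetric]
        using tendsto_at_iff_tendsto_nhds[of "\<lambda>x. \<phi> x t" x] by (simp add: isCont_def)
      from filterlim_compose[OF tendsto_chart_inv[OF A c(1) y(1)] filterlim_compose[OF this tendsto_coord[OF A c(1) x(2)]]]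
      show "((\<lambda>u. the (flow A Y t u)) \<longlongrightarrow> y) (nhds q)"
        by (rule Lim_transform_eventually) (use evV in eventually_elim, simp add: fl[OF _ t])
      have "((\<lambda>x. \<phi> x t) has_derivative blinfun_apply (W x t)) (at (coord c q))"
        using L(9)[OF x(1) t] by (simp add: x_def)
      then show "(local_expr c c (flow A Y t) has_derivative blinfun_apply (W x t)) (at (coord c q))"
      proof (rule has_derivative_transform_within_open[OF _ open_ball])
        show "coord c q \<in> ball (coord c p) r" using x by (simp add: x_def)
        fix u assume u: "u \<in> ball (coord c p) r"
        then have uU: "u \<in> U" using L(3) L(2) by (auto simp: subset_eq)
        then have "chart_inv c u \<in> V" "coord c (chart_inv c u) = u"
          using u chart_inv_in_dom[OF A c(1)] coord_chart_inv[OF A c(1)] by (auto simp: V_def U_def)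
        then show "\<phi> u t = local_expr c c (flow A Y t) u"
          using fl[OF _ t, of "chart_inv c u"] coord_chart_inv[OF A c(1)] \<phi>U[OF u t]
          by (simp add: local_expr_def U_def)
      qed
      show "\<eta> c (coord c y) (blinfun_apply (W x t) v) = k * \<eta> c (coord c q) v" for v
        using k(2)[of v] y(2) L(4)[OF x(1)] by (simp add: x_def)
    qed
  qed
  then show ?thesis using L(1) V by blast
qed

text \<open>The neighbourhoods of \<open>contact_at_flow_local\<close> come with their own time
  bounds; finitely many of them cover the compact curve and leave one common bound
  \<open>\<delta>\<close>. The time \<open>t\<close> is cut into \<open>n\<close> steps of length at
  most \<open>\<delta>\<close>.\<close>

lemma contact_at_flow:
  assumes A: "smooth_atlas A" and \<eta>: "one_form A \<eta>" and Y: "vector_field A Y"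
    and nz: "\<And>c x. c \<in> A \<Longrightarrow> x \<in> chart_dom c \<Longrightarrow> \<exists>v. \<eta> c (coord c x) v \<noteq> 0"
    and \<rho>: "\<And>c x v. c \<in> A \<Longrightarrow> x \<in> chart_dom c \<Longrightarrow> lie_deriv (Y c) (\<eta> c) (coord c x) v = \<rho> x * \<eta> c (coord c x) v"
    and xy: "flow A Y t x = Some y"
  shows "contact_at A \<eta> (flow A Y t) x"
proof -
  obtain \<gamma> where \<gamma>: "integral_curve A Y (closed_segment 0 t) \<gamma>" "\<gamma> 0 = x"
    using xy unfolding flow_eq_Some_iff[OF A Y] flows_to_def by blast
  define K where "K = \<gamma> ` closed_segment 0 t"
  have "continuous_on (closed_segment 0 t) \<gamma>" "K \<subseteq> carrier A"
    using \<gamma>(1) unfolding integral_curve_def K_def by blast+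
  then have K: "compact K" unfolding K_def by (intro compact_continuous_image) auto
  have "\<forall>p\<in>K. \<exists>\<delta>>0. \<exists>V. open V \<and> p \<in> V \<and> (\<forall>q\<in>V. \<forall>t\<in>{-\<delta>..\<delta>}. contact_at A \<eta> (flow A Y t) q)"
    using contact_at_flow_local[OF A \<eta> Y, of \<rho>] nz \<rho> \<open>K \<subseteq> carrier A\<close> by (simp add: subset_eq)
  then obtain D V where DV: "\<And>p. p \<in> K \<Longrightarrow> D p > (0::real)" "\<And>p. p \<in> K \<Longrightarrow> open (V p)" "\<And>p. p \<in> K \<Longrightarrow> p \<in> V p"
    "\<And>p q t. p \<in> K \<Longrightarrow> q \<in> V p \<Longrightarrow> t \<in> {- D p..D p} \<Longrightarrow> contact_at A \<eta> (flow A Y t) q"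
    by metis
  obtain C where C: "C \<subseteq> K" "finite C" "K \<subseteq> (\<Union>p\<in>C. V p)"
    using compactE_image[OF K, of K V] DV(2,3) by blast
  have "x \<in> K" using \<gamma>(2) by (auto simp: K_def)
  then have "C \<noteq> {}" using C by blast
  define \<delta> where "\<delta> = Min (D ` C)"
  have \<delta>: "\<delta> > 0" "\<And>p. p \<in> C \<Longrightarrow> \<delta> \<le> D p"
    using C \<open>C \<noteq> {}\<close> DV(1) by (auto simp: \<delta>_def)
  have small: "contact_at A \<eta> (flow A Y s) q" if q: "q \<in> K" and s: "\<bar>s\<bar> \<le> \<delta>" for q s
  proof -
    obtain p where p: "p \<in> C" "q \<in> V p" using C(3) q by blast
    have "s \<in> {- D p..D p}" using \<delta>(2)[OF p(1)] s by auto
    then show ?thesis using DV(4) p C(1) by blast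
  qed
  obtain n :: nat where n: "\<bar>t\<bar> / \<delta> < real n" using reals_Archimedean2 by blast
  have n0: "n > 0"
  proof (rule ccontr)
    assume "\<not> n > 0"
    then have "\<bar>t\<bar> / \<delta> < 0" using n by simp
    then show False using \<delta>(1) by (simp add: divide_less_0_iff)
  qed
  define h where "h = t / real n"
  have h: "\<bar>h\<bar> \<le> \<delta>" "real n * h = t" using n n0 \<delta>(1) by (auto simp: h_def field_simps)
  have seg: "real m * h \<in> closed_segment 0 t" if "m \<le> n" for m
    unfolding closed_segment_def using that n0 by (auto simp: h_def field_simps intro!: exI[of _ "real m / real n"])
  have "m \<le> n \<Longrightarrow> contact_at A \<eta> (flow A Y (real m * h)) x" for m
  proof (induction m)
    case 0
    then show ?case using small[OF \<open>x \<in> K\<close>, of 0] \<delta>(1) by simp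
  next
    case (Suc m)
    let ?s = "real m * h"
    have "flow A Y ?s x = Some (\<gamma> ?s)"
      using flows_to_along_curve[OF \<gamma>(1) seg[of m]] Suc.prems \<gamma>(2) by (simp add: flow_eq_Some_iff[OF A Y])
    moreover have "contact_at A \<eta> (flow A Y h) (\<gamma> ?s)"
      by (rule small[OF _ h(1)]) (use seg[of m] Suc.prems in \<open>auto simp: K_def\<close>)
    ultimately have "contact_at A \<eta> (flow A Y h \<circ>\<^sub>m flow A Y ?s) x"
      using Suc by (intro contact_at_map_comp[OF A \<eta>]) auto
    \<comment> \<open>Concatenating curves shows that the composition is a restriction of the longer
      flow; \<open>contact_at_mono\<close> needs no more than that.\<close>
    moreover have "(flow A Y h \<circ>\<^sub>m flow A Y ?s) \<subseteq>\<^sub>m flow A Y (?s + h)"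
      unfolding map_le_def
    proof
      fix u assume "u \<in> dom (flow A Y h \<circ>\<^sub>m flow A Y ?s)"
      then obtain v w where vw: "flow A Y ?s u = Some v" "flow A Y h v = Some w"
        by (auto simp: map_comp_def split: option.splits)
      have "?s \<in> closed_segment 0 (?s + h)"
      proof -
        have "?s = (real m / (real m + 1)) * (?s + h)" by (simp add: field_simps)
        then show ?thesis
          unfolding closed_segment_def by (auto intro!: exI[of _ "real m / (real m + 1)"])
      qed
      then have "flow A Y (?s + h) u = Some w"
        using flows_to_concat vw unfolding flow_eq_Some_iff[OF A Y] by blast
      then show "(flow A Y h \<circ>\<^sub>m flow A Y ?s) u = flow A Y (?s + h) u"
        using vw by (simp add: map_comp_def)
    qed
    ultimately have "contact_at A \<eta> (flow A Y (?s + h)) x"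
      by (rule contact_at_mono[OF A \<eta>])
    then show ?case by (simp add: algebra_simps)
  qed
  from this[of n] show ?thesis using h(2) by simp
qed

section \<open>Lie series\<close>

text \<open>The derivative along the curve of the remainder for \<open>f\<close> is the remainder for \<open>dir_deriv Y f\<close>, with one
  term less.\<close>

lemma taylor_along_curves:
  fixes f :: "'e::euclidean_space \<Rightarrow> 'f::real_normed_vector"
  assumes "open U" "smooth_on U Y" "smooth_on U f" "compact K" "K \<subseteq> U"
  shows "\<exists>C\<ge>0. \<forall>\<delta>\<ge>0. \<forall>z. (\<forall>t\<in>{-\<delta>..\<delta>}. z t \<in> K \<and> (z has_vector_derivative Y (z t)) (at t within {-\<delta>..\<delta>})) \<longrightarrow>
     (\<forall>t\<in>{-\<delta>..\<delta>}. norm (f (z t) - (\<Sum>i<n. (t ^ i / fact i) *\<^sub>R (dir_deriv Y ^^ i) f (z 0))) \<le> C * \<bar>t\<bar> ^ n)"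
  using assms(3)
proof (induction n arbitrary: f)
  case 0
  have "bounded (f ` K)"
    using smooth_on_continuous[OF 0] assms compact_continuous_image compact_imp_bounded continuous_on_subset
    by metis
  then obtain C where C: "\<And>x. x \<in> K \<Longrightarrow> norm (f x) \<le> C" by (auto simp: bounded_iff)
  show ?case
    by (rule exI[of _ "max C 0"]) (use C in \<open>auto simp: le_max_iff_disj\<close>)
next
  case (Suc n)
  note sm = smooth_on_dir_deriv[OF assms(1,2) Suc.prems]
  from Suc.IH[OF sm] obtain C where C: "C \<ge> 0" and *: "\<And>\<delta> z t. \<delta> \<ge> 0 \<Longrightarrow>
     (\<And>t. t \<in> {-\<delta>..\<delta>} \<Longrightarrow> z t \<in> K \<and> (z has_vector_derivative Y (z t)) (at t within {-\<delta>..\<delta>})) \<Longrightarrow> t \<in> {-\<delta>..\<delta>} \<Longrightarrow>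
     norm (dir_deriv Y f (z t) - (\<Sum>i<n. (t ^ i / fact i) *\<^sub>R (dir_deriv Y ^^ i) (dir_deriv Y f) (z 0))) \<le> C * \<bar>t\<bar> ^ n"
    by blast
  show ?case
  proof (intro exI[of _ C] conjI allI impI ballI C)
    fix \<delta> :: real and z t
    assume \<delta>: "\<delta> \<ge> 0" and t: "t \<in> {-\<delta>..\<delta>}"
      and z: "\<forall>t\<in>{-\<delta>..\<delta>}. z t \<in> K \<and> (z has_vector_derivative Y (z t)) (at t within {-\<delta>..\<delta>})"
    define J where "J = closed_segment 0 t"
    have J: "J \<subseteq> {-\<delta>..\<delta>}" "convex J" "0 \<in> J" "t \<in> J" "\<And>s. s \<in> J \<Longrightarrow> \<bar>s\<bar> \<le> \<bar>t\<bar>"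
      using t \<delta> by (auto simp: J_def closed_segment_eq_real_ivl split: if_splits)
    define e where "e s = f (z s) - (\<Sum>i<Suc n. (s ^ i / fact i) *\<^sub>R (dir_deriv Y ^^ i) f (z 0))" for s
    define e' where "e' s = dir_deriv Y f (z s) - (\<Sum>i<n. (s ^ i / fact i) *\<^sub>R (dir_deriv Y ^^ i) (dir_deriv Y f) (z 0))" for s
    have d: "(e has_vector_derivative e' s) (at s within J)" if s: "s \<in> J" for s
    proof -
      have zs: "z s \<in> U" "(z has_vector_derivative Y (z s)) (at s within J)"
        using z J(1) s assms(5) has_vector_derivative_within_subset by blast+
      have "((\<lambda>s. f (z s)) has_derivative (\<lambda>h. frechet_derivative f (at (z s)) (h *\<^sub>R Y (z s)))) (at s within J)"
        using has_derivative_compose[OF zs(2)[unfolded has_vector_derivative_def] smooth_on_has_derivative[OF Suc.prems zs(1)]] .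
      then have 1: "((\<lambda>s. f (z s)) has_vector_derivative dir_deriv Y f (z s)) (at s within J)"
        using linear_scale[OF has_derivative_linear[OF smooth_on_has_derivative[OF Suc.prems zs(1)]]]
        by (simp add: has_vector_derivative_def dir_deriv_def)
      have 2: "((\<lambda>s. (s ^ Suc i / fact (Suc i)) *\<^sub>R v) has_vector_derivative (s ^ i / fact i) *\<^sub>R v) (at s within J)"
        for i and v :: 'f
      proof -
        have "((\<lambda>s. s ^ Suc i / fact (Suc i)) has_real_derivative (real (Suc i) * s ^ i / fact (Suc i))) (at s within J)"
          using DERIV_cdivide[OF DERIV_pow[of "Suc i" s J], of "fact (Suc i)"] by simp
        also have "real (Suc i) * s ^ i / fact (Suc i) = s ^ i / fact i"
          by (simp add: field_simps del: of_nat_Suc)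
        finally show ?thesis
          using has_vector_derivative_scaleR[OF _ has_vector_derivative_const[of v]] by fastforce
      qed
      have "((\<lambda>s. \<Sum>i<n. (s ^ Suc i / fact (Suc i)) *\<^sub>R (dir_deriv Y ^^ i) (dir_deriv Y f) (z 0)) has_vector_derivative
          (\<Sum>i<n. (s ^ i / fact i) *\<^sub>R (dir_deriv Y ^^ i) (dir_deriv Y f) (z 0))) (at s within J)"
        by (intro has_vector_derivative_sum 2)
      then have 3: "((\<lambda>s. f (z 0) + (\<Sum>i<n. (s ^ Suc i / fact (Suc i)) *\<^sub>R (dir_deriv Y ^^ i) (dir_deriv Y f) (z 0))) has_vector_derivative
          (\<Sum>i<n. (s ^ i / fact i) *\<^sub>R (dir_deriv Y ^^ i) (dir_deriv Y f) (z 0))) (at s within J)"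
        using has_vector_derivative_add[OF has_vector_derivative_const[of "f (z 0)"]] by fastforce
      have "(\<Sum>i<Suc n. (s ^ i / fact i) *\<^sub>R (dir_deriv Y ^^ i) f (z 0)) =
          f (z 0) + (\<Sum>i<n. (s ^ Suc i / fact (Suc i)) *\<^sub>R (dir_deriv Y ^^ i) (dir_deriv Y f) (z 0))" for s
        unfolding sum.lessThan_Suc_shift by (simp add: funpow_swap1 del: fact_Suc power_Suc)
      then show ?thesis
        unfolding e_def e'_def by (simp only:) (rule has_vector_derivative_diff[OF 1 3])
    qed
    have "norm (e t - e 0) \<le> (C * \<bar>t\<bar> ^ n) * \<bar>t - 0\<bar>"
    proof (rule vector_derivative_bound[OF J(2) d])
      fix s assume s: "s \<in> J"
      have "norm (e' s) \<le> C * \<bar>s\<bar> ^ n"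
        unfolding e'_def by (rule *[OF \<delta> bspec[OF z]]) (use s J in auto)
      also have "\<dots> \<le> C * \<bar>t\<bar> ^ n"
        using J(5)[OF s] C by (intro mult_left_mono power_mono) auto
      finally show "norm (e' s) \<le> C * \<bar>t\<bar> ^ n" .
    qed (use J in auto)
    moreover have "e 0 = 0" unfolding e_def sum.lessThan_Suc_shift by simp
    ultimately show "norm (f (z t) - (\<Sum>i<Suc n. (t ^ i / fact i) *\<^sub>R (dir_deriv Y ^^ i) f (z 0))) \<le> C * \<bar>t\<bar> ^ Suc n"
      by (simp add: e_def mult_ac)
  qed
qed

text \<open>The first letter differentiates first. For a composition, the flow applied last is
  expanded first, so concatenating words corresponds to listing the flows as in
  \<open>flow_composition\<close>, outermost first.\<close>

fun lie_word :: "('a \<Rightarrow> 'e::euclidean_space \<Rightarrow> 'e) \<Rightarrow> 'a list \<Rightarrow> ('e \<Rightarrow> 'f::real_normed_vector) \<Rightarrow> 'e \<Rightarrow> 'f" where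
  "lie_word Y [] f = f"
| "lie_word Y (j # w) f = lie_word Y w (dir_deriv (Y j) f)"

lemma smooth_on_lie_word:
  assumes "open U" "\<And>j. j \<in> S \<Longrightarrow> smooth_on U (Y j)"
  shows "set w \<subseteq> S \<Longrightarrow> smooth_on U f \<Longrightarrow> smooth_on U (lie_word Y w f)"
  by (induction w arbitrary: f) (auto intro: smooth_on_dir_deriv assms)

lemma lie_word_append: "lie_word Y (u @ v) f = lie_word Y v (lie_word Y u f)"
  by (induction u arbitrary: f) auto

lemma lie_word_replicate: "lie_word Y (replicate i j) f = (dir_deriv (Y j) ^^ i) f"
  by (induction i arbitrary: f) (auto simp: funpow_swap1)

definition words_upto :: "'a set \<Rightarrow> nat \<Rightarrow> 'a list set" where
  "words_upto S n = {w. set w \<subseteq> S \<and> length w \<le> n}"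

lemma finite_words_upto: "finite S \<Longrightarrow> finite (words_upto S n)"
  unfolding words_upto_def by (rule finite_lists_length_le)

text \<open>The noncommutative expansion of the i-th power of a sum: every word of length i occurs
  once. A further derivative is applied last and therefore appends a letter at the end.\<close>

lemma dir_deriv_funpow_sum:
  assumes U: "open U" and S: "finite S" and Y: "\<And>j. j \<in> S \<Longrightarrow> smooth_on U (Y j)" and f: "smooth_on U f"
    and Z: "\<And>x. x \<in> U \<Longrightarrow> Z x = (\<Sum>j\<in>S. Y j x)"
  shows "x \<in> U \<Longrightarrow> (dir_deriv Z ^^ i) f x = (\<Sum>w | set w \<subseteq> S \<and> length w = i. lie_word Y w f x)"
proof (induction i arbitrary: x)
  case 0
  have "{w. set w \<subseteq> S \<and> length w = 0} = {[]}" by auto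
  then show ?case by simp
next
  case (Suc i)
  let ?W = "{w. set w \<subseteq> S \<and> length w = i}"
  have sm: "smooth_on U (lie_word Y w f)" if "w \<in> ?W" for w
    using that smooth_on_lie_word[OF U Y _ f, where w = w] by simp
  have d: "((\<lambda>x. \<Sum>w\<in>?W. lie_word Y w f x) has_derivative
      (\<lambda>v. \<Sum>w\<in>?W. frechet_derivative (lie_word Y w f) (at x) v)) (at x)"
    by (rule has_derivative_sum) (rule smooth_on_has_derivative[OF sm Suc.prems])
  have "((dir_deriv Z ^^ i) f has_derivative
      (\<lambda>v. \<Sum>w\<in>?W. frechet_derivative (lie_word Y w f) (at x) v)) (at x)"
    by (rule has_derivative_transform_within_open[OF d U Suc.prems]) (simp add: Suc.IH)
  then have "(dir_deriv Z ^^ Suc i) f x = (\<Sum>w\<in>?W. frechet_derivative (lie_word Y w f) (at x) (Z x))"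
    by (simp add: dir_deriv_def[of Z "(dir_deriv Z ^^ i) f"] frechet_derivative_eq)
  also have "\<dots> = (\<Sum>w\<in>?W. \<Sum>j\<in>S. dir_deriv (Y j) (lie_word Y w f) x)"
  proof (rule sum.cong[OF refl])
    fix w assume "w \<in> ?W"
    have "linear (frechet_derivative (lie_word Y w f) (at x))"
      by (rule has_derivative_linear[OF smooth_on_has_derivative[OF sm Suc.prems]]) fact
    then show "frechet_derivative (lie_word Y w f) (at x) (Z x) = (\<Sum>j\<in>S. dir_deriv (Y j) (lie_word Y w f) x)"
      by (simp add: Z[OF Suc.prems] linear_sum dir_deriv_def)
  qed
  also have "\<dots> = (\<Sum>(w, j)\<in>?W \<times> S. lie_word Y (w @ [j]) f x)"
    by (simp add: sum.cartesian_product lie_word_append)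
  also have "\<dots> = (\<Sum>w | set w \<subseteq> S \<and> length w = Suc i. lie_word Y w f x)"
  proof (rule sum.reindex_bij_witness[where j = "\<lambda>(w, j). w @ [j]" and i = "\<lambda>w. (butlast w, last w)"])
    fix w assume w: "w \<in> {w. set w \<subseteq> S \<and> length w = Suc i}"
    then have "w \<noteq> []" by auto
    then show "(case (butlast w, last w) of (w, j) \<Rightarrow> w @ [j]) = w" by simp
    show "(butlast w, last w) \<in> ?W \<times> S"
      using w \<open>w \<noteq> []\<close> last_in_set[of w] in_set_butlastD[of _ w] by auto
  qed auto
  finally show ?case .
qed

text \<open>\<open>E\<close> depends on time and initial point. The bound is uniform for initial
  points near \<open>x0\<close>, which makes it stable under substituting the result of an earlier
  flow for the initial point.\<close>

definition vanishes_to_order :: "nat \<Rightarrow> 'e::topological_space \<Rightarrow> (real \<times> 'e \<Rightarrow> 'f::real_normed_vector) \<Rightarrow> bool" where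
  "vanishes_to_order n x0 E \<longleftrightarrow> (\<exists>C. \<forall>\<^sub>F p in nhds (0, x0). norm (E p) \<le> C * \<bar>fst p\<bar> ^ n)"

section \<open>Calculus of remainders near time zero\<close>

lemma vanishes_to_order_0: "vanishes_to_order n x0 (\<lambda>p. 0)"
  unfolding vanishes_to_order_def by (intro exI[of _ 0]) simp

lemma vanishes_to_order_add:
  assumes "vanishes_to_order n x0 E" "vanishes_to_order n x0 F"
  shows "vanishes_to_order n x0 (\<lambda>p. E p + F p)"
proof -
  obtain C D where "\<forall>\<^sub>F p in nhds (0, x0). norm (E p) \<le> C * \<bar>fst p\<bar> ^ n" "\<forall>\<^sub>F p in nhds (0, x0). norm (F p) \<le> D * \<bar>fst p\<bar> ^ n"
    using assms by (auto simp: vanishes_to_order_def)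
  then have "\<forall>\<^sub>F p in nhds (0, x0). norm (E p + F p) \<le> (C + D) * \<bar>fst p\<bar> ^ n"
    by eventually_elim (unfold distrib_right, rule norm_triangle_mono)
  then show ?thesis unfolding vanishes_to_order_def by blast
qed

lemma vanishes_to_order_sum:
  assumes "\<And>i. i \<in> I \<Longrightarrow> vanishes_to_order n x0 (E i)"
  shows "vanishes_to_order n x0 (\<lambda>p. \<Sum>i\<in>I. E i p)"
  using assms by (induction I rule: infinite_finite_induct)
    (auto intro: vanishes_to_order_0 vanishes_to_order_add)

lemma vanishes_to_order_uminus:
  "vanishes_to_order n x0 E \<Longrightarrow> vanishes_to_order n x0 (\<lambda>p. - E p)"
  by (simp add: vanishes_to_order_def)

lemma vanishes_to_order_diff:
  "vanishes_to_order n x0 E \<Longrightarrow> vanishes_to_order n x0 F \<Longrightarrow> vanishes_to_order n x0 (\<lambda>p. E p - F p)"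
  using vanishes_to_order_add[OF _ vanishes_to_order_uminus, of n x0 E F] by simp

lemma vanishes_to_order_scaleR:
  assumes s: "isCont s (0, x0)" and E: "vanishes_to_order n x0 E"
  shows "vanishes_to_order n x0 (\<lambda>p. s p *\<^sub>R E p)"
proof -
  obtain C where C: "\<forall>\<^sub>F p in nhds (0, x0). norm (E p) \<le> C * \<bar>fst p\<bar> ^ n"
    using E by (auto simp: vanishes_to_order_def)
  have "(s \<longlongrightarrow> s (0, x0)) (nhds (0, x0))"
    using s tendsto_at_iff_tendsto_nhds[of s "(0, x0)"] by (simp add: isCont_def)
  then have "\<forall>\<^sub>F p in nhds (0, x0). dist (s p) (s (0, x0)) < 1" by (rule tendstoD) simp
  with C have "\<forall>\<^sub>F p in nhds (0, x0). norm (s p *\<^sub>R E p) \<le> ((\<bar>s (0, x0)\<bar> + 1) * C) * \<bar>fst p\<bar> ^ n"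
  proof eventually_elim
    case p: (elim p)
    have "norm (s p *\<^sub>R E p) = \<bar>s p\<bar> * norm (E p)" by simp
    also have "\<dots> \<le> (\<bar>s (0, x0)\<bar> + 1) * (C * \<bar>fst p\<bar> ^ n)"
      using p by (intro mult_mono) (auto simp: dist_real_def intro: order_trans[OF norm_ge_zero])
    finally show ?case by simp
  qed
  then show ?thesis unfolding vanishes_to_order_def by blast
qed

lemma tendsto_fst_nhds: "(fst \<longlongrightarrow> t0) (nhds (t0, x0))"
  using tendsto_fst[OF filterlim_ident, of "(t0, x0)"] by simp

lemma tendsto_snd_nhds: "(snd \<longlongrightarrow> x0) (nhds (t0, x0))"
  using tendsto_snd[OF filterlim_ident, of "(t0, x0)"] by simp

lemma vanishes_to_order_monomial:
  fixes g :: "'e::t2_space \<Rightarrow> 'f::real_normed_vector"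
  assumes g: "isCont g x0" and m: "n \<le> m"
  shows "vanishes_to_order n x0 (\<lambda>p. fst p ^ m *\<^sub>R g (snd p))"
proof -
  have "(g \<longlongrightarrow> g x0) (nhds x0)"
    using g tendsto_at_iff_tendsto_nhds[of g x0] by (simp add: isCont_def)
  then have "((\<lambda>p. g (snd p)) \<longlongrightarrow> g x0) (nhds (0::real, x0))"
    by (rule filterlim_compose[OF _ tendsto_snd_nhds])
  then have 1: "\<forall>\<^sub>F p in nhds (0::real, x0). dist (g (snd p)) (g x0) < 1" by (rule tendstoD) simp
  have "\<forall>\<^sub>F p in nhds (0::real, x0). dist (fst p) 0 < 1"
    by (rule tendstoD[OF tendsto_fst_nhds]) simp
  with 1 have "\<forall>\<^sub>F p in nhds (0, x0). norm (fst p ^ m *\<^sub>R g (snd p)) \<le> (norm (g x0) + 1) * \<bar>fst p\<bar> ^ n"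
  proof eventually_elim
    case p: (elim p)
    have "norm (g (snd p)) \<le> norm (g x0) + 1"
      using p(1) norm_triangle_sub[of "g (snd p)" "g x0"] by (simp add: dist_norm)
    moreover have "\<bar>fst p\<bar> ^ m \<le> \<bar>fst p\<bar> ^ n"
      using p(2) m by (intro power_decreasing) auto
    ultimately have "\<bar>fst p\<bar> ^ m * norm (g (snd p)) \<le> \<bar>fst p\<bar> ^ n * (norm (g x0) + 1)"
      by (intro mult_mono) auto
    then show ?case
      by (simp add: power_abs mult.commute)
  qed
  then show ?thesis unfolding vanishes_to_order_def by blast
qed

lemma vanishes_to_order_compose:
  assumes E: "vanishes_to_order n x0 E" and G: "((\<lambda>p. G p) \<longlongrightarrow> x0) (nhds (0, x0))"
  shows "vanishes_to_order n x0 (\<lambda>p. E (a * fst p, G p))"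
proof -
  obtain C where C: "\<forall>\<^sub>F p in nhds (0, x0). norm (E p) \<le> C * \<bar>fst p\<bar> ^ n"
    using E by (auto simp: vanishes_to_order_def)
  have "((\<lambda>p. (a * fst p, G p)) \<longlongrightarrow> (0, x0)) (nhds (0, x0))"
    by (rule tendsto_Pair[OF tendsto_mult_right_zero[OF tendsto_fst_nhds] G])
  from eventually_compose_filterlim[OF C this]
  have "\<forall>\<^sub>F p in nhds (0, x0). norm (E (a * fst p, G p)) \<le> (C * \<bar>a\<bar> ^ n) * \<bar>fst p\<bar> ^ n"
    by eventually_elim (simp add: abs_mult power_mult_distrib)
  then show ?thesis unfolding vanishes_to_order_def by blast
qed

lemma chart_flow_expansion:
  assumes A: "smooth_atlas A" and c: "c \<in> A" and Y: "vector_field A Y" and x0: "x0 \<in> coord c ` chart_dom c"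
  shows "\<exists>\<phi>. (\<forall>\<^sub>F p in nhds (0, x0). flow A Y (fst p) (chart_inv c (snd p)) = Some (chart_inv c (\<phi> p)) \<and>
        \<phi> p \<in> coord c ` chart_dom c) \<and> (\<phi> \<longlongrightarrow> x0) (nhds (0, x0)) \<and>
     (\<forall>(f :: 'e \<Rightarrow> 'e::euclidean_space) n. smooth_on (coord c ` chart_dom c) f \<longrightarrow>
        vanishes_to_order n x0 (\<lambda>p. f (\<phi> p) - (\<Sum>i<n. (fst p ^ i / fact i) *\<^sub>R (dir_deriv (Y c) ^^ i) f (snd p))))"
proof -
  define U where "U = coord c ` chart_dom c"
  have U: "open U" "x0 \<in> U" using open_chart_image[OF A c] x0 by (auto simp: U_def)
  have sY: "smooth_on U (Y c)" using Y c by (simp add: vector_field_def U_def)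
  obtain \<delta> r \<phi> W where L: "\<delta> > 0" "r > 0" "cball x0 (2 * r) \<subseteq> U"
    "\<And>x. x \<in> ball x0 r \<Longrightarrow> \<phi> x 0 = x"
    "\<And>x t. x \<in> ball x0 r \<Longrightarrow> t \<in> {-\<delta>..\<delta>} \<Longrightarrow> \<phi> x t \<in> cball x0 (2 * r)"
    "\<And>x t. x \<in> ball x0 r \<Longrightarrow> t \<in> {-\<delta>..\<delta>} \<Longrightarrow>
       (\<phi> x has_vector_derivative Y c (\<phi> x t)) (at t within {-\<delta>..\<delta>})"
    "\<And>x. x \<in> ball x0 r \<Longrightarrow> W x 0 = id_blinfun"
    "\<And>x t. x \<in> ball x0 r \<Longrightarrow> t \<in> {-\<delta>..\<delta>} \<Longrightarrow>
       (W x has_vector_derivative (total_deriv (Y c) (\<phi> x t) o\<^sub>L W x t)) (at t within {-\<delta>..\<delta>})"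
    "\<And>x t. x \<in> ball x0 r \<Longrightarrow> t \<in> {-\<delta>..\<delta>} \<Longrightarrow>
       ((\<lambda>x. \<phi> x t) has_derivative blinfun_apply (W x t)) (at x)"
    using local_flow[OF U(1) sY U(2)] by blast
  have \<phi>U: "\<phi> x t \<in> U" if "x \<in> ball x0 r" "t \<in> {-\<delta>..\<delta>}" for x t using L(3) L(5)[OF that] by blast
  have dom: "\<forall>\<^sub>F p in nhds (0, x0). fst p \<in> {-\<delta>..\<delta>} \<and> snd p \<in> ball x0 r"
  proof -
    have "\<forall>\<^sub>F p in nhds (0, x0). p \<in> {-\<delta><..<\<delta>} \<times> ball x0 r"
      by (rule eventually_nhds_in_open) (use L in \<open>auto intro: open_Times\<close>)
    then show ?thesis by eventually_elim auto
  qed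
  have taylor: "vanishes_to_order n x0 (\<lambda>p. f (\<phi> (snd p) (fst p)) - (\<Sum>i<n. (fst p ^ i / fact i) *\<^sub>R (dir_deriv (Y c) ^^ i) f (snd p)))"
    if f: "smooth_on U f" for f :: "'e \<Rightarrow> 'e" and n
  proof -
    \<comment> \<open>The constant does not depend on the curve, so one \<open>C\<close> serves all
      initial points in \<open>ball x0 r\<close>.\<close>
    obtain C where C: "C \<ge> 0" "\<forall>\<delta>\<ge>0. \<forall>z. (\<forall>t\<in>{-\<delta>..\<delta>}. z t \<in> cball x0 (2 * r) \<and> (z has_vector_derivative Y c (z t)) (at t within {-\<delta>..\<delta>})) \<longrightarrow>
     (\<forall>t\<in>{-\<delta>..\<delta>}. norm (f (z t) - (\<Sum>i<n. (t ^ i / fact i) *\<^sub>R (dir_deriv (Y c) ^^ i) f (z 0))) \<le> C * \<bar>t\<bar> ^ n)"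
      using taylor_along_curves[OF U(1) sY f compact_cball L(3), of n] by blast
    from dom have "\<forall>\<^sub>F p in nhds (0, x0). norm (f (\<phi> (snd p) (fst p)) -
        (\<Sum>i<n. (fst p ^ i / fact i) *\<^sub>R (dir_deriv (Y c) ^^ i) f (snd p))) \<le> C * \<bar>fst p\<bar> ^ n"
    proof eventually_elim
      case (elim p)
      then have "\<forall>t\<in>{-\<delta>..\<delta>}. \<phi> (snd p) t \<in> cball x0 (2 * r) \<and>
          (\<phi> (snd p) has_vector_derivative Y c (\<phi> (snd p) t)) (at t within {-\<delta>..\<delta>})"
        using L(5,6) by blast
      with C(2) L(1) elim have "norm (f (\<phi> (snd p) (fst p)) -
          (\<Sum>i<n. (fst p ^ i / fact i) *\<^sub>R (dir_deriv (Y c) ^^ i) f (\<phi> (snd p) 0))) \<le> C * \<bar>fst p\<bar> ^ n"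
        using less_imp_le by blast
      then show ?case using elim L(4) by simp
    qed
    then show ?thesis unfolding vanishes_to_order_def by blast
  qed
  have fl: "\<forall>\<^sub>F p in nhds (0, x0). flow A Y (fst p) (chart_inv c (snd p)) = Some (chart_inv c (\<phi> (snd p) (fst p))) \<and> \<phi> (snd p) (fst p) \<in> U"
    using dom
  proof eventually_elim
    case p: (elim p)
    have "flow A Y (fst p) (chart_inv c (\<phi> (snd p) 0)) = Some (chart_inv c (\<phi> (snd p) (fst p)))"
      by (rule flow_from_chart[OF A c Y, of \<delta>]) (use p \<phi>U L(6) in \<open>auto simp: U_def\<close>)
    then show ?case
      using p L(4) \<phi>U by simp
  qed
  \<comment> \<open>Joint continuity at (0, x0) comes from the expansion of the identity with one
    term: |\<phi> x t - x| is at most C |t|.\<close>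
  have lim: "((\<lambda>p. \<phi> (snd p) (fst p)) \<longlongrightarrow> x0) (nhds (0, x0))"
  proof -
    obtain C where C: "\<forall>\<^sub>F p in nhds (0, x0). norm (\<phi> (snd p) (fst p) - snd p) \<le> C * \<bar>fst p\<bar>"
      using taylor[OF smooth_on_ident[OF U(1)], of 1] by (auto simp: vanishes_to_order_def)
    have "((\<lambda>p::real \<times> 'e. C * \<bar>fst p\<bar>) \<longlongrightarrow> C * \<bar>0\<bar>) (nhds (0, x0))"
      by (intro tendsto_intros tendsto_fst_nhds)
    then have "((\<lambda>p. \<phi> (snd p) (fst p) - snd p) \<longlongrightarrow> 0) (nhds (0, x0))"
      using C by (intro Lim_null_comparison[OF C]) simp
    from tendsto_add[OF this tendsto_snd_nhds] show ?thesis by simp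
  qed
  show ?thesis
    by (intro exI[of _ "\<lambda>p. \<phi> (snd p) (fst p)"] conjI allI impI fl[unfolded U_def] lim taylor) (simp add: U_def)
qed

section \<open>Lie series of compositions and of the flow of a sum\<close>

lemma continuous_power_fst: "isCont (\<lambda>p. (a * fst p) ^ i / b) (p :: real \<times> 'e::t2_space)"
  unfolding isCont_def
  by (rule tendsto_mono[OF at_within_le_nhds]) (cases p, auto simp: divide_inverse intro!: tendsto_intros tendsto_fst_nhds)

text \<open>The terms on the right are indexed by the words with a marked initial power of \<open>j\<close>.\<close>

lemma sum_words_conv_exp_letter:
  fixes L :: "'a list \<Rightarrow> 'v::real_vector"
  assumes S: "finite S" "j \<in> S"
  shows "(\<Sum>v\<in>words_upto S K. (t ^ length v * conv (exp_letter c j) a v) *\<^sub>R L v) =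
    (\<Sum>(i, w)\<in>{(i, w) \<in> {..<Suc K} \<times> words_upto S K. i + length w \<le> K}.
       (t ^ (i + length w) * (c ^ i / fact i * a w)) *\<^sub>R L (replicate i j @ w))"
proof -
  let ?W = "words_upto S K"
  have fin: "finite ?W" by (rule finite_words_upto[OF S(1)])
  define h where "h v i = (t ^ length v * (exp_letter c j (take i v) * a (drop i v))) *\<^sub>R L v" for v i
  have "(\<Sum>v\<in>?W. (t ^ length v * conv (exp_letter c j) a v) *\<^sub>R L v) = (\<Sum>v\<in>?W. \<Sum>i\<le>length v. h v i)"
    by (simp add: conv_def h_def sum_distrib_left scaleR_sum_left)
  also have "\<dots> = (\<Sum>(v, i)\<in>Sigma ?W (\<lambda>v. {..length v}). h v i)"
    by (rule sum.Sigma) (use fin in auto)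
  also have "\<dots> = (\<Sum>(v, i)\<in>{(v, i) \<in> Sigma ?W (\<lambda>v. {..length v}). take i v = replicate i j}. h v i)"
  proof (rule sum.mono_neutral_right)
    show "finite (Sigma ?W (\<lambda>v. {..length v}))" using fin by auto
    show "\<forall>x\<in>Sigma ?W (\<lambda>v. {..length v}) - {(v, i) \<in> Sigma ?W (\<lambda>v. {..length v}). take i v = replicate i j}.
        (case x of (v, i) \<Rightarrow> h v i) = 0"
    proof -
      have z: "take i v = replicate i j" if "exp_letter c j (take i v) \<noteq> 0" "i \<le> length v" for i v
        using that by (simp add: exp_letter_def min_absorb2 split: if_splits)
      show ?thesis by (auto simp: h_def dest: z)
    qed
  qed auto
  also have "\<dots> = (\<Sum>(i, w)\<in>{(i, w) \<in> {..<Suc K} \<times> ?W. i + length w \<le> K}.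
       (t ^ (i + length w) * (c ^ i / fact i * a w)) *\<^sub>R L (replicate i j @ w))"
  proof (rule sum.reindex_bij_witness[where j = "\<lambda>(v, i). (i, drop i v)" and i = "\<lambda>(i, w). (replicate i j @ w, i)"])
    fix x assume "x \<in> {(v, i) \<in> Sigma ?W (\<lambda>v. {..length v}). take i v = replicate i j}"
    then obtain v i where x: "x = (v, i)" "v \<in> ?W" "i \<le> length v" "take i v = replicate i j" by auto
    have v: "replicate i j @ drop i v = v" using x(4) append_take_drop_id[of i v] by simp
    show "(case case x of (v, i) \<Rightarrow> (i, drop i v) of (i, w) \<Rightarrow> (replicate i j @ w, i)) = x"
      using v by (simp add: x(1))
    show "(case x of (v, i) \<Rightarrow> (i, drop i v)) \<in> {(i, w) \<in> {..<Suc K} \<times> ?W. i + length w \<le> K}"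
      using x set_drop_subset[of i v] by (auto simp: words_upto_def)
    show "(case case x of (v, i) \<Rightarrow> (i, drop i v) of (i, w) \<Rightarrow>
        (t ^ (i + length w) * (c ^ i / fact i * a w)) *\<^sub>R L (replicate i j @ w)) = (case x of (v, i) \<Rightarrow> h v i)"
      using x v by (simp add: h_def exp_letter_def min_def)
  next
    fix y assume "y \<in> {(i, w) \<in> {..<Suc K} \<times> ?W. i + length w \<le> K}"
    then obtain i w where y: "y = (i, w)" "w \<in> ?W" "i + length w \<le> K" by auto
    show "(case case y of (i, w) \<Rightarrow> (replicate i j @ w, i) of (v, i) \<Rightarrow> (i, drop i v)) = y"
      by (simp add: y(1))
    show "(case y of (i, w) \<Rightarrow> (replicate i j @ w, i)) \<in> {(v, i) \<in> Sigma ?W (\<lambda>v. {..length v}). take i v = replicate i j}"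
      using y S(2) by (auto simp: words_upto_def)
  qed
  finally show ?thesis .
qed

lemma flow_composition_Cons:
  "flow_composition A X ((c, j) # cs) \<tau> = flow A (X j) (c * \<tau>) \<circ>\<^sub>m flow_composition A X cs \<tau>"
  by (simp add: flow_composition_def)

text \<open>Induction on the list. The head flow acts last, so \<open>f\<close> is first expanded
  along it at the intermediate point \<open>G p\<close>; the resulting functions \<open>g i\<close>,
  the iterated derivatives of \<open>f\<close>, are then expanded by the induction hypothesis.
  Powers of the head letter in front of words for the tail give the product of series.\<close>

lemma flow_composition_expansion:
  fixes A :: "('m::{t2_space, second_countable_topology}, 'e::euclidean_space) chart set"
  assumes A: "smooth_atlas A" and c: "c \<in> A" and S: "finite S" and X: "\<And>j. j \<in> S \<Longrightarrow> vector_field A (X j)"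
    and x0: "x0 \<in> coord c ` chart_dom c"
  shows "snd ` set cs \<subseteq> S \<Longrightarrow>
     \<exists>G. (\<forall>\<^sub>F p in nhds (0, x0). flow_composition A X cs (fst p) (chart_inv c (snd p)) = Some (chart_inv c (G p)) \<and>
        G p \<in> coord c ` chart_dom c) \<and> (G \<longlongrightarrow> x0) (nhds (0, x0)) \<and>
     (\<forall>f :: 'e \<Rightarrow> 'e. smooth_on (coord c ` chart_dom c) f \<longrightarrow>
        vanishes_to_order (Suc K) x0 (\<lambda>p. f (G p) -
          (\<Sum>w\<in>words_upto S K. (fst p ^ length w * word_coeff cs w) *\<^sub>R lie_word (\<lambda>j. X j c) w f (snd p))))"
proof (induction cs)
  case Nil
  have W: "finite (words_upto S K)" by (rule finite_words_upto[OF S])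
  have "(\<Sum>w\<in>words_upto S K. (fst p ^ length w * word_coeff [] w) *\<^sub>R lie_word (\<lambda>j. X j c) w f (snd p)) = f (snd p)"
    for f :: "'e \<Rightarrow> 'e" and p :: "real \<times> 'e"
  proof -
    have "(\<Sum>w\<in>words_upto S K. (fst p ^ length w * word_coeff [] w) *\<^sub>R lie_word (\<lambda>j. X j c) w f (snd p)) =
        (\<Sum>w\<in>{[]}. (fst p ^ length w * word_coeff [] w) *\<^sub>R lie_word (\<lambda>j. X j c) w f (snd p))"
      by (rule sum.mono_neutral_right[OF W]) (auto simp: words_upto_def word_one_def)
    then show ?thesis by (simp add: word_one_def)
  qed
  moreover have "\<forall>\<^sub>F p in nhds (0::real, x0). snd p \<in> coord c ` chart_dom c"
    by (rule topological_tendstoD[OF tendsto_snd_nhds open_chart_image[OF A c] x0])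
  ultimately show ?case
    by (intro exI[of _ snd]) (simp add: flow_composition_def tendsto_snd_nhds vanishes_to_order_0)
next
  case (Cons cj cs)
  obtain a j where cj: "cj = (a, j)" by (cases cj)
  let ?W = "words_upto S K" and ?U = "coord c ` chart_dom c"
  let ?L = "lie_word (\<lambda>j. X j c)"
  have W: "finite ?W" by (rule finite_words_upto[OF S])
  have U: "open ?U" by (rule open_chart_image[OF A c])
  have j: "j \<in> S" "snd ` set cs \<subseteq> S" using Cons.prems by (auto simp: cj)
  have sX: "smooth_on ?U (X j c)" if "j \<in> S" for j using X[OF that] c by (simp add: vector_field_def)
  from Cons.IH[OF j(2)] obtain G where
    G: "\<forall>\<^sub>F p in nhds (0, x0). flow_composition A X cs (fst p) (chart_inv c (snd p)) = Some (chart_inv c (G p)) \<and> G p \<in> ?U"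
      "(G \<longlongrightarrow> x0) (nhds (0, x0))"
    and GL: "\<forall>f :: 'e \<Rightarrow> 'e. smooth_on ?U f \<longrightarrow> vanishes_to_order (Suc K) x0 (\<lambda>p. f (G p) -
          (\<Sum>w\<in>?W. (fst p ^ length w * word_coeff cs w) *\<^sub>R ?L w f (snd p)))"
    by (elim exE conjE)
  from chart_flow_expansion[OF A c X[OF j(1)] x0] obtain \<phi> where
    \<phi>: "\<forall>\<^sub>F p in nhds (0, x0). flow A (X j) (fst p) (chart_inv c (snd p)) = Some (chart_inv c (\<phi> p)) \<and> \<phi> p \<in> ?U"
      "(\<phi> \<longlongrightarrow> x0) (nhds (0, x0))"
    and \<phi>L: "\<forall>(f :: 'e \<Rightarrow> 'e) n. smooth_on ?U f \<longrightarrow>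
        vanishes_to_order n x0 (\<lambda>p. f (\<phi> p) - (\<Sum>i<n. (fst p ^ i / fact i) *\<^sub>R (dir_deriv (X j c) ^^ i) f (snd p)))"
    by (elim exE conjE)
  define q where "q p = (a * fst p, G p)" for p :: "real \<times> 'e"
  have q: "(q \<longlongrightarrow> (0, x0)) (nhds (0, x0))"
    unfolding q_def by (rule tendsto_Pair[OF tendsto_mult_right_zero[OF tendsto_fst_nhds] G(2)])
  show ?case
  proof (intro exI[of _ "\<lambda>p. \<phi> (q p)"] conjI allI impI)
    show "((\<lambda>p. \<phi> (q p)) \<longlongrightarrow> x0) (nhds (0, x0))" by (rule filterlim_compose[OF \<phi>(2) q])
    show "\<forall>\<^sub>F p in nhds (0, x0). flow_composition A X (cj # cs) (fst p) (chart_inv c (snd p)) = Some (chart_inv c (\<phi> (q p))) \<and>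
        \<phi> (q p) \<in> ?U"
      using G(1) eventually_compose_filterlim[OF \<phi>(1) q]
      by eventually_elim (simp add: cj flow_composition_Cons q_def map_comp_def)
    fix f :: "'e \<Rightarrow> 'e" assume f: "smooth_on ?U f"
    define g where "g i = (dir_deriv (X j c) ^^ i) f" for i
    have g: "smooth_on ?U (g i)" for i
      unfolding g_def lie_word_replicate[of "\<lambda>j. X j c", symmetric] using j(1)
      by (intro smooth_on_lie_word[OF U sX _ f]) auto
    define s where "s i p = (a * fst p) ^ i / fact i" for i and p :: "real \<times> 'e"
    \<comment> \<open>\<open>E1\<close> is the truncation error of the head flow at
      \<open>G p\<close>, \<open>E2\<close> the remainders of the induction hypothesis for the
      \<open>g i\<close>. \<open>T\<close> lists the terms of the double expansion; those of total
      degree above \<open>K\<close> are of order \<open>Suc K\<close> and join the error.\<close>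
    define E1 where "E1 p = f (\<phi> (q p)) - (\<Sum>i<Suc K. s i p *\<^sub>R g i (G p))" for p
    define E2 where "E2 p = (\<Sum>i<Suc K. s i p *\<^sub>R (g i (G p) - (\<Sum>w\<in>?W. (fst p ^ length w * word_coeff cs w) *\<^sub>R ?L w (g i) (snd p))))" for p
    define T where "T p = (\<lambda>(i, w). (fst p ^ (i + length w) * (a ^ i / fact i * word_coeff cs w)) *\<^sub>R ?L (replicate i j @ w) f (snd p))" for p :: "real \<times> 'e"
    let ?D = "{..<Suc K} \<times> ?W" and ?Dlo = "{(i, w) \<in> {..<Suc K} \<times> ?W. i + length w \<le> K}"
    have "vanishes_to_order (Suc K) x0 E1"
      using vanishes_to_order_compose[OF \<phi>L[rule_format, OF f, of "Suc K"] G(2), of a]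
      by (simp only: E1_def[abs_def] q_def s_def g_def fst_conv snd_conv)
    moreover have "vanishes_to_order (Suc K) x0 E2"
      unfolding E2_def[abs_def] s_def
      by (intro vanishes_to_order_sum vanishes_to_order_scaleR continuous_power_fst GL[rule_format] g)
    moreover have "vanishes_to_order (Suc K) x0 (\<lambda>p. \<Sum>x\<in>?D - ?Dlo. T p x)"
    proof (rule vanishes_to_order_sum)
      fix x assume "x \<in> ?D - ?Dlo"
      then obtain i w where x: "x = (i, w)" "w \<in> ?W" "\<not> i + length w \<le> K" by auto
      then have deg: "Suc K \<le> i + length w" by simp
      have "smooth_on ?U (?L (replicate i j @ w) f)"
        using x(2) j(1) by (intro smooth_on_lie_word[OF U sX _ f]) (auto simp: words_upto_def)
      then have "isCont (?L (replicate i j @ w) f) x0"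
        using smooth_on_differentiable[OF _ x0] differentiable_imp_continuous_within by blast
      then have "isCont (\<lambda>x. (a ^ i / fact i * word_coeff cs w) *\<^sub>R ?L (replicate i j @ w) f x) x0"
        by (intro continuous_intros)
      from vanishes_to_order_monomial[OF this deg]
      show "vanishes_to_order (Suc K) x0 (\<lambda>p. T p x)" by (simp add: T_def x(1))
    qed
    ultimately have "vanishes_to_order (Suc K) x0 (\<lambda>p. E1 p + (E2 p + (\<Sum>x\<in>?D - ?Dlo. T p x)))"
      by (intro vanishes_to_order_add)
    moreover have "E1 p + (E2 p + (\<Sum>x\<in>?D - ?Dlo. T p x)) = f (\<phi> (q p)) -
        (\<Sum>w\<in>?W. (fst p ^ length w * word_coeff (cj # cs) w) *\<^sub>R ?L w f (snd p))" for p
    proof -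
      have "(\<Sum>i<Suc K. s i p *\<^sub>R (\<Sum>w\<in>?W. (fst p ^ length w * word_coeff cs w) *\<^sub>R ?L w (g i) (snd p))) = (\<Sum>x\<in>?D. T p x)"
        unfolding sum.cartesian_product[symmetric] T_def scaleR_sum_right
        by (intro sum.cong refl)
          (simp add: s_def g_def lie_word_append lie_word_replicate power_mult_distrib power_add mult_ac)
      also have "\<dots> = (\<Sum>x\<in>?D - ?Dlo. T p x) + (\<Sum>x\<in>?Dlo. T p x)"
        by (rule sum.subset_diff) (use W in auto)
      also have "(\<Sum>x\<in>?Dlo. T p x) = (\<Sum>w\<in>?W. (fst p ^ length w * word_coeff (cj # cs) w) *\<^sub>R ?L w f (snd p))"
        unfolding T_def cj word_coeff.simps by (rule sum_words_conv_exp_letter[OF S j(1), symmetric])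
      finally show ?thesis
        unfolding E1_def E2_def by (simp add: scaleR_diff_right sum_subtractf)
    qed
    ultimately show "vanishes_to_order (Suc K) x0 (\<lambda>p. f (\<phi> (q p)) -
          (\<Sum>w\<in>?W. (fst p ^ length w * word_coeff (cj # cs) w) *\<^sub>R ?L w f (snd p)))"
      by simp
  qed
qed

text \<open>Taylor's formula gives powers of the derivative along Z with weights t^i / i!; expanding
  each power into words gives every word of length i the coefficient 1 / i!, which is the target of
  \<open>exp_order\<close>.\<close>

lemma sum_flow_expansion:
  fixes A :: "('m::{t2_space, second_countable_topology}, 'e::euclidean_space) chart set"
  assumes A: "smooth_atlas A" and c: "c \<in> A" and S: "finite S" and X: "\<And>j. j \<in> S \<Longrightarrow> vector_field A (X j)"
    and Z: "vector_field A Z" "\<And>x. x \<in> coord c ` chart_dom c \<Longrightarrow> Z c x = (\<Sum>j\<in>S. X j c x)"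
    and x0: "x0 \<in> coord c ` chart_dom c"
  shows "\<exists>\<phi>. (\<forall>\<^sub>F p in nhds (0, x0). flow A Z (fst p) (chart_inv c (snd p)) = Some (chart_inv c (\<phi> p)) \<and>
        \<phi> p \<in> coord c ` chart_dom c) \<and>
     (\<forall>f :: 'e \<Rightarrow> 'e. smooth_on (coord c ` chart_dom c) f \<longrightarrow>
        vanishes_to_order (Suc K) x0 (\<lambda>p. f (\<phi> p) -
          (\<Sum>w\<in>words_upto S K. (fst p ^ length w * (1 / fact (length w))) *\<^sub>R lie_word (\<lambda>j. X j c) w f (snd p))))"
proof -
  let ?W = "words_upto S K" and ?U = "coord c ` chart_dom c"
  let ?L = "lie_word (\<lambda>j. X j c)"
  have U: "open ?U" by (rule open_chart_image[OF A c])
  have sX: "smooth_on ?U (X j c)" if "j \<in> S" for j using X[OF that] c by (simp add: vector_field_def)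
  from chart_flow_expansion[OF A c Z(1) x0] obtain \<phi> where
    \<phi>: "\<forall>\<^sub>F p in nhds (0, x0). flow A Z (fst p) (chart_inv c (snd p)) = Some (chart_inv c (\<phi> p)) \<and> \<phi> p \<in> ?U"
    and \<phi>L: "\<forall>(f :: 'e \<Rightarrow> 'e) n. smooth_on ?U f \<longrightarrow>
        vanishes_to_order n x0 (\<lambda>p. f (\<phi> p) - (\<Sum>i<n. (fst p ^ i / fact i) *\<^sub>R (dir_deriv (Z c) ^^ i) f (snd p)))"
    by (elim exE conjE)
  have inU: "\<forall>\<^sub>F p in nhds (0::real, x0). snd p \<in> ?U"
    by (rule topological_tendstoD[OF tendsto_snd_nhds U x0])
  have "vanishes_to_order (Suc K) x0 (\<lambda>p. f (\<phi> p) -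
          (\<Sum>w\<in>?W. (fst p ^ length w * (1 / fact (length w))) *\<^sub>R ?L w f (snd p)))"
    if f: "smooth_on ?U f" for f :: "'e \<Rightarrow> 'e"
  proof -
    have eq: "(\<Sum>i<Suc K. (t ^ i / fact i) *\<^sub>R (dir_deriv (Z c) ^^ i) f x) =
        (\<Sum>w\<in>?W. (t ^ length w * (1 / fact (length w))) *\<^sub>R ?L w f x)" if x: "x \<in> ?U" for t :: real and x
    proof -
      have "(\<Sum>i<Suc K. (t ^ i / fact i) *\<^sub>R (dir_deriv (Z c) ^^ i) f x) =
          (\<Sum>i<Suc K. \<Sum>w | w \<in> ?W \<and> length w = i. (t ^ length w * (1 / fact (length w))) *\<^sub>R ?L w f x)"
      proof (rule sum.cong[OF refl])
        fix i assume i: "i \<in> {..<Suc K}"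
        have "{w. set w \<subseteq> S \<and> length w = i} = {w. w \<in> ?W \<and> length w = i}"
          using i by (auto simp: words_upto_def)
        moreover have "(dir_deriv (Z c) ^^ i) f x = (\<Sum>w | set w \<subseteq> S \<and> length w = i. ?L w f x)"
          by (rule dir_deriv_funpow_sum[OF U S sX f Z(2) x])
        ultimately show "(t ^ i / fact i) *\<^sub>R (dir_deriv (Z c) ^^ i) f x =
          (\<Sum>w | w \<in> ?W \<and> length w = i. (t ^ length w * (1 / fact (length w))) *\<^sub>R ?L w f x)"
          by (auto simp: scaleR_sum_right intro!: sum.cong)
      qed
      also have "\<dots> = (\<Sum>w\<in>?W. (t ^ length w * (1 / fact (length w))) *\<^sub>R ?L w f x)"
        by (rule sum.group[OF finite_words_upto[OF S]]) (auto simp: words_upto_def)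
      finally show ?thesis .
    qed
    obtain C where C: "\<forall>\<^sub>F p in nhds (0, x0). norm (f (\<phi> p) -
        (\<Sum>i<Suc K. (fst p ^ i / fact i) *\<^sub>R (dir_deriv (Z c) ^^ i) f (snd p))) \<le> C * \<bar>fst p\<bar> ^ Suc K"
      using \<phi>L[rule_format, OF f, of "Suc K"] unfolding vanishes_to_order_def by blast
    show ?thesis
      unfolding vanishes_to_order_def
      by (rule exI[of _ C]) (use C inU in \<open>eventually_elim, simp only: eq\<close>)
  qed
  then show ?thesis using \<phi> by blast
qed

section \<open>Nondegeneracy of the contact volume\<close>

text \<open>Linear algebra at one point: \<open>a\<close> stands for \<eta> and \<open>w\<close> for
  d\<eta> there. The normalisation 1 / 2^n of \<open>contact_volume\<close> is dropped, since the
  question is only whether the sum vanishes.\<close>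

definition volume_term ::
    "nat \<Rightarrow> ('e \<Rightarrow> real) \<Rightarrow> ('e \<Rightarrow> 'e \<Rightarrow> real) \<Rightarrow> (nat \<Rightarrow> 'e) \<Rightarrow> (nat \<Rightarrow> nat) \<Rightarrow> real" where
  "volume_term n a w v \<sigma> = of_int (sign \<sigma>) * a (v (\<sigma> 0)) * (\<Prod>i<n. w (v (\<sigma> (2 * i + 1))) (v (\<sigma> (2 * i + 2))))"

definition form_volume ::
    "nat \<Rightarrow> ('e \<Rightarrow> real) \<Rightarrow> ('e \<Rightarrow> 'e \<Rightarrow> real) \<Rightarrow> (nat \<Rightarrow> 'e) \<Rightarrow> real" where
  "form_volume n a w v = (\<Sum>\<sigma> | \<sigma> permutes {..2 * n}. volume_term n a w v \<sigma>)"

text \<open>The m-th vector enters exactly one factor: \<open>a\<close> if its position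
  \<open>p = inv \<sigma> m\<close> is 0, otherwise the factor of \<open>w\<close> with index
  \<open>(p - 1) div 2\<close>.\<close>

lemma volume_term_linear:
  fixes a :: "'e::real_vector \<Rightarrow> real"
  assumes a: "linear a" and w: "\<And>u. linear (w u)" "\<And>u. linear (\<lambda>v. w v u)"
    and \<sigma>: "\<sigma> permutes {..2 * n}" and m: "m \<le> 2 * n"
  shows "linear (\<lambda>x. volume_term n a w (v(m := x)) \<sigma>)"
proof -
  have scaled: "linear (\<lambda>x. C * g x)" if "linear g" for g :: "'e \<Rightarrow> real" and C
    using linear_compose[OF that, of "\<lambda>y. C * y"] by (simp add: linear_iff comp_def algebra_simps)
  define p where "p = inv \<sigma> m"
  have p: "\<sigma> p = m" using permutes_inverses[OF \<sigma>] by (simp add: p_def)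
  have "p \<le> 2 * n" using permutes_in_image[OF permutes_inv[OF \<sigma>], of m] m by (simp add: p_def)
  have ne: "(v(m := x)) (\<sigma> q) = v (\<sigma> q)" if "q \<noteq> p" for q x
    using that p permutes_inj[OF \<sigma>] by (auto dest: injD)
  show ?thesis
  proof (cases "p = 0")
    case True
    have "volume_term n a w (v(m := x)) \<sigma> =
        (of_int (sign \<sigma>) * (\<Prod>i<n. w (v (\<sigma> (2 * i + 1))) (v (\<sigma> (2 * i + 2))))) * a x" for x
      using True p by (simp add: volume_term_def ne del: fun_upd_apply) simp
    then show ?thesis using scaled[OF a] by simp
  next
    case False
    define k where "k = (p - 1) div 2"
    have k: "k < n" "p = 2 * k + 1 \<or> p = 2 * k + 2" using False \<open>p \<le> 2 * n\<close> by (auto simp: k_def)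
    define R where "R = (\<Prod>i\<in>{..<n} - {k}. w (v (\<sigma> (2 * i + 1))) (v (\<sigma> (2 * i + 2))))"
    have rest: "(\<Prod>i\<in>{..<n} - {k}. w ((v(m := x)) (\<sigma> (2 * i + 1))) ((v(m := x)) (\<sigma> (2 * i + 2)))) = R" for x
      unfolding R_def
    proof (rule prod.cong[OF refl])
      fix i assume "i \<in> {..<n} - {k}"
      then have "i \<noteq> k" by simp
      then have neq: "2 * i + 1 \<noteq> p" "2 * i + 2 \<noteq> p" using k(2) by presburger+
      show "w ((v(m := x)) (\<sigma> (2 * i + 1))) ((v(m := x)) (\<sigma> (2 * i + 2))) =
          w (v (\<sigma> (2 * i + 1))) (v (\<sigma> (2 * i + 2)))"
        by (simp only: ne[OF neq(1)] ne[OF neq(2)])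
    qed
    have e: "volume_term n a w (v(m := x)) \<sigma> =
        (of_int (sign \<sigma>) * a (v (\<sigma> 0)) * R) * w ((v(m := x)) (\<sigma> (2 * k + 1))) ((v(m := x)) (\<sigma> (2 * k + 2)))" for x
    proof -
      have "(\<Prod>i<n. w ((v(m := x)) (\<sigma> (2 * i + 1))) ((v(m := x)) (\<sigma> (2 * i + 2)))) =
          w ((v(m := x)) (\<sigma> (2 * k + 1))) ((v(m := x)) (\<sigma> (2 * k + 2))) * R"
        using k(1) by (subst prod.remove[of _ k]) (simp_all only: rest finite_lessThan lessThan_iff)
      moreover have "(v(m := x)) (\<sigma> 0) = v (\<sigma> 0)" using False by (intro ne) simp
      ultimately show ?thesis by (simp add: volume_term_def)
    qed
    from k(2) show ?thesis
    proof
      assume pk: "p = 2 * k + 1"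
      have "(v(m := x)) (\<sigma> (2 * k + 1)) = x" "(v(m := x)) (\<sigma> (2 * k + 2)) = v (\<sigma> (2 * k + 2))" for x
        using p ne[of "2 * k + 2"] by (simp_all add: pk del: One_nat_def)
      then show ?thesis unfolding e using scaled[OF w(2)] by (simp only:)
    next
      assume pk: "p = 2 * k + 2"
      have "(v(m := x)) (\<sigma> (2 * k + 2)) = x" "(v(m := x)) (\<sigma> (2 * k + 1)) = v (\<sigma> (2 * k + 1))" for x
        using p ne[of "2 * k + 1"] by (simp_all add: pk del: One_nat_def)
      then show ?thesis unfolding e using scaled[OF w(1)] by (simp only:)
    qed
  qed
qed

text \<open>Composing all permutations with the transposition of \<open>i\<close> and
  \<open>j\<close> changes every sign but no value, so the sum equals its negative.\<close>

lemma form_volume_alternating: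
  assumes ij: "i \<noteq> j" "i \<le> 2 * n" "j \<le> 2 * n" "v i = v j"
  shows "form_volume n a w v = 0"
proof -
  let ?t = "Transposition.transpose i j"
  have t: "?t permutes {..2 * n}" using ij by (intro permutes_swap_id) auto
  have v: "v (?t k) = v k" for k using ij(4) by (auto simp: Transposition.transpose_def)
  have "form_volume n a w v = (\<Sum>\<sigma> | \<sigma> permutes {..2 * n}. volume_term n a w v (?t \<circ> \<sigma>))"
    unfolding form_volume_def by (rule setum_permutations_compose_left[OF t])
  also have "\<dots> = (\<Sum>\<sigma> | \<sigma> permutes {..2 * n}. - volume_term n a w v \<sigma>)"
  proof (rule sum.cong[OF refl])
    fix \<sigma> assume "\<sigma> \<in> {\<sigma>. \<sigma> permutes {..2 * n}}"
    then have "sign (?t \<circ> \<sigma>) = - sign \<sigma>"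
      using sign_compose[of ?t \<sigma>] permutes_imp_permutation[OF _ t] permutes_imp_permutation[of "{..2 * n}" \<sigma>] ij(1)
      by (simp add: sign_swap_id)
    then show "volume_term n a w v (?t \<circ> \<sigma>) = - volume_term n a w v \<sigma>"
      by (simp add: volume_term_def v)
  qed
  finally show ?thesis unfolding form_volume_def sum_negf by simp
qed

text \<open>If \<open>Z\<close> lies in the kernel of \<open>a\<close> and \<open>w Z\<close> is proportional to \<open>a\<close>, the permutations that put
  \<open>Z\<close> in a fixed argument of \<open>w\<close> cancel in pairs, by exchanging the partner of \<open>Z\<close> with the argument
  of \<open>a\<close>.\<close>

lemma form_volume_eq_0:
  assumes anti: "\<And>u v. w u v = - w v u" and Z: "a Z = 0" "\<And>u. w Z u = r * a u"
    and m: "v m = Z" "m \<le> 2 * n"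
  shows "form_volume n a w v = 0"
proof -
  let ?P = "{\<sigma>. \<sigma> permutes {..2 * n}}"
  have "(\<Sum>\<sigma> \<in> {\<sigma> \<in> ?P. inv \<sigma> m = p}. volume_term n a w v \<sigma>) = 0" if "p \<le> 2 * n" for p
  proof (cases "p = 0")
    case True
    show ?thesis
    proof (rule sum.neutral, rule ballI)
      fix \<sigma> assume "\<sigma> \<in> {\<sigma> \<in> ?P. inv \<sigma> m = p}"
      then have "\<sigma> 0 = m" using True permutes_inverses(1)[of \<sigma> "{..2 * n}" m] by auto
      then show "volume_term n a w v \<sigma> = 0" using m Z by (simp add: volume_term_def)
    qed
  next
    case False
    define k where "k = (p - 1) div 2"
    \<comment> \<open>The position paired with \<open>p\<close> in the k-th factor of
      \<open>w\<close>.\<close>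
    define p' where "p' = (if p = 2 * k + 1 then 2 * k + 2 else 2 * k + 1)"
    have k: "k < n" "p = 2 * k + 1 \<or> p = 2 * k + 2" using False that by (auto simp: k_def)
    have p': "p' \<noteq> 0" "p' \<noteq> p" "p' \<le> 2 * n" using k by (auto simp: p'_def)
    let ?t = "Transposition.transpose 0 p'"
    have t: "?t permutes {..2 * n}" using p' by (intro permutes_swap_id) auto
    define \<Phi> where "\<Phi> \<sigma> = \<sigma> \<circ> ?t" for \<sigma> :: "nat \<Rightarrow> nat"
    define Q where "Q = {\<sigma> \<in> ?P. inv \<sigma> m = p}"
    have Q: "\<sigma> \<in> Q \<longleftrightarrow> \<sigma> permutes {..2 * n} \<and> \<sigma> p = m" for \<sigma>
      unfolding Q_def using permutes_inverses[of \<sigma> "{..2 * n}"] by auto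
    have \<Phi>Q: "\<Phi> \<sigma> \<in> Q" if "\<sigma> \<in> Q" for \<sigma>
      using that permutes_compose[OF t] p' False by (auto simp: Q \<Phi>_def Transposition.transpose_def)
    have \<Phi>\<Phi>: "\<Phi> (\<Phi> \<sigma>) = \<sigma>" for \<sigma> by (simp add: \<Phi>_def comp_assoc)
    have neg: "volume_term n a w v (\<Phi> \<sigma>) = - volume_term n a w v \<sigma>" if \<sigma>: "\<sigma> \<in> Q" for \<sigma>
    proof -
      define R where "R = (\<Prod>i\<in>{..<n} - {k}. w (v (\<sigma> (2 * i + 1))) (v (\<sigma> (2 * i + 2))))"
      \<comment> \<open>The sign from antisymmetry when Z is the second argument. The factor then
        reads \<epsilon> r a(partner), so a(v (\<sigma> 0)) times it is symmetric under exchanging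
        positions 0 and \<open>p'\<close>, while the sign of \<sigma> flips.\<close>
      define \<epsilon> :: real where "\<epsilon> = (if p = 2 * k + 1 then 1 else - 1)"
      have fac: "w (v (\<tau> (2 * k + 1))) (v (\<tau> (2 * k + 2))) = \<epsilon> * r * a (v (\<tau> p'))" if "\<tau> p = m" for \<tau>
        using that k(2) m Z(2) anti[of _ Z] by (auto simp: \<epsilon>_def p'_def)
      have split: "volume_term n a w v \<tau> = of_int (sign \<tau>) * a (v (\<tau> 0)) * (\<epsilon> * r * a (v (\<tau> p')) *
          (\<Prod>i\<in>{..<n} - {k}. w (v (\<tau> (2 * i + 1))) (v (\<tau> (2 * i + 2)))))" if "\<tau> p = m" for \<tau>
      proof -
        have "(\<Prod>i<n. w (v (\<tau> (2 * i + 1))) (v (\<tau> (2 * i + 2)))) = w (v (\<tau> (2 * k + 1))) (v (\<tau> (2 * k + 2))) *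
            (\<Prod>i\<in>{..<n} - {k}. w (v (\<tau> (2 * i + 1))) (v (\<tau> (2 * i + 2))))"
          by (rule prod.remove) (use k(1) in auto)
        then show ?thesis unfolding volume_term_def fac[of \<tau>, OF that] by (rule arg_cong)
      qed
      have "(\<Prod>i\<in>{..<n} - {k}. w (v (\<Phi> \<sigma> (2 * i + 1))) (v (\<Phi> \<sigma> (2 * i + 2)))) = R"
        unfolding R_def
      proof (rule prod.cong[OF refl])
        fix i assume "i \<in> {..<n} - {k}"
        then have "i \<noteq> k" by simp
        then have "2 * i + 1 \<noteq> p'" "2 * i + 2 \<noteq> p'" unfolding p'_def by (split if_split; presburger)+
        then show "w (v (\<Phi> \<sigma> (2 * i + 1))) (v (\<Phi> \<sigma> (2 * i + 2))) = w (v (\<sigma> (2 * i + 1))) (v (\<sigma> (2 * i + 2)))"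
          by (simp add: \<Phi>_def Transposition.transpose_def)
      qed
      moreover have "sign (\<Phi> \<sigma>) = - sign \<sigma>"
        using \<sigma> sign_compose[of \<sigma> ?t] permutes_imp_permutation[OF _ t] permutes_imp_permutation[of "{..2 * n}" \<sigma>] p'(1)
        by (simp add: \<Phi>_def Q sign_swap_id)
      moreover have "\<Phi> \<sigma> 0 = \<sigma> p'" "\<Phi> \<sigma> p' = \<sigma> 0" by (simp_all add: \<Phi>_def)
      ultimately show ?thesis
        using split[of \<sigma>] split[of "\<Phi> \<sigma>"] \<sigma> \<Phi>Q[OF \<sigma>] by (simp add: Q R_def)
    qed
    have "(\<Sum>\<sigma>\<in>Q. volume_term n a w v \<sigma>) = (\<Sum>\<sigma>\<in>Q. - volume_term n a w v \<sigma>)"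
      by (rule sum.reindex_bij_witness[where i = \<Phi> and j = \<Phi>]) (auto simp: \<Phi>Q \<Phi>\<Phi> neg)
    then show ?thesis unfolding Q_def[symmetric] sum_negf by simp
  qed
  then have "(\<Sum>p\<in>{..2 * n}. \<Sum>\<sigma> \<in> {\<sigma> \<in> ?P. inv \<sigma> m = p}. volume_term n a w v \<sigma>) = 0"
    by (intro sum.neutral) simp
  moreover have "(\<Sum>p\<in>{..2 * n}. \<Sum>\<sigma> \<in> {\<sigma> \<in> ?P. inv \<sigma> m = p}. volume_term n a w v \<sigma>) = form_volume n a w v"
    unfolding form_volume_def
  proof (rule sum.group)
    show "(\<lambda>\<sigma>. inv \<sigma> m) ` ?P \<subseteq> {..2 * n}"
    proof
      fix p assume "p \<in> (\<lambda>\<sigma>. inv \<sigma> m) ` ?P"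
      then obtain \<sigma> where "\<sigma> permutes {..2 * n}" "p = inv \<sigma> m" by auto
      then show "p \<in> {..2 * n}" using permutes_in_image[OF permutes_inv, of \<sigma> "{..2 * n}" m] m by simp
    qed
  qed (auto intro: finite_permutations)
  ultimately show ?thesis by simp
qed

text \<open>In either case some Y with the properties of Z is a nontrivial combination of the
  \<open>v i\<close>: if they are independent they span the space and Y = Z will do, otherwise Y =
  0. Replacing \<open>v m\<close> by Y, where \<open>v m\<close> has nonzero coefficient, multiplies
  the volume by that coefficient, yet \<open>form_volume_eq_0\<close> makes the result vanish.
  Injectivity of \<open>v\<close> lets coefficients of vectors be read as coefficients of
  indices.\<close>

lemma form_volume_nondegenerate:
  fixes a :: "'e::euclidean_space \<Rightarrow> real"
  assumes a: "linear a" and w: "\<And>u. linear (w u)" "\<And>u. linear (\<lambda>v. w v u)" and anti: "\<And>u v. w u v = - w v u"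
    and Z: "a Z = 0" "\<And>u. w Z u = r * a u"
    and dim: "DIM('e) = 2 * n + 1" and vol: "form_volume n a w v \<noteq> 0"
  shows "Z = 0"
proof (rule ccontr)
  assume "Z \<noteq> 0"
  have inj: "inj_on v {..2 * n}"
    using form_volume_alternating[of _ _ n v a w] vol by (auto simp: inj_on_def)
  define B where "B = v ` {..2 * n}"
  have B: "finite B" "card B = DIM('e)" using inj dim by (auto simp: B_def card_image)
  have "\<exists>u Y s. (\<Sum>b\<in>B. u b *\<^sub>R b) = Y \<and> (\<exists>b\<in>B. u b \<noteq> 0) \<and> a Y = 0 \<and> (\<forall>x. w Y x = s * a x)"
  proof (cases "independent B")
    case True
    then have "Z \<in> span B" using B card_ge_dim_independent[of B UNIV] by auto
    then obtain u where u: "(\<Sum>b\<in>B. u b *\<^sub>R b) = Z"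
      unfolding span_finite[OF B(1)] by blast
    moreover have "\<exists>b\<in>B. u b \<noteq> 0"
    proof (rule ccontr)
      assume "\<not> (\<exists>b\<in>B. u b \<noteq> 0)"
      then have "(\<Sum>b\<in>B. u b *\<^sub>R b) = 0" by (intro sum.neutral) auto
      then show False using u \<open>Z \<noteq> 0\<close> by simp
    qed
    ultimately show ?thesis using Z by blast
  next
    case False
    then obtain u where "(\<Sum>b\<in>B. u b *\<^sub>R b) = 0" "\<exists>b\<in>B. u b \<noteq> 0"
      using dependent_finite[OF B(1)] by auto
    moreover have "a 0 = 0" "\<forall>x. w 0 x = 0 * a x" using linear_0[OF a] linear_0[OF w(2)] by simp_all
    ultimately show ?thesis by blast
  qed
  then obtain u Y s m where Y: "(\<Sum>b\<in>B. u b *\<^sub>R b) = Y" "a Y = 0" "\<And>x. w Y x = s * a x"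
    and m: "m \<le> 2 * n" "u (v m) \<noteq> 0"
    by (auto simp: B_def)
  have Ysum: "Y = (\<Sum>i\<le>2 * n. u (v i) *\<^sub>R v i)"
    unfolding Y(1)[symmetric] B_def by (simp add: sum.reindex[OF inj] comp_def)
  have lin: "linear (\<lambda>x. form_volume n a w (v(m := x)))"
    unfolding form_volume_def
    by (rule linear_compose_sum) (auto intro: volume_term_linear[OF a w _ m(1)])
  have "form_volume n a w (v(m := Y)) = (\<Sum>i\<le>2 * n. u (v i) * form_volume n a w (v(m := v i)))"
    unfolding Ysum linear_sum[OF lin, of "\<lambda>i. u (v i) *\<^sub>R v i"] by (simp add: linear_scale[OF lin])
  also have "\<dots> = (\<Sum>i\<in>{m}. u (v i) * form_volume n a w (v(m := v i)))"
  proof (rule sum.mono_neutral_right)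
    show "\<forall>i\<in>{..2 * n} - {m}. u (v i) * form_volume n a w (v(m := v i)) = 0"
    proof
      fix i assume "i \<in> {..2 * n} - {m}"
      then have "form_volume n a w (v(m := v i)) = 0"
        using m(1) by (intro form_volume_alternating[of m i]) auto
      then show "u (v i) * form_volume n a w (v(m := v i)) = 0" by simp
    qed
  qed (use m in auto)
  finally have "form_volume n a w (v(m := Y)) = u (v m) * form_volume n a w v" by simp
  moreover have "form_volume n a w (v(m := Y)) = 0"
    by (rule form_volume_eq_0[of w a Y s, OF anti Y(2,3) _ m(1)]) simp
  ultimately show False using m vol by simp
qed

section \<open>Additivity of contact Hamiltonian vector fields\<close>

lemma ext_deriv_linear_left:
  assumes U: "open U" and sm: "\<And>v. smooth_on U (\<lambda>y. \<alpha> y v)" and lin: "\<And>y. y \<in> U \<Longrightarrow> linear (\<alpha> y)"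
    and x: "x \<in> U"
  shows "linear (\<lambda>u. ext_deriv \<alpha> x u v)"
proof -
  have "linear (\<lambda>u. frechet_derivative (\<lambda>y. \<alpha> y v) (at x) u)"
    by (rule has_derivative_linear[OF smooth_on_has_derivative[OF sm x]])
  moreover have "linear (\<lambda>u. frechet_derivative (\<lambda>y. \<alpha> y u) (at x) v)"
  proof -
    have "(\<lambda>u. frechet_derivative (\<lambda>y. \<alpha> y u) (at x) v) =
        (\<lambda>u. \<Sum>b\<in>Basis. (u \<bullet> b) * frechet_derivative (\<lambda>y. \<alpha> y b) (at x) v)"
      by (rule ext) (rule form_derivative_eq_sum_Basis[OF U sm lin x])
    moreover have "linear (\<lambda>u. \<Sum>b\<in>Basis. (u \<bullet> b) * frechet_derivative (\<lambda>y. \<alpha> y b) (at x) v)"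
      by (rule linearI) (simp_all add: inner_add_left distrib_right sum.distrib sum_distrib_left mult_ac)
    ultimately show ?thesis by simp
  qed
  ultimately show ?thesis unfolding ext_deriv_def by (rule linear_compose_sub)
qed

lemma ext_deriv_antisym: "ext_deriv \<alpha> x u v = - ext_deriv \<alpha> x v u"
  by (simp add: ext_deriv_def)

text \<open>The difference Z of the two sides lies in the kernel of \<eta>, and by Cartan's formula
  d\<eta>(Z, .) is a multiple of \<eta>. Nondegeneracy leaves only Z = 0.\<close>

lemma contact_hamiltonian_vf_sum:
  fixes A :: "('m::{t2_space, second_countable_topology}, 'e::euclidean_space) chart set"
  assumes M: "exact_contact_manifold n A \<eta>" and S: "finite S"
    and H: "\<And>x. x \<in> carrier A \<Longrightarrow> H x = (\<Sum>j\<in>S. \<phi> j x)"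
    and XH: "contact_hamiltonian_vf A \<eta> H X_H"
    and X: "\<And>j. j \<in> S \<Longrightarrow> contact_hamiltonian_vf A \<eta> (\<phi> j) (X j)"
    and c: "c \<in> A" and x: "x \<in> coord c ` chart_dom c"
  shows "X_H c x = (\<Sum>j\<in>S. X j c x)"
proof -
  have A: "smooth_atlas A" and \<eta>: "one_form A \<eta>" and dim: "DIM('e) = 2 * n + 1"
    using M by (auto simp: exact_contact_manifold_def)
  define U where "U = coord c ` chart_dom c"
  have U: "open U" "x \<in> U" using open_chart_image[OF A c] x by (auto simp: U_def)
  define \<alpha> where "\<alpha> = \<eta> c"
  have sm: "\<And>v. smooth_on U (\<lambda>y. \<alpha> y v)" and lin: "\<And>y. y \<in> U \<Longrightarrow> linear (\<alpha> y)"
    using \<eta> c unfolding one_form_def U_def \<alpha>_def by blast+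
  have inU: "chart_inv c y \<in> chart_dom c" "coord c (chart_inv c y) = y" if "y \<in> U" for y
    using chart_inv_in_dom[OF A c] coord_chart_inv[OF A c] that by (auto simp: U_def)
  define p where "p = chart_inv c x"
  have vf: "smooth_on U (Y c)" "\<exists>\<rho>. \<forall>v. lie_deriv (Y c) \<alpha> x v = \<rho> * \<alpha> x v"
      "\<And>y. y \<in> U \<Longrightarrow> \<alpha> y (Y c y) = - h (chart_inv c y)" if Y: "contact_hamiltonian_vf A \<eta> h Y" for h Y
  proof -
    show "smooth_on U (Y c)"
      using Y c by (simp add: contact_hamiltonian_vf_def vector_field_def U_def)
    obtain \<rho> where \<rho>: "\<And>x v. x \<in> chart_dom c \<Longrightarrow> lie_deriv (Y c) \<alpha> (coord c x) v = \<rho> x * \<alpha> (coord c x) v"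
      using Y c unfolding contact_hamiltonian_vf_def \<alpha>_def by blast
    have "lie_deriv (Y c) \<alpha> x v = \<rho> p * \<alpha> x v" for v
      using \<rho>[of p v] inU[OF U(2)] by (simp add: p_def)
    then show "\<exists>\<rho>. \<forall>v. lie_deriv (Y c) \<alpha> x v = \<rho> * \<alpha> x v" by blast
    show "\<alpha> y (Y c y) = - h (chart_inv c y)" if "y \<in> U" for y
    proof -
      have "\<alpha> (coord c (chart_inv c y)) (Y c (coord c (chart_inv c y))) = - h (chart_inv c y)"
        using Y c inU(1)[OF that] unfolding contact_hamiltonian_vf_def \<alpha>_def by blast
      then show ?thesis by (simp add: inU(2)[OF that])
    qed
  qed
  have pair: "((\<lambda>y. \<alpha> y (Y y)) has_derivative frechet_derivative (\<lambda>y. \<alpha> y (Y y)) (at x)) (at x)"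
    if Y: "smooth_on U Y" for Y
  proof -
    have "((\<lambda>y. \<alpha> y (Y y)) has_derivative
        (\<lambda>h. frechet_derivative (\<lambda>y. \<alpha> y (Y x)) (at x) h + \<alpha> x (frechet_derivative Y (at x) h))) (at x within U)"
      by (rule form_pairing_has_derivative[OF U(1) sm lin has_derivative_ident _ U(2)])
        (use smooth_on_has_derivative[OF Y U(2)] has_derivative_at_withinI in auto)
    then have "(\<lambda>y. \<alpha> y (Y y)) differentiable (at x)"
      unfolding at_within_open[OF U(2,1)] differentiable_def by blast
    then show ?thesis by (simp add: frechet_derivative_works)
  qed
  have "((\<lambda>y. \<Sum>j\<in>S. \<alpha> y (X j c y)) has_derivative
      (\<lambda>v. \<Sum>j\<in>S. frechet_derivative (\<lambda>y. \<alpha> y (X j c y)) (at x) v)) (at x)"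
    by (intro has_derivative_sum pair vf(1)[OF X])
  \<comment> \<open>The pairings with \<alpha> agree on all of \<open>U\<close>, not just at
    \<open>x\<close>, so their derivatives at \<open>x\<close> agree as well.\<close>
  then have "((\<lambda>y. \<alpha> y (X_H c y)) has_derivative
      (\<lambda>v. \<Sum>j\<in>S. frechet_derivative (\<lambda>y. \<alpha> y (X j c y)) (at x) v)) (at x)"
  proof (rule has_derivative_transform_within_open[OF _ U])
    fix y assume y: "y \<in> U"
    have "chart_inv c y \<in> carrier A" using inU(1)[OF y] c by (auto simp: carrier_def)
    then show "(\<Sum>j\<in>S. \<alpha> y (X j c y)) = \<alpha> y (X_H c y)"
      using vf(3)[OF XH y] vf(3)[OF X y] H by (simp add: sum_negf)
  qed
  note dH = frechet_derivative_eq[OF this]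
  define Z where "Z = X_H c x - (\<Sum>j\<in>S. X j c x)"
  have extl: "linear (\<lambda>u. ext_deriv \<alpha> x u v)" for v by (rule ext_deriv_linear_left[OF U(1) sm lin U(2)])
  have extr: "linear (ext_deriv \<alpha> x u)" for u
  proof -
    have "linear (\<lambda>v. - ext_deriv \<alpha> x v u)" by (rule linear_compose_neg[OF extl])
    then show ?thesis by (simp flip: ext_deriv_antisym)
  qed
  obtain \<rho>H where \<rho>H: "\<And>v. lie_deriv (X_H c) \<alpha> x v = \<rho>H * \<alpha> x v" using vf(2)[OF XH] by blast
  have "\<forall>j\<in>S. \<exists>\<rho>. \<forall>v. lie_deriv (X j c) \<alpha> x v = \<rho> * \<alpha> x v" using vf(2)[OF X] by blast
  then obtain \<rho> where \<rho>: "\<And>j v. j \<in> S \<Longrightarrow> lie_deriv (X j c) \<alpha> x v = \<rho> j * \<alpha> x v" by metis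
  have "ext_deriv \<alpha> x Z v = (\<rho>H - (\<Sum>j\<in>S. \<rho> j)) * \<alpha> x v" for v
  proof -
    have "ext_deriv \<alpha> x Z v = ext_deriv \<alpha> x (X_H c x) v - (\<Sum>j\<in>S. ext_deriv \<alpha> x (X j c x) v)"
      unfolding Z_def linear_diff[OF extl] linear_sum[OF extl] ..
    \<comment> \<open>The terms d(\<alpha>(Y)) in Cartan's formula cancel by
      \<open>dH\<close>.\<close>
    also have "\<dots> = lie_deriv (X_H c) \<alpha> x v - (\<Sum>j\<in>S. lie_deriv (X j c) \<alpha> x v)"
      unfolding lie_deriv_def dH by (simp add: sum.distrib)
    also have "\<dots> = (\<rho>H - (\<Sum>j\<in>S. \<rho> j)) * \<alpha> x v"
      by (simp add: \<rho>H \<rho> left_diff_distrib sum_distrib_right)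
    finally show ?thesis .
  qed
  moreover have "\<alpha> x Z = 0"
  proof -
    have "p \<in> carrier A" using inU(1)[OF U(2)] c by (auto simp: carrier_def p_def)
    then have "\<alpha> x (X_H c x) = (\<Sum>j\<in>S. \<alpha> x (X j c x))"
      using vf(3)[OF XH U(2)] vf(3)[OF X U(2)] H by (simp add: sum_negf p_def)
    then show ?thesis
      unfolding Z_def linear_diff[OF lin[OF U(2)]] linear_sum[OF lin[OF U(2)]] by simp
  qed
  moreover obtain v where "form_volume n (\<alpha> x) (ext_deriv \<alpha> x) v \<noteq> 0"
  proof -
    have "\<exists>v. contact_volume n (\<eta> c) (coord c p) v \<noteq> 0"
      using M c inU(1)[OF U(2)] unfolding exact_contact_manifold_def p_def by blast
    then show thesis
      using that inU(2)[OF U(2)]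
      by (auto simp: contact_volume_def form_volume_def volume_term_def \<alpha>_def p_def)
  qed
  ultimately have "Z = 0"
    by (intro form_volume_nondegenerate[OF lin[OF U(2)] extr extl ext_deriv_antisym _ _ dim])
  then show ?thesis by (simp add: Z_def)
qed

section \<open>Compositions of flows as contact integrators\<close>

lemma exact_contact_form_nonzero:
  assumes "exact_contact_manifold n A \<eta>" "c \<in> A" "x \<in> chart_dom c"
  shows "\<exists>v. \<eta> c (coord c x) v \<noteq> 0"
proof (rule ccontr)
  assume "\<not> (\<exists>v. \<eta> c (coord c x) v \<noteq> 0)"
  then have "contact_volume n (\<eta> c) (coord c x) v = 0" for v
    by (simp add: contact_volume_def)
  then show False using assms unfolding exact_contact_manifold_def by blast
qed

text \<open>The empty composition is \<open>Some\<close>, defined on the whole type, whereas a flow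
  is defined at points of \<open>carrier A\<close> only. The induction therefore starts from a
  single flow.\<close>

lemma contact_at_flow_composition:
  assumes A: "smooth_atlas A" and \<eta>: "one_form A \<eta>"
    and flow: "\<And>j t x y. j \<in> S \<Longrightarrow> flow A (X j) t x = Some y \<Longrightarrow> contact_at A \<eta> (flow A (X j) t) x"
  shows "cs \<noteq> [] \<Longrightarrow> snd ` set cs \<subseteq> S \<Longrightarrow> flow_composition A X cs \<tau> x = Some y \<Longrightarrow>
    contact_at A \<eta> (flow_composition A X cs \<tau>) x"
proof (induction cs arbitrary: y)
  case (Cons cj cs)
  obtain a j where cj: "cj = (a, j)" by (cases cj)
  have j: "j \<in> S" using Cons.prems by (simp add: cj)
  show ?case
  proof (cases "cs = []")
    case True
    then have "flow_composition A X (cj # cs) \<tau> = flow A (X j) (a * \<tau>)"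
      by (auto simp: cj flow_composition_def map_comp_def)
    then show ?thesis using flow[OF j] Cons.prems by simp
  next
    case False
    obtain z where z: "flow_composition A X cs \<tau> x = Some z" "flow A (X j) (a * \<tau>) z = Some y"
      using Cons.prems(3) by (auto simp: cj flow_composition_Cons map_comp_def split: option.splits)
    show ?thesis
      unfolding cj flow_composition_Cons
      by (rule contact_at_map_comp[OF A \<eta> Cons.IH[OF False _ z(1)] z(1) flow[OF j z(2)]])
        (use Cons.prems in auto)
  qed
qed simp

text \<open>With the identity as \<open>f\<close>, both expansions describe the maps in coordinates.
  Their coefficients agree on all words of length at most \<open>K\<close>, so only remainders of
  order \<open>Suc K\<close> survive.\<close>

lemma integrator_of_order_flow_composition:
  fixes A :: "('m::{t2_space, second_countable_topology}, 'e::euclidean_space) chart set"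
  assumes A: "smooth_atlas A" and S: "finite S" and X: "\<And>j. j \<in> S \<Longrightarrow> vector_field A (X j)"
    and Z: "vector_field A Z" "\<And>c x. c \<in> A \<Longrightarrow> x \<in> coord c ` chart_dom c \<Longrightarrow> Z c x = (\<Sum>j\<in>S. X j c x)"
    and cs: "snd ` set cs \<subseteq> S" "exp_order S K cs"
  shows "integrator_of_order A Z K (flow_composition A X cs)"
  unfolding integrator_of_order_def
proof (intro ballI)
  fix c x assume c: "c \<in> A" and x: "x \<in> chart_dom c"
  let ?U = "coord c ` chart_dom c"
  define x0 where "x0 = coord c x"
  have x0: "x0 \<in> ?U" "chart_inv c x0 = x" using x chart_inv_coord[OF A c x] by (simp_all add: x0_def)
  have id: "smooth_on ?U (\<lambda>x. x)" by (rule smooth_on_ident[OF open_chart_image[OF A c]])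
  let ?L = "\<lambda>w. lie_word (\<lambda>j. X j c) w (\<lambda>x. x)"
  obtain G where G: "\<forall>\<^sub>F p in nhds (0, x0). flow_composition A X cs (fst p) (chart_inv c (snd p)) = Some (chart_inv c (G p)) \<and> G p \<in> ?U"
    and GL: "vanishes_to_order (Suc K) x0 (\<lambda>p. G p -
          (\<Sum>w\<in>words_upto S K. (fst p ^ length w * word_coeff cs w) *\<^sub>R ?L w (snd p)))"
    using flow_composition_expansion[where X = X and K = K, OF A c S X x0(1) cs(1)] id by blast
  obtain \<phi> where \<phi>: "\<forall>\<^sub>F p in nhds (0, x0). flow A Z (fst p) (chart_inv c (snd p)) = Some (chart_inv c (\<phi> p)) \<and> \<phi> p \<in> ?U"
    and \<phi>L: "vanishes_to_order (Suc K) x0 (\<lambda>p. \<phi> p -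
          (\<Sum>w\<in>words_upto S K. (fst p ^ length w * (1 / fact (length w))) *\<^sub>R ?L w (snd p)))"
    using sum_flow_expansion[where X = X and K = K, OF A c S X Z(1) Z(2)[OF c] x0(1)] id by blast
  have "(\<Sum>w\<in>words_upto S K. (t ^ length w * word_coeff cs w) *\<^sub>R ?L w y) =
      (\<Sum>w\<in>words_upto S K. (t ^ length w * (1 / fact (length w))) *\<^sub>R ?L w y)" for t :: real and y
    by (rule sum.cong) (use cs(2) in \<open>auto simp: exp_order_def words_upto_def\<close>)
  then have "vanishes_to_order (Suc K) x0 (\<lambda>p. G p - \<phi> p)"
    using vanishes_to_order_diff[OF GL \<phi>L] by simp
  then obtain C where C: "\<forall>\<^sub>F p in nhds (0, x0). norm (G p - \<phi> p) \<le> C * \<bar>fst p\<bar> ^ Suc K"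
    unfolding vanishes_to_order_def by blast
  have lim: "((\<lambda>\<tau>. (\<tau>, x0)) \<longlongrightarrow> (0, x0)) (at 0)" by (intro tendsto_intros)
  have G': "\<forall>\<^sub>F \<tau> in at 0. flow_composition A X cs \<tau> x = Some (chart_inv c (G (\<tau>, x0))) \<and> G (\<tau>, x0) \<in> ?U"
    using eventually_compose_filterlim[OF G lim] by (simp add: x0(2))
  have \<phi>': "\<forall>\<^sub>F \<tau> in at 0. flow A Z \<tau> x = Some (chart_inv c (\<phi> (\<tau>, x0))) \<and> \<phi> (\<tau>, x0) \<in> ?U"
    using eventually_compose_filterlim[OF \<phi> lim] by (simp add: x0(2))
  have "\<forall>\<^sub>F \<tau> in at 0. norm (norm (coord c (the (flow_composition A X cs \<tau> x)) - coord c (the (flow A Z \<tau> x)))) \<le> C * norm (\<tau> ^ (K + 1))"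
    using G' \<phi>' eventually_compose_filterlim[OF C lim]
    by eventually_elim (simp add: coord_chart_inv[OF A c] norm_power abs_mult power_abs)
  from bigoI[OF this]
  show "(\<forall>\<^sub>F \<tau> in at 0. \<exists>y\<in>chart_dom c. flow_composition A X cs \<tau> x = Some y) \<and>
       (\<forall>\<^sub>F \<tau> in at 0. \<exists>y\<in>chart_dom c. flow A Z \<tau> x = Some y) \<and>
       (\<lambda>\<tau>. norm (coord c (the (flow_composition A X cs \<tau> x)) - coord c (the (flow A Z \<tau> x)))) \<in> O[at 0](\<lambda>\<tau>. \<tau> ^ (K + 1))"
  proof (intro conjI)
    show "\<forall>\<^sub>F \<tau> in at 0. \<exists>y\<in>chart_dom c. flow_composition A X cs \<tau> x = Some y"
      using G' by eventually_elim (use chart_inv_in_dom[OF A c] in blast)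
    show "\<forall>\<^sub>F \<tau> in at 0. \<exists>y\<in>chart_dom c. flow A Z \<tau> x = Some y"
      using \<phi>' by eventually_elim (use chart_inv_in_dom[OF A c] in blast)
  qed
qed

theorem corollary1:
  fixes A :: "('m::{t2_space, second_countable_topology}, 'e::euclidean_space) chart set"
    and \<eta> :: "('m, 'e) oneform"
    and n N :: nat
    and H :: "'m \<Rightarrow> real"
    and \<phi> :: "nat \<Rightarrow> 'm \<Rightarrow> real"
    and X_H :: "('m, 'e) vfield"
    and X :: "nat \<Rightarrow> ('m, 'e) vfield"
  assumes "exact_contact_manifold n A \<eta>"
    and "1 \<le> N"
    and "smooth_function A H"
    and "\<And>j. j \<in> {1..N} \<Longrightarrow> smooth_function A (\<phi> j)"
    and "\<And>x. x \<in> carrier A \<Longrightarrow> H x = (\<Sum>j=1..N. \<phi> j x)"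
    and "contact_hamiltonian_vf A \<eta> H X_H"
    and "\<And>j. j \<in> {1..N} \<Longrightarrow> contact_hamiltonian_vf A \<eta> (\<phi> j) (X j)"
  shows "\<forall>k\<ge>1. \<exists>cs :: (real \<times> nat) list.
           (\<forall>(c, j) \<in> set cs. j \<in> {1..N}) \<and>
           contact_integrator A \<eta> (flow_composition A X cs) \<and>
           integrator_of_order A X_H (2 * k) (flow_composition A X cs)"
proof (intro allI impI)
  fix k :: nat assume k: "1 \<le> k"
  let ?S = "{1..N}"
  have A: "smooth_atlas A" and \<eta>: "one_form A \<eta>"
    using assms(1) by (auto simp: exact_contact_manifold_def)
  have X: "vector_field A (X j)" if "j \<in> ?S" for j
    using assms(7)[OF that] by (simp add: contact_hamiltonian_vf_def)
  obtain cs where cs: "snd ` set cs \<subseteq> ?S" "exp_order ?S (2 * k) cs"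
    using exp_order_exists[of ?S k] k by blast
  \<comment> \<open>The empty list gives the one-letter word \<open>[1]\<close> the coefficient 0
    instead of 1; \<open>1 \<le> N\<close> puts this letter into the alphabet.\<close>
  have "cs \<noteq> []"
  proof
    assume "cs = []"
    moreover have "word_coeff cs [1] = 1 / fact (length [1::nat])"
      using cs(2) assms(2) k unfolding exp_order_def by (elim allE[of _ "[1]"]) auto
    ultimately show False by (simp add: word_one_def)
  qed
  have "contact_at A \<eta> (flow A (X j) t) x" if j: "j \<in> ?S" and xy: "flow A (X j) t x = Some y" for j t x y
  proof -
    obtain \<rho> where "\<And>c x v. c \<in> A \<Longrightarrow> x \<in> chart_dom c \<Longrightarrow> lie_deriv (X j c) (\<eta> c) (coord c x) v = \<rho> x * \<eta> c (coord c x) v"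
      using assms(7)[OF j] unfolding contact_hamiltonian_vf_def by blast
    then show ?thesis
      using contact_at_flow[OF A \<eta> X[OF j] exact_contact_form_nonzero[OF assms(1)] _ xy] by blast
  qed
  then have "contact_integrator A \<eta> (flow_composition A X cs)"
    unfolding contact_integrator_def
    using contact_at_flow_composition[OF A \<eta> _ \<open>cs \<noteq> []\<close> cs(1)]
    by (intro allI contact_map_if_contact_at) (auto simp: dom_def)
  moreover have "integrator_of_order A X_H (2 * k) (flow_composition A X cs)"
  proof (rule integrator_of_order_flow_composition[OF A _ X _ _ cs])
    show "vector_field A X_H" using assms(6) by (simp add: contact_hamiltonian_vf_def)
    show "X_H c x = (\<Sum>j\<in>?S. X j c x)" if "c \<in> A" "x \<in> coord c ` chart_dom c" for c x
      by (rule contact_hamiltonian_vf_sum[OF assms(1) _ assms(5-7) that]) auto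
  qed auto
  moreover have "\<forall>(c, j)\<in>set cs. j \<in> ?S" using cs(1) by force
  ultimately show "\<exists>cs :: (real \<times> nat) list.
           (\<forall>(c, j) \<in> set cs. j \<in> {1..N}) \<and>
           contact_integrator A \<eta> (flow_composition A X cs) \<and>
           integrator_of_order A X_H (2 * k) (flow_composition A X cs)"
    by blast
qed

end
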